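(* For all $P_1,P_2,N>0$ and $\sigma_2^2\ge0$, $$\mathcal C_{\mathrm{NoisyPartialFB}}(P_1,P_2,N,\sigma_2^2)\supseteq\mathcal R_{\mathrm P}(P_1,P_2,N,\sigma_2^2).$$
   Context: Channel model (noisy partial feedback). Fix $P_1,P_2,N>0$ and $\sigma_2^2\ge0$. Messages $M_1,M_2$ are independent and uniform on finite sets $\mathcal M_1,\mathcal M_2$. $\{Z_t\}$ is IID $\mathcal N(0,N)$, $\{W_{2,t}\}$ is IID $\mathcal N(0,\sigma_2^2)$, and $M_1,M_2,\{Z_t\},\{W_{2,t}\}$ are mutually independent. The output is $Y_t=X_{1,t}+X_{2,t}+Z_t$. Transmitter 1 has no feedback: $X_{1,t}=\varphi_{1,t}(M_1)$. Transmitter 2 observes causally $V_{2,t}=Y_t+W_{2,t}$: $X_{2,t}=\varphi_{2,t}(M_2,V_{2,1},\dots,V_{2,t-1})$. Encoders must satisfy $\frac1n\sum_{t=1}^n\mathbb E[X_{\nu,t}^2]\le P_\nu$, and the decoder is $\phi:\mathbb R^n\to\mathcal M_1\times\mathcal M_2$. Achievability of $(R_1,R_2)$: for every $\delta>0$ and all sufficiently large $n$ there is a blocklength-$n$ code with $\frac1n\log|\mathcal M_\nu|>R_\nu-\delta$ and error probability $\Pr[\phi(Y^n)\neq(M_1,M_2)]\to0$ as $n\to\infty$. $\mathcal C_{\mathrm{NoisyPartialFB}}(P_1,P_2,N,\sigma_2^2)$ is the set of achievable pairs. Region $\mathcal R_{\mathrm P}$. For a positive integer $\eta$, $\mathbf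 a_1,\mathbf a_2\in\mathbb R^\eta$, strictly lower-triangular $\mathsf B_2\in\mathbb R^{\eta\times\eta}$, $\mathsf C\in\mathbb R^{2\times\eta}$, let $\mathsf A=(\mathbf a_1\ \mathbf a_2)$ and $\mathsf Q_{\mathrm P}=N\mathsf I_\eta+\sigma_2^2\mathsf B_2\mathsf B_2^{\mathsf T}$. If $\mathsf C\mathsf C^{\mathsf T}$ is nonsingular, $\mathcal R^{N,\sigma_2^2}_{\mathrm P,\eta}(\mathbf a_1,\mathbf a_2,\mathsf B_2,\mathsf C)$ is the set of nonnegative $(R_1,R_2)$ with $R_1\le\frac1{2\eta}\log\frac{\det(\mathsf C(\mathbf a_1\mathbf a_1^{\mathsf T}+\mathsf Q_{\mathrm P})\mathsf C^{\mathsf T})}{\det(\mathsf C\mathsf Q_{\mathrm P}\mathsf C^{\mathsf T})}$, $R_2\le\frac1{2\eta}\log\frac{\det(\mathsf C(\mathbf a_2\mathbf a_2^{\mathsf T}+\mathsf Q_{\mathrm P})\mathsf C^{\mathsf T})}{\det(\mathsf C\mathsf Q_{\mathrm P}\mathsf C^{\mathsf T})}$, $R_1+R_2\le\frac1{2\eta}\log\frac{\det(\mathsf C(\mathsf A\mathsf A^{\mathsf T}+\mathsf Q_{\mathrm P})\mathsf C^{\mathsf T})}{\det(\mathsf C\mathsf Q_{\mathrm P}\mathsf C^{\mathsf T})}$; if $\mathsf C\mathsf C^{\mathsf T}$ is singular but $\mathsf C\ne0$, the same with $\mathsf C$ replaced by any nonzero row; if $\mathsf C=0$, $\{(0,0)\}$.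 Power constraints: $\mathbf a_1^{\mathsf T}\mathbf a_1\le\eta P_1$ and $\mathrm{tr}\big((\mathsf I_\eta-\mathsf B_2)^{-1}(\mathbf a_2\mathbf a_2^{\mathsf T}+\mathsf B_2\mathbf a_1\mathbf a_1^{\mathsf T}\mathsf B_2^{\mathsf T}+(N+\sigma_2^2)\mathsf B_2\mathsf B_2^{\mathsf T})(\mathsf I_\eta-\mathsf B_2)^{-\mathsf T}\big)\le\eta P_2$. $\mathcal R_{\mathrm P}(P_1,P_2,N,\sigma_2^2)$ is the closure of the union of $\mathcal R^{N,\sigma_2^2}_{\mathrm P,\eta}(\mathbf a_1,\mathbf a_2,\mathsf B_2,\mathsf C)$ over all $(\eta,\mathbf a_1,\mathbf a_2,\mathsf B_2,\mathsf C)$ satisfying the power constraints. *)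

theory Defs
  imports "HOL-Probability.Probability" "Jordan_Normal_Form.Determinant"
begin

text \<open>A blocklength-n code.  Time is indexed 0..n-1.  Message sets are {0..<msz1}, {0..<msz2}.
  enc1 t m1 is X_{1,t}; enc2 t m2 vs is X_{2,t}, where vs is the list of past feedback
  observations V_{2,0},...,V_{2,t-1}; dec maps the received block (a function on {0..<n}) to a
  message pair.\<close>

record code =
  msz1 :: nat
  msz2 :: nat
  enc1 :: "nat \<Rightarrow> nat \<Rightarrow> real"
  enc2 :: "nat \<Rightarrow> nat \<Rightarrow> real list \<Rightarrow> real"
  dec  :: "(nat \<Rightarrow> real) \<Rightarrow> nat \<times> nat"

definition gauss :: "real \<Rightarrow> real measure" where
  "gauss v = (if v = 0 then return borel 0 else density lborel (normal_density 0 (sqrt v)))"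

definition noise_space :: "nat \<Rightarrow> real \<Rightarrow> real \<Rightarrow> ((nat \<Rightarrow> real) \<times> (nat \<Rightarrow> real)) measure" where
  "noise_space n N s2 = (PiM {..<n} (\<lambda>_. gauss N)) \<Otimes>\<^sub>M (PiM {..<n} (\<lambda>_. gauss s2))"

text \<open>Feedback observations V_{2,0},...,V_{2,t-1} for messages m1 m2 and noise z w,
  with V_{2,s} = Y_s + W_{2,s} and Y_s = X_{1,s} + X_{2,s} + Z_s.\<close>
fun vlist :: "code \<Rightarrow> nat \<Rightarrow> nat \<Rightarrow> (nat \<Rightarrow> real) \<Rightarrow> (nat \<Rightarrow> real) \<Rightarrow> nat \<Rightarrow> real list" where
  "vlist c m1 m2 z w 0 = []"
| "vlist c m1 m2 z w (Suc t) =
     (let vs = vlist c m1 m2 z w t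
      in vs @ [enc1 c t m1 + enc2 c t m2 vs + z t + w t])"

definition x2 :: "code \<Rightarrow> nat \<Rightarrow> nat \<Rightarrow> (nat \<Rightarrow> real) \<Rightarrow> (nat \<Rightarrow> real) \<Rightarrow> nat \<Rightarrow> real" where
  "x2 c m1 m2 z w t = enc2 c t m2 (vlist c m1 m2 z w t)"

definition yout :: "code \<Rightarrow> nat \<Rightarrow> nat \<Rightarrow> (nat \<Rightarrow> real) \<Rightarrow> (nat \<Rightarrow> real) \<Rightarrow> nat \<Rightarrow> real" where
  "yout c m1 m2 z w t = enc1 c t m1 + x2 c m1 m2 z w t + z t"

definition decoded :: "code \<Rightarrow> nat \<Rightarrow> nat \<Rightarrow> nat \<Rightarrow> (nat \<Rightarrow> real) \<times> (nat \<Rightarrow> real) \<Rightarrow> nat \<times> nat" where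
  "decoded c n m1 m2 \<omega> = dec c (restrict (yout c m1 m2 (fst \<omega>) (snd \<omega>)) {..<n})"

text \<open>Admissible blocklength-n code: nonempty message sets, measurable encoder-2 outputs and
  decoder (so that probabilities/expectations are defined), and the power constraints
  (1/n) sum_t E[X_{nu,t}^2] <= P_nu, expectations over uniform messages and noise.\<close>
definition valid_code :: "real \<Rightarrow> real \<Rightarrow> real \<Rightarrow> real \<Rightarrow> nat \<Rightarrow> code \<Rightarrow> bool" where
  "valid_code P1 P2 N s2 n c \<longleftrightarrow>
     msz1 c \<ge> 1 \<and> msz2 c \<ge> 1 \<and>
     (\<forall>m1<msz1 c. \<forall>m2<msz2 c.
        (\<forall>t<n. (\<lambda>\<omega>. x2 c m1 m2 (fst \<omega>) (snd \<omega>) t) \<in> borel_measurable (noise_space n N s2)) \<and>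
        decoded c n m1 m2 \<in> noise_space n N s2 \<rightarrow>\<^sub>M count_space UNIV) \<and>
     (\<Sum>t<n. \<Sum>m1<msz1 c. (enc1 c t m1)\<^sup>2) \<le> real n * real (msz1 c) * P1 \<and>
     (\<Sum>t<n. \<Sum>m1<msz1 c. \<Sum>m2<msz2 c.
        \<integral>\<^sup>+ \<omega>. ennreal ((x2 c m1 m2 (fst \<omega>) (snd \<omega>) t)\<^sup>2) \<partial>(noise_space n N s2))
       \<le> ennreal (real n * real (msz1 c) * real (msz2 c) * P2)"

definition err_prob :: "real \<Rightarrow> real \<Rightarrow> nat \<Rightarrow> code \<Rightarrow> real" where
  "err_prob N s2 n c =
     (\<Sum>m1<msz1 c. \<Sum>m2<msz2 c.
        measure (noise_space n N s2)
          {\<omega> \<in> space (noise_space n N s2). decoded c n m1 m2 \<omega> \<noteq> (m1, m2)})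
     / (real (msz1 c) * real (msz2 c))"

definition achievable :: "real \<Rightarrow> real \<Rightarrow> real \<Rightarrow> real \<Rightarrow> real \<times> real \<Rightarrow> bool" where
  "achievable P1 P2 N s2 R \<longleftrightarrow>
     (\<forall>\<delta>>0. \<exists>cs :: nat \<Rightarrow> code.
        (\<forall>\<^sub>F n in sequentially. valid_code P1 P2 N s2 n (cs n) \<and>
            ln (real (msz1 (cs n))) / real n > fst R - \<delta> \<and>
            ln (real (msz2 (cs n))) / real n > snd R - \<delta>) \<and>
        (\<lambda>n. err_prob N s2 n (cs n)) \<longlonglongrightarrow> 0)"

definition capacity_NoisyPartialFB :: "real \<Rightarrow> real \<Rightarrow> real \<Rightarrow> real \<Rightarrow> (real \<times> real) set" where
  "capacity_NoisyPartialFB P1 P2 N s2 = {R. achievable P1 P2 N s2 R}"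

definition outer_mat :: "real vec \<Rightarrow> real mat" where
  "outer_mat a = mat (dim_vec a) (dim_vec a) (\<lambda>(i,j). a $ i * a $ j)"

definition trace_mat :: "real mat \<Rightarrow> real" where
  "trace_mat A = (\<Sum>i<dim_row A. A $$ (i,i))"

definition inv_mat :: "real mat \<Rightarrow> real mat" where
  "inv_mat A = (SOME B. B \<in> carrier_mat (dim_row A) (dim_row A) \<and> inverts_mat A B \<and> inverts_mat B A)"

definition strictly_lower :: "nat \<Rightarrow> real mat \<Rightarrow> bool" where
  "strictly_lower \<eta> B \<longleftrightarrow> B \<in> carrier_mat \<eta> \<eta> \<and> (\<forall>i<\<eta>. \<forall>j<\<eta>. i \<le> j \<longrightarrow> B $$ (i,j) = 0)"

definition QP :: "real \<Rightarrow> real \<Rightarrow> nat \<Rightarrow> real mat \<Rightarrow> real mat" where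
  "QP N s2 \<eta> B2 = N \<cdot>\<^sub>m 1\<^sub>m \<eta> + s2 \<cdot>\<^sub>m (B2 * transpose_mat B2)"

definition rate_bound :: "nat \<Rightarrow> real mat \<Rightarrow> real mat \<Rightarrow> real mat \<Rightarrow> real" where
  "rate_bound \<eta> D S Q =
     ln (det (D * (S + Q) * transpose_mat D) / det (D * Q * transpose_mat D)) / (2 * real \<eta>)"

definition pent :: "real \<Rightarrow> real \<Rightarrow> nat \<Rightarrow> real vec \<Rightarrow> real vec \<Rightarrow> real mat \<Rightarrow> real mat \<Rightarrow> (real \<times> real) set" where
  "pent N s2 \<eta> a1 a2 B2 D =
     (let Q = QP N s2 \<eta> B2 in
      {(R1, R2). 0 \<le> R1 \<and> 0 \<le> R2 \<and>
        R1 \<le> rate_bound \<eta> D (outer_mat a1) Q \<and>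
        R2 \<le> rate_bound \<eta> D (outer_mat a2) Q \<and>
        R1 + R2 \<le> rate_bound \<eta> D (outer_mat a1 + outer_mat a2) Q})"

definition region_P_eta :: "real \<Rightarrow> real \<Rightarrow> nat \<Rightarrow> real vec \<Rightarrow> real vec \<Rightarrow> real mat \<Rightarrow> real mat \<Rightarrow> (real \<times> real) set" where
  "region_P_eta N s2 \<eta> a1 a2 B2 C =
     (if det (C * transpose_mat C) \<noteq> 0 then pent N s2 \<eta> a1 a2 B2 C
      else if C \<noteq> 0\<^sub>m 2 \<eta> then
        (\<Union>i\<in>{i. i < 2 \<and> row C i \<noteq> 0\<^sub>v \<eta>}. pent N s2 \<eta> a1 a2 B2 (mat_of_rows \<eta> [row C i]))
      else {(0, 0)})"

definition power_ok :: "real \<Rightarrow> real \<Rightarrow> real \<Rightarrow> real \<Rightarrow> nat \<Rightarrow> real vec \<Rightarrow> real vec \<Rightarrow> real mat \<Rightarrow> bool" where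
  "power_ok P1 P2 N s2 \<eta> a1 a2 B2 \<longleftrightarrow>
     a1 \<bullet> a1 \<le> real \<eta> * P1 \<and>
     (let G = inv_mat (1\<^sub>m \<eta> - B2) in
       trace_mat (G * (outer_mat a2 + B2 * outer_mat a1 * transpose_mat B2
                       + (N + s2) \<cdot>\<^sub>m (B2 * transpose_mat B2)) * transpose_mat G)
       \<le> real \<eta> * P2)"

definition region_P :: "real \<Rightarrow> real \<Rightarrow> real \<Rightarrow> real \<Rightarrow> (real \<times> real) set" where
  "region_P P1 P2 N s2 = closure (\<Union> {region_P_eta N s2 \<eta> a1 a2 B2 C | \<eta> a1 a2 B2 C.
      0 < \<eta> \<and> a1 \<in> carrier_vec \<eta> \<and> a2 \<in> carrier_vec \<eta> \<and> strictly_lower \<eta> B2 \<and>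
      C \<in> carrier_mat 2 \<eta> \<and> power_ok P1 P2 N s2 \<eta> a1 a2 B2})"

end

theory Submission
  imports Defs
begin

text \<open>Group the channel uses into blocks of length \<open>\<eta>\<close>, and let both transmitters send one Gaussian symbol
  per block along \<open>a\<^sub>1\<close> and \<open>a\<^sub>2\<close>, transmitter 2 adding \<open>B\<close> times its feedback.  Then \<open>(I - B) y =
  a\<^sub>1 \<xi>\<^sub>1 + a\<^sub>2 \<xi>\<^sub>2 + z + B w\<close>, a memoryless Gaussian multiple-access channel with noise covariance \<open>Q\<close>.
  For random Gaussian codebooks and a decoder that thresholds three log-likelihood ratios, wrong
  codewords are excluded by Markov's inequality, because the exponential of each ratio has mean 1
  under an independent codeword, and the true pair passes by Chebyshev's inequality, because each
  ratio is a sum over blocks of independent quadratic forms of Gaussians.  Chebyshev's inequality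
  also controls the transmitted power averaged over the messages; the slack it needs comes from
  scaling the symbols down by a factor close to 1.\<close>

section \<open>Second moments of Gaussian quadratic forms\<close>

text \<open>A deterministic code must decode reliably and meet the power constraints at once. Both
  demands go into one expectation: to the failure probability of a random code a penalty is added,
  the squared deviation of the block energies from their means, scaled so that an average penalty of
  at most 1 keeps the average energies below the limits. A single pair of codebooks that keeps the
  sum below \<open>d < 1\<close> serves both purposes, and no codeword has to be discarded. The
  penalty concerns codeword energy only, because the noise fed back by transmitter 2 has the same
  energy for every codebook.

  The decoder sees two scalars per block, the outputs of matched filters. Their signal gains equal
  their noise covariances, so all three ratios are sums of one scalar formula, \<open>score\<close>.
  The ratio of a pair is split so that one word at a time can be integrated out. The bounds for the
  true pair are constants divided by the number of blocks; this asks only for fourth moments that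
  are finite and the same in every block.\<close>

lemma prob_space_gauss: "0 \<le> v \<Longrightarrow> prob_space (gauss v)"
  by (auto simp: gauss_def intro!: prob_space_return prob_space_normal_density)

lemma sets_gauss [simp, measurable_cong]: "sets (gauss v) = sets borel"
  by (simp add: gauss_def)

lemma space_gauss [simp]: "space (gauss v) = UNIV"
  by (simp add: gauss_def)

text \<open>The variance 0 must be allowed because the feedback noise may vanish.
  \<open>gauss 0\<close> is the point mass at 0, hence the case split in each moment
  computation.\<close>

lemma integrable_gauss_power:
  assumes "0 \<le> v"
  shows "integrable (gauss v) (\<lambda>x. x ^ k)"
proof (cases "v = 0")
  case True
  have "integrable (return borel (0::real)) (\<lambda>x. x ^ k)"
    by (intro integrableI_bounded) (auto simp: nn_integral_return)
  then show ?thesis using True by (simp add: gauss_def)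
next
  case False
  then have "sqrt v > 0" using assms by simp
  from integrable_normal_moment[OF this, of 0 k] show ?thesis
    using False by (simp add: gauss_def integrable_density)
qed

lemma integral_gauss_id:
  assumes "0 \<le> v" shows "(\<integral>x. x \<partial>gauss v) = 0"
proof (cases "v = 0")
  case True then show ?thesis by (simp add: gauss_def integral_return)
next
  case False
  then have "sqrt v > 0" using assms by simp
  from integral_normal_moment_nz_1[OF this, of 0] show ?thesis
    using False by (simp add: gauss_def integral_density)
qed

lemma integral_gauss_power2:
  assumes "0 \<le> v" shows "(\<integral>x. x\<^sup>2 \<partial>gauss v) = v"
proof (cases "v = 0")
  case True then show ?thesis by (simp add: gauss_def integral_return)
next
  case False
  then have "sqrt v > 0" using assms by simp
  from integral_normal_moment_even[OF this, of 0 1] show ?thesis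
    using False assms by (simp add: gauss_def integral_density power2_eq_square fact_numeral)
qed

text \<open>The log-likelihood ratio of \<open>b = c x + \<nu>\<close> with \<open>\<nu> \<sim> N(0, c)\<close> against its marginal \<open>N(0, c (1 + c))\<close>
  for \<open>x \<sim> N(0, 1)\<close>.\<close>

definition score :: "real \<Rightarrow> real \<Rightarrow> real \<Rightarrow> real" where
  "score c b x = b * x - c * x\<^sup>2 / 2 - b\<^sup>2 / (2 * (1 + c)) + ln (1 + c) / 2"

lemma score_measurable [measurable]:
  assumes [measurable]: "f \<in> borel_measurable M" "g \<in> borel_measurable M"
  shows "(\<lambda>x. score c (f x) (g x)) \<in> borel_measurable M"
  unfolding score_def by measurable

text \<open>Completing the square: the standard normal density times
  \<open>exp (score c b x)\<close> is the density of x given b, normal with mean b / (1 + c) and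
  variance 1 / (1 + c).\<close>

lemma nn_integral_exp_score:
  assumes c: "0 \<le> c"
  shows "(\<integral>\<^sup>+x. ennreal (exp (score c b x)) \<partial>gauss 1) = 1"
proof -
  define s where "s = 1 / sqrt (1 + c)"
  have s: "s > 0" using c by (simp add: s_def)
  have s2: "s\<^sup>2 = 1 / (1 + c)" using c by (simp add: s_def power_divide)
  have eq: "normal_density 0 1 x * exp (score c b x) = normal_density (b / (1 + c)) s x" for x
  proof -
    have e: "exp (ln (1 + c) / 2) = sqrt (1 + c)"
      using c by (simp add: powr_half_sqrt[symmetric] powr_def)
    have "- (x - b / (1 + c))\<^sup>2 / (2 * s\<^sup>2)
        = - x\<^sup>2 / 2 + (b * x - c * x\<^sup>2 / 2 - b\<^sup>2 / (2 * (1 + c)))"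
      using c unfolding s2 by (simp add: field_simps power2_eq_square add_nonneg_eq_0_iff)
    then have "normal_density (b / (1 + c)) s x =
        1 / sqrt (2 * pi * s\<^sup>2) * exp (- x\<^sup>2 / 2 + (b * x - c * x\<^sup>2 / 2 - b\<^sup>2 / (2 * (1 + c))))"
      unfolding normal_density_def by simp
    also have "1 / sqrt (2 * pi * s\<^sup>2) = 1 / sqrt (2 * pi) * exp (ln (1 + c) / 2)"
      using c unfolding e s2 by (simp add: real_sqrt_divide real_sqrt_mult)
    finally show ?thesis
      by (simp add: normal_density_def score_def exp_add[symmetric] algebra_simps)
  qed
  have "(\<integral>\<^sup>+x. ennreal (exp (score c b x)) \<partial>gauss 1)
      = (\<integral>\<^sup>+x. ennreal (normal_density (b / (1 + c)) s x) \<partial>lborel)"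
    by (simp add: gauss_def nn_integral_density ennreal_mult[symmetric] eq)
  also have "\<dots> = emeasure (density lborel (normal_density (b / (1 + c)) s)) UNIV"
    by (simp add: emeasure_density)
  also have "\<dots> = 1"
    using prob_space.emeasure_space_1[OF prob_space_normal_density[OF s]] by simp
  finally show ?thesis .
qed

section \<open>Second moments of sums of independent variables\<close>

lemma abs_mult_le_add_squares: "\<bar>a * b\<bar> \<le> a\<^sup>2 + (b::real)\<^sup>2"
proof -
  have "2 * (\<bar>a\<bar> * \<bar>b\<bar>) \<le> \<bar>a\<bar>\<^sup>2 + \<bar>b\<bar>\<^sup>2" using sum_squares_bound[of "\<bar>a\<bar>" "\<bar>b\<bar>"] by simp
  moreover have "0 \<le> \<bar>a\<bar> * \<bar>b\<bar>" by simp
  ultimately have "\<bar>a\<bar> * \<bar>b\<bar> \<le> \<bar>a\<bar>\<^sup>2 + \<bar>b\<bar>\<^sup>2" by linarith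
  then show ?thesis by (simp add: abs_mult)
qed

lemma integrable_mult_of_squares:
  fixes f g :: "'a \<Rightarrow> real"
  assumes [measurable]: "f \<in> borel_measurable M" "g \<in> borel_measurable M"
    and "integrable M (\<lambda>x. (f x)\<^sup>2)" "integrable M (\<lambda>x. (g x)\<^sup>2)"
  shows "integrable M (\<lambda>x. f x * g x)"
  by (rule Bochner_Integration.integrable_bound[OF Bochner_Integration.integrable_add[OF assms(3,4)]])
     (auto simp: abs_mult_le_add_squares)

lemma (in prob_space) integrable_of_square:
  fixes f :: "'a \<Rightarrow> real"
  assumes [measurable]: "f \<in> borel_measurable M" and "integrable M (\<lambda>x. (f x)\<^sup>2)"
  shows "integrable M f"
  using integrable_mult_of_squares[OF assms(1) borel_measurable_const[of 1] assms(2)] by simp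

text \<open>Induction on the index set: independence and zero means remove the cross term.
  Integrability is carried along because the cross term must be integrable before it can be split
  off.\<close>

lemma (in prob_space) second_moment_sum_indep:
  fixes F :: "'k \<Rightarrow> 'a \<Rightarrow> real"
  assumes "finite K" and "indep_vars (\<lambda>_. borel) F K"
    and "\<And>k. k \<in> K \<Longrightarrow> integrable M (\<lambda>x. (F k x)\<^sup>2)"
    and "\<And>k. k \<in> K \<Longrightarrow> expectation (F k) = 0"
    and "\<And>k. k \<in> K \<Longrightarrow> expectation (\<lambda>x. (F k x)\<^sup>2) \<le> V"
  shows "integrable M (\<lambda>x. (\<Sum>k\<in>K. F k x)\<^sup>2) \<and>
         expectation (\<lambda>x. (\<Sum>k\<in>K. F k x)\<^sup>2) \<le> real (card K) * V"
  using assms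
proof (induction K rule: finite_induct)
  case empty
  then show ?case by simp
next
  case (insert k K)
  have meas [measurable]: "F j \<in> borel_measurable M" if "j \<in> insert k K" for j
    using insert.prems(1) that by (auto simp: indep_vars_def)
  let ?S = "\<lambda>x. \<Sum>k\<in>K. F k x"
  have indK: "indep_vars (\<lambda>_. borel) F K"
    using insert.prems(1) by (rule indep_vars_subset) auto
  have IH: "integrable M (\<lambda>x. (?S x)\<^sup>2)" "expectation (\<lambda>x. (?S x)\<^sup>2) \<le> real (card K) * V"
    using insert.IH[OF indK] insert.prems by auto
  have ind: "indep_var borel (F k) borel ?S"
    using insert.hyps insert.prems(1) by (intro indep_vars_sum) auto
  have mS [measurable]: "?S \<in> borel_measurable M" by (intro borel_measurable_sum) auto
  have mk [measurable]: "F k \<in> borel_measurable M" by auto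
  have sqk: "integrable M (\<lambda>x. (F k x)\<^sup>2)" using insert.prems by auto
  have ik: "integrable M (F k)" by (rule integrable_of_square[OF mk sqk])
  have iS: "integrable M ?S" by (rule integrable_of_square[OF mS IH(1)])
  have ikS: "integrable M (\<lambda>x. F k x * ?S x)" by (rule integrable_mult_of_squares[OF mk mS sqk IH(1)])
  have z: "expectation (\<lambda>x. F k x * ?S x) = 0"
    using indep_var_lebesgue_integral[OF ind ik iS] insert.prems(3)[of k] by simp
  have eq: "(\<Sum>k\<in>insert k K. F k x)\<^sup>2 = (F k x)\<^sup>2 + (2 * (F k x * ?S x) + (?S x)\<^sup>2)" for x
    using insert.hyps by (simp add: power2_sum algebra_simps)
  have "expectation (\<lambda>x. (\<Sum>k\<in>insert k K. F k x)\<^sup>2)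
      = expectation (\<lambda>x. (F k x)\<^sup>2) + (2 * expectation (\<lambda>x. F k x * ?S x) + expectation (\<lambda>x. (?S x)\<^sup>2))"
    unfolding eq using sqk ikS IH(1)
    by (subst Bochner_Integration.integral_add; (subst Bochner_Integration.integral_add)?; simp)
  moreover have "integrable M (\<lambda>x. (\<Sum>k\<in>insert k K. F k x)\<^sup>2)"
    unfolding eq using sqk ikS IH(1) by simp
  moreover have "expectation (\<lambda>x. (F k x)\<^sup>2) \<le> V" using insert.prems by auto
  ultimately show ?case using z IH(2) insert.hyps by (simp add: algebra_simps)
qed

text \<open>The joint law of the coordinates is the product of their marginal laws, which is
  independence. That characterization is for nonempty index sets, so the empty one is treated
  apart.\<close>

lemma indep_vars_PiM_components:
  assumes "\<And>i. i \<in> I \<Longrightarrow> prob_space (M i)"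
  shows "prob_space.indep_vars (PiM I M) M (\<lambda>i \<omega>. \<omega> i) I"
proof (cases "I = {}")
  case True
  interpret prob_space "PiM I M" using assms by (rule prob_space_PiM)
  show ?thesis unfolding indep_vars_def indep_sets_def using True by simp
next
  case False
  interpret prob_space "PiM I M" using assms by (rule prob_space_PiM)
  have "distr (PiM I M) (PiM I M) (\<lambda>x. \<lambda>i\<in>I. x i) = distr (PiM I M) (PiM I M) (\<lambda>x. x)"
    by (intro distr_cong) (auto simp: space_PiM)
  also have "\<dots> = (\<Pi>\<^sub>M i\<in>I. distr (PiM I M) (M i) (\<lambda>x. x i))"
    using assms by (simp add: distr_PiM_component cong: PiM_cong)
  finally show ?thesis
    using False by (subst indep_vars_iff_distr_eq_PiM') auto
qed

text \<open>Cauchy-Schwarz against the constant 1, applied twice.\<close>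

lemma sum_power4_le:
  fixes x :: "'j \<Rightarrow> real"
  shows "(\<Sum>j\<in>J. x j) ^ 4 \<le> real (card J) ^ 3 * (\<Sum>j\<in>J. x j ^ 4)"
proof -
  have "(\<Sum>j\<in>J. x j) ^ 4 = ((\<Sum>j\<in>J. x j)\<^sup>2)\<^sup>2" by simp
  also have "\<dots> \<le> ((\<Sum>j\<in>J. (x j)\<^sup>2) * real (card J))\<^sup>2"
    by (rule power_mono[OF sum_squared_le_sum_of_squares]) simp
  also have "\<dots> = (\<Sum>j\<in>J. (x j)\<^sup>2)\<^sup>2 * (real (card J))\<^sup>2" by (simp add: power_mult_distrib)
  also have "\<dots> \<le> ((\<Sum>j\<in>J. ((x j)\<^sup>2)\<^sup>2) * real (card J)) * (real (card J))\<^sup>2"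
    by (rule mult_right_mono[OF sum_squared_le_sum_of_squares]) simp
  also have "\<dots> = real (card J) ^ 3 * (\<Sum>j\<in>J. x j ^ 4)"
    by (simp add: power2_eq_square[of "real (card J)"] power3_eq_cube)
  finally show ?thesis .
qed

section \<open>Linear forms in independent Gaussian coordinates\<close>

context
  fixes I :: "'i set" and v :: "'i \<Rightarrow> real" and P
  assumes v: "\<And>i. 0 \<le> v i"
  defines "P \<equiv> PiM I (\<lambda>i. gauss (v i))"
begin

lemma prob_space_gauss_PiM: "prob_space P"
  unfolding P_def by (intro prob_space_PiM prob_space_gauss v)

lemma gauss_PiM_component:
  assumes "i \<in> I" and [measurable]: "g \<in> borel_measurable borel"
  shows "(\<integral>\<omega>. g (\<omega> i) \<partial>P) = (\<integral>x. (g x :: real) \<partial>gauss (v i))"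
    and "integrable P (\<lambda>\<omega>. g (\<omega> i)) \<longleftrightarrow> integrable (gauss (v i)) g"
proof -
  have d: "distr P (gauss (v i)) (\<lambda>\<omega>. \<omega> i) = gauss (v i)"
    unfolding P_def using assms by (intro distr_PiM_component prob_space_gauss v)
  have [measurable]: "(\<lambda>\<omega>. \<omega> i) \<in> P \<rightarrow>\<^sub>M gauss (v i)"
    unfolding P_def using assms(1) by simp
  show "(\<integral>\<omega>. g (\<omega> i) \<partial>P) = (\<integral>x. g x \<partial>gauss (v i))"
    by (subst d[symmetric], subst integral_distr) auto
  show "integrable P (\<lambda>\<omega>. g (\<omega> i)) \<longleftrightarrow> integrable (gauss (v i)) g"
    by (subst d[symmetric], subst integrable_distr_eq) auto
qed

lemma component_measurable_gauss_PiM: "i \<in> I \<Longrightarrow> (\<lambda>\<omega>. \<omega> i) \<in> borel_measurable P"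
  unfolding P_def by (subst measurable_cong_sets[OF refl sets_gauss[symmetric, of "v i"]]) simp

lemma gauss_PiM_covariance:
  assumes "i \<in> I" "j \<in> I"
  shows "integrable P (\<lambda>\<omega>. \<omega> i * \<omega> j)" "(\<integral>\<omega>. \<omega> i * \<omega> j \<partial>P) = (if i = j then v i else 0)"
proof -
  interpret prob_space P by (rule prob_space_gauss_PiM)
  have sq: "integrable P (\<lambda>\<omega>. (\<omega> i)\<^sup>2)" if "i \<in> I" for i
    using gauss_PiM_component(2)[OF that, of "\<lambda>x. x\<^sup>2"] integrable_gauss_power[OF v, of i 2] by simp
  show "integrable P (\<lambda>\<omega>. \<omega> i * \<omega> j)"
    using assms by (intro integrable_mult_of_squares sq component_measurable_gauss_PiM)
  show "(\<integral>\<omega>. \<omega> i * \<omega> j \<partial>P) = (if i = j then v i else 0)"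
  proof (cases "i = j")
    case True
    then show ?thesis
      using gauss_PiM_component(1)[OF assms(1), of "\<lambda>x. x\<^sup>2"] integral_gauss_power2[OF v, of i]
      by (simp add: power2_eq_square)
  next
    case False
    have "indep_vars (\<lambda>i. gauss (v i)) (\<lambda>i \<omega>. \<omega> i) I"
      unfolding P_def by (intro indep_vars_PiM_components prob_space_gauss v)
    then have "indep_vars (\<lambda>i. gauss (v i)) (\<lambda>i \<omega>. \<omega> i) {i, j}"
      by (rule indep_vars_subset) (use assms in auto)
    then have "indep_vars (\<lambda>_. borel) (\<lambda>i \<omega>. \<omega> i) {i, j}"
      by (rule indep_vars_compose2[where Y = "\<lambda>_ x. x"]) (rule measurable_ident_sets[OF sets_gauss])
    then have "(\<integral>\<omega>. (\<Prod>l\<in>{i, j}. \<omega> l) \<partial>P) = (\<Prod>l\<in>{i, j}. \<integral>\<omega>. \<omega> l \<partial>P)"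
      by (intro indep_vars_lebesgue_integral)
         (use assms in \<open>auto intro!: integrable_of_square sq component_measurable_gauss_PiM\<close>)
    moreover have "(\<integral>\<omega>. \<omega> i \<partial>P) = 0"
      using gauss_PiM_component(1)[OF assms(1), of "\<lambda>x. x"] integral_gauss_id[OF v, of i] by simp
    ultimately show ?thesis using False by simp
  qed
qed

text \<open>\<open>J\<close> is a template of one block and \<open>\<phi> k\<close> places it into
  the index set of the product. Disjoint images make the blocks independent; equal variances make
  the constants below independent of \<open>k\<close>.\<close>

context
  fixes J :: "'j set" and K :: "'k set" and \<phi> :: "'k \<Rightarrow> 'j \<Rightarrow> 'i" and u :: "'j \<Rightarrow> real"
  assumes finJ: "finite J" and finK: "finite K"
    and \<phi>: "\<And>k j. k \<in> K \<Longrightarrow> j \<in> J \<Longrightarrow> \<phi> k j \<in> I \<and> v (\<phi> k j) = u j"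
    and inj: "\<And>k. k \<in> K \<Longrightarrow> inj_on (\<phi> k) J"
    and disj: "disjoint_family_on (\<lambda>k. \<phi> k ` J) K"
begin

lemma gauss_PiM_linear_form_covariance:
  assumes k: "k \<in> K"
  shows "integrable P (\<lambda>\<omega>. (\<Sum>j\<in>J. d j * \<omega> (\<phi> k j)) * (\<Sum>j\<in>J. e j * \<omega> (\<phi> k j)))"
    and "(\<integral>\<omega>. (\<Sum>j\<in>J. d j * \<omega> (\<phi> k j)) * (\<Sum>j\<in>J. e j * \<omega> (\<phi> k j)) \<partial>P) = (\<Sum>j\<in>J. d j * e j * u j)"
proof -
  have eq: "(\<Sum>j\<in>J. d j * \<omega> (\<phi> k j)) * (\<Sum>j\<in>J. e j * \<omega> (\<phi> k j))
      = (\<Sum>i\<in>J. \<Sum>j\<in>J. d i * e j * (\<omega> (\<phi> k i) * \<omega> (\<phi> k j)))" for \<omega>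
    by (simp add: sum_product ac_simps)
  have int: "integrable P (\<lambda>\<omega>. d i * e j * (\<omega> (\<phi> k i) * \<omega> (\<phi> k j)))" if "i \<in> J" "j \<in> J" for i j
    using that k by (intro integrable_mult_right gauss_PiM_covariance) (auto simp: \<phi>)
  show "integrable P (\<lambda>\<omega>. (\<Sum>j\<in>J. d j * \<omega> (\<phi> k j)) * (\<Sum>j\<in>J. e j * \<omega> (\<phi> k j)))"
    unfolding eq by (intro Bochner_Integration.integrable_sum int)
  have "(\<integral>\<omega>. (\<Sum>j\<in>J. d j * \<omega> (\<phi> k j)) * (\<Sum>j\<in>J. e j * \<omega> (\<phi> k j)) \<partial>P)
      = (\<Sum>i\<in>J. \<Sum>j\<in>J. \<integral>\<omega>. d i * e j * (\<omega> (\<phi> k i) * \<omega> (\<phi> k j)) \<partial>P)"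
    unfolding eq
    by (subst Bochner_Integration.integral_sum, intro Bochner_Integration.integrable_sum int, assumption+,
        intro sum.cong refl Bochner_Integration.integral_sum int)
  also have "\<dots> = (\<Sum>i\<in>J. \<Sum>j\<in>J. if i = j then d i * e i * u i else 0)"
    using k inj[OF k] by (intro sum.cong refl) (auto simp: gauss_PiM_covariance \<phi> inj_on_eq_iff)
  also have "\<dots> = (\<Sum>j\<in>J. d j * e j * u j)"
    using finJ by simp
  finally show "(\<integral>\<omega>. (\<Sum>j\<in>J. d j * \<omega> (\<phi> k j)) * (\<Sum>j\<in>J. e j * \<omega> (\<phi> k j)) \<partial>P) = (\<Sum>j\<in>J. d j * e j * u j)" .
qed

text \<open>A crude bound suffices: what matters later is that it is finite and the same for every
  block.\<close>

lemma gauss_PiM_linear_form_fourth_moment: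
  assumes k: "k \<in> K"
  shows "integrable P (\<lambda>\<omega>. (\<Sum>j\<in>J. d j * \<omega> (\<phi> k j)) ^ 4)"
    and "(\<integral>\<omega>. (\<Sum>j\<in>J. d j * \<omega> (\<phi> k j)) ^ 4 \<partial>P)
      \<le> real (card J) ^ 3 * (\<Sum>j\<in>J. d j ^ 4 * (\<integral>x. x ^ 4 \<partial>gauss (u j)))"
proof -
  let ?B = "\<lambda>\<omega>. real (card J) ^ 3 * (\<Sum>j\<in>J. d j ^ 4 * \<omega> (\<phi> k j) ^ 4)"
  have le: "(\<Sum>j\<in>J. d j * \<omega> (\<phi> k j)) ^ 4 \<le> ?B \<omega>" for \<omega>
    using sum_power4_le[of "\<lambda>j. d j * \<omega> (\<phi> k j)" J] by (simp add: power_mult_distrib)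
  have i4: "integrable P (\<lambda>\<omega>. \<omega> (\<phi> k j) ^ 4)" if "j \<in> J" for j
    using gauss_PiM_component(2)[of "\<phi> k j" "\<lambda>x. x ^ 4"] integrable_gauss_power[OF v, of "\<phi> k j" 4]
      \<phi>[OF k that] by simp
  have intB: "integrable P ?B"
    by (intro integrable_mult_right Bochner_Integration.integrable_sum i4)
  have m: "(\<lambda>\<omega>. \<omega> (\<phi> k j)) \<in> borel_measurable P" if "j \<in> J" for j
    using \<phi>[OF k that] by (auto intro: component_measurable_gauss_PiM)
  have mm: "(\<lambda>\<omega>. (\<Sum>j\<in>J. d j * \<omega> (\<phi> k j)) ^ 4) \<in> borel_measurable P"
    by (intro borel_measurable_power borel_measurable_sum borel_measurable_times m) auto
  show int: "integrable P (\<lambda>\<omega>. (\<Sum>j\<in>J. d j * \<omega> (\<phi> k j)) ^ 4)"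
  proof (rule Bochner_Integration.integrable_bound[OF intB mm], rule AE_I2)
    fix \<omega>
    have "0 \<le> (\<Sum>j\<in>J. d j * \<omega> (\<phi> k j)) ^ 4" by simp
    with le[of \<omega>] show "norm ((\<Sum>j\<in>J. d j * \<omega> (\<phi> k j)) ^ 4) \<le> norm (?B \<omega>)"
      unfolding real_norm_def by linarith
  qed
  have "(\<integral>\<omega>. (\<Sum>j\<in>J. d j * \<omega> (\<phi> k j)) ^ 4 \<partial>P) \<le> (\<integral>\<omega>. ?B \<omega> \<partial>P)"
    by (intro integral_mono int intB le)
  also have "\<dots> = real (card J) ^ 3 * (\<Sum>j\<in>J. d j ^ 4 * (\<integral>\<omega>. \<omega> (\<phi> k j) ^ 4 \<partial>P))"
    by (subst integral_mult_right_zero, subst Bochner_Integration.integral_sum)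
       (auto intro!: integrable_mult_right i4)
  also have "\<dots> = real (card J) ^ 3 * (\<Sum>j\<in>J. d j ^ 4 * (\<integral>x. x ^ 4 \<partial>gauss (u j)))"
    using \<phi>[OF k] gauss_PiM_component(1)[of _ "\<lambda>x. x ^ 4"]
    by (intro arg_cong[where f = "\<lambda>x. real (card J) ^ 3 * x"] sum.cong refl) auto
  finally show "(\<integral>\<omega>. (\<Sum>j\<in>J. d j * \<omega> (\<phi> k j)) ^ 4 \<partial>P)
      \<le> real (card J) ^ 3 * (\<Sum>j\<in>J. d j ^ 4 * (\<integral>x. x ^ 4 \<partial>gauss (u j)))" .
qed

text \<open>Products of two forms of the same block, centred by their covariance \<open>m\<close>,
  are independent across blocks. Fourth moments bound each of their second moments because (X Y)^2
  \<le> X^4 + Y^4.\<close>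

lemma gauss_PiM_block_product_second_moment:
  fixes d e :: "'j \<Rightarrow> real"
  defines "X \<equiv> \<lambda>k \<omega>. \<Sum>j\<in>J. d j * \<omega> (\<phi> k j)" and "Y \<equiv> \<lambda>k \<omega>. \<Sum>j\<in>J. e j * \<omega> (\<phi> k j)"
    and "m \<equiv> \<Sum>j\<in>J. d j * e j * u j"
  shows "integrable P (\<lambda>\<omega>. (\<Sum>k\<in>K. X k \<omega> * Y k \<omega> - m)\<^sup>2)"
    and "(\<integral>\<omega>. (\<Sum>k\<in>K. X k \<omega> * Y k \<omega> - m)\<^sup>2 \<partial>P)
      \<le> real (card K) * (2 * (real (card J) ^ 3 * (\<Sum>j\<in>J. d j ^ 4 * (\<integral>x. x ^ 4 \<partial>gauss (u j)))
          + real (card J) ^ 3 * (\<Sum>j\<in>J. e j ^ 4 * (\<integral>x. x ^ 4 \<partial>gauss (u j)))) + 2 * m\<^sup>2)" (is "_ \<le> _ * ?V")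
proof -
  interpret prob_space P by (rule prob_space_gauss_PiM)
  let ?F = "\<lambda>k \<omega>. X k \<omega> * Y k \<omega> - m"
  have mX [measurable]: "X k \<in> borel_measurable P" and mY [measurable]: "Y k \<in> borel_measurable P"
    if "k \<in> K" for k
    unfolding X_def Y_def using \<phi>[OF that]
    by (auto intro!: borel_measurable_sum borel_measurable_times component_measurable_gauss_PiM)
  have "indep_vars (\<lambda>i. gauss (v i)) (\<lambda>i \<omega>. \<omega> i) I"
    unfolding P_def by (intro indep_vars_PiM_components prob_space_gauss v)
  then have ind1: "indep_vars (\<lambda>k. PiM (\<phi> k ` J) (\<lambda>i. gauss (v i))) (\<lambda>k \<omega>. restrict (\<lambda>i. \<omega> i) (\<phi> k ` J)) K"
    by (rule indep_vars_restrict) (use \<phi> disj in auto)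
  \<comment> \<open>\<open>?F k\<close> reads only the coordinates of block \<open>k\<close>, so
    restricting its argument changes nothing and the independence of the restrictions passes to
    it.\<close>
  have ind2: "indep_vars (\<lambda>_. borel) (\<lambda>k \<omega>. ?F k (restrict (\<lambda>i. \<omega> i) (\<phi> k ` J))) K"
  proof (rule indep_vars_compose2[OF ind1, where Y = ?F])
    fix k assume "k \<in> K"
    have [measurable]: "(\<lambda>\<omega>. \<omega> (\<phi> k j)) \<in> borel_measurable (PiM (\<phi> k ` J) (\<lambda>i. gauss (v i)))" if "j \<in> J" for j
      using that by (subst measurable_cong_sets[OF refl sets_gauss[symmetric, of "v (\<phi> k j)"]]) simp
    show "?F k \<in> borel_measurable (PiM (\<phi> k ` J) (\<lambda>i. gauss (v i)))"
      unfolding X_def Y_def by measurable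
  qed
  have ind: "indep_vars (\<lambda>_. borel) ?F K"
    using ind2 by (simp add: X_def Y_def cong: sum.cong)
  have sq: "integrable P (\<lambda>\<omega>. (?F k \<omega>)\<^sup>2) \<and> expectation (\<lambda>\<omega>. (?F k \<omega>)\<^sup>2) \<le> ?V" if k: "k \<in> K" for k
  proof -
    note f4 = gauss_PiM_linear_form_fourth_moment[OF k]
    have le: "(?F k \<omega>)\<^sup>2 \<le> 2 * (X k \<omega> ^ 4 + Y k \<omega> ^ 4) + 2 * m\<^sup>2" for \<omega>
    proof -
      have "(?F k \<omega>)\<^sup>2 \<le> 2 * (X k \<omega> * Y k \<omega>)\<^sup>2 + 2 * m\<^sup>2"
        using sum_squares_bound[of "X k \<omega> * Y k \<omega>" "- m"] by (simp add: power2_diff)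
      moreover have "(X k \<omega> * Y k \<omega>)\<^sup>2 \<le> X k \<omega> ^ 4 + Y k \<omega> ^ 4"
        using abs_mult_le_add_squares[of "(X k \<omega>)\<^sup>2" "(Y k \<omega>)\<^sup>2"] by (simp add: power_mult_distrib)
      then have "2 * (X k \<omega> * Y k \<omega>)\<^sup>2 + 2 * m\<^sup>2 \<le> 2 * (X k \<omega> ^ 4 + Y k \<omega> ^ 4) + 2 * m\<^sup>2"
        by (intro add_right_mono mult_left_mono) auto
      ultimately show ?thesis by (rule order_trans)
    qed
    have intB: "integrable P (\<lambda>\<omega>. 2 * (X k \<omega> ^ 4 + Y k \<omega> ^ 4) + 2 * m\<^sup>2)"
      unfolding X_def Y_def by (intro Bochner_Integration.integrable_add integrable_mult_right f4 integrable_const)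
    have int: "integrable P (\<lambda>\<omega>. (?F k \<omega>)\<^sup>2)"
    proof (rule Bochner_Integration.integrable_bound[OF intB])
      show "(\<lambda>\<omega>. (?F k \<omega>)\<^sup>2) \<in> borel_measurable P" using k by measurable
      show "AE \<omega> in P. norm ((?F k \<omega>)\<^sup>2) \<le> norm (2 * (X k \<omega> ^ 4 + Y k \<omega> ^ 4) + 2 * m\<^sup>2)"
      proof (rule AE_I2)
        fix \<omega>
        have "norm ((?F k \<omega>)\<^sup>2) = (?F k \<omega>)\<^sup>2" by simp
        also note le
        also have "2 * (X k \<omega> ^ 4 + Y k \<omega> ^ 4) + 2 * m\<^sup>2 \<le> norm (2 * (X k \<omega> ^ 4 + Y k \<omega> ^ 4) + 2 * m\<^sup>2)"
          unfolding real_norm_def by (rule abs_ge_self)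
        finally show "norm ((?F k \<omega>)\<^sup>2) \<le> norm (2 * (X k \<omega> ^ 4 + Y k \<omega> ^ 4) + 2 * m\<^sup>2)" .
      qed
    qed
    have "expectation (\<lambda>\<omega>. (?F k \<omega>)\<^sup>2) \<le> expectation (\<lambda>\<omega>. 2 * (X k \<omega> ^ 4 + Y k \<omega> ^ 4) + 2 * m\<^sup>2)"
      by (intro integral_mono int intB le)
    also have "\<dots> = 2 * (expectation (\<lambda>\<omega>. X k \<omega> ^ 4) + expectation (\<lambda>\<omega>. Y k \<omega> ^ 4)) + 2 * m\<^sup>2"
      using f4(1)[of d] f4(1)[of e] by (simp add: X_def Y_def prob_space)
    also have "\<dots> \<le> ?V"
      using f4(2)[of d] f4(2)[of e] unfolding X_def Y_def
      by (intro add_right_mono mult_left_mono add_mono) auto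
    finally show ?thesis using int by simp
  qed
  have mean: "expectation (?F k) = 0" if k: "k \<in> K" for k
    using gauss_PiM_linear_form_covariance[OF k, of d e]
    by (simp add: X_def Y_def m_def prob_space)
  from second_moment_sum_indep[OF finK ind, of ?V] sq mean
  show "integrable P (\<lambda>\<omega>. (\<Sum>k\<in>K. ?F k \<omega>)\<^sup>2)" "(\<integral>\<omega>. (\<Sum>k\<in>K. ?F k \<omega>)\<^sup>2 \<partial>P) \<le> real (card K) * ?V"
    by auto
qed

end

end

text \<open>Transports the product of the codeword and noise spaces to one product measure over a sum of
  index sets, where functions of disjoint blocks of coordinates are independent.\<close>

definition sum_join :: "'a set \<Rightarrow> 'b set \<Rightarrow> ('a \<Rightarrow> real) \<times> ('b \<Rightarrow> real) \<Rightarrow> 'a + 'b \<Rightarrow> real" where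
  "sum_join A B p = (\<lambda>i\<in>A <+> B. case_sum (fst p) (snd p) i)"

lemma
  fixes v :: "'a \<Rightarrow> real" and w :: "'b \<Rightarrow> real"
  assumes fin: "finite A" "finite B" and v: "\<And>i. 0 \<le> v i" and w: "\<And>i. 0 \<le> w i"
  defines "PA \<equiv> PiM A (\<lambda>i. gauss (v i))" and "PB \<equiv> PiM B (\<lambda>i. gauss (w i))"
    and "PAB \<equiv> PiM (A <+> B) (\<lambda>i. gauss (case_sum v w i))"
  shows sum_join_measurable: "sum_join A B \<in> PA \<Otimes>\<^sub>M PB \<rightarrow>\<^sub>M PAB"
    and distr_sum_join: "distr (PA \<Otimes>\<^sub>M PB) PAB (sum_join A B) = PAB"
proof -
  show meas [measurable]: "sum_join A B \<in> PA \<Otimes>\<^sub>M PB \<rightarrow>\<^sub>M PAB"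
    unfolding sum_join_def PAB_def
  proof (rule measurable_restrict)
    fix i assume "i \<in> A <+> B"
    then show "(\<lambda>p. case_sum (fst p) (snd p) i) \<in> PA \<Otimes>\<^sub>M PB \<rightarrow>\<^sub>M gauss (case_sum v w i)"
      by (auto simp: PA_def PB_def)
  qed
  have vw: "0 \<le> case_sum v w i" for i using v w by (auto split: sum.split)
  interpret product_prob_space "\<lambda>i. gauss (case_sum v w i)" "A <+> B"
    by (intro product_prob_spaceI prob_space_gauss vw)
  interpret pA: prob_space PA unfolding PA_def by (intro prob_space_PiM prob_space_gauss v)
  interpret pB: prob_space PB unfolding PB_def by (intro prob_space_PiM prob_space_gauss w)
  interpret prA: product_prob_space "\<lambda>i. gauss (v i)" A by (intro product_prob_spaceI prob_space_gauss v)
  interpret prB: product_prob_space "\<lambda>i. gauss (w i)" B by (intro product_prob_spaceI prob_space_gauss w)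
  show "distr (PA \<Otimes>\<^sub>M PB) PAB (sum_join A B) = PAB"
    unfolding PAB_def
  proof (rule PiM_eqI)
    show "finite (A <+> B)" using fin by simp
    fix E :: "'a + 'b \<Rightarrow> real set" assume E: "\<And>i. i \<in> A <+> B \<Longrightarrow> E i \<in> sets (gauss (case_sum v w i))"
    have E': "E (Inl i) \<in> sets borel" if "i \<in> A" for i using E[of "Inl i"] that by auto
    have E'': "E (Inr i) \<in> sets borel" if "i \<in> B" for i using E[of "Inr i"] that by auto
    have EA: "(Pi\<^sub>E A (\<lambda>i. E (Inl i))) \<in> sets PA" and EB: "(Pi\<^sub>E B (\<lambda>i. E (Inr i))) \<in> sets PB"
      unfolding PA_def PB_def using fin E' E'' by (auto intro!: sets_PiM_I_finite)
    \<comment> \<open>The preimage of a box is a product of two boxes, so both measures agree on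
      boxes, and these determine a finite product measure.\<close>
    have pre: "sum_join A B -` Pi\<^sub>E (A <+> B) E \<inter> space (PA \<Otimes>\<^sub>M PB)
        = Pi\<^sub>E A (\<lambda>i. E (Inl i)) \<times> Pi\<^sub>E B (\<lambda>i. E (Inr i))"
      by (auto simp: sum_join_def space_pair_measure PA_def PB_def space_PiM PiE_iff Plus_def ball_Un)
    have EAB: "Pi\<^sub>E (A <+> B) E \<in> sets PAB"
      unfolding PAB_def using fin E by (intro sets_PiM_I_finite) auto
    have "emeasure (distr (PA \<Otimes>\<^sub>M PB) PAB (sum_join A B)) (Pi\<^sub>E (A <+> B) E)
        = emeasure PA (Pi\<^sub>E A (\<lambda>i. E (Inl i))) * emeasure PB (Pi\<^sub>E B (\<lambda>i. E (Inr i)))"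
      using EA EB EAB by (simp add: emeasure_distr pre pB.emeasure_pair_measure_Times)
    also have "\<dots> = (\<Prod>i\<in>A <+> B. emeasure (gauss (case_sum v w i)) (E i))"
      unfolding PA_def PB_def using fin E' E''
      by (simp add: prA.emeasure_PiM prB.emeasure_PiM prod.Plus)
    finally show "emeasure (distr (PA \<Otimes>\<^sub>M PB) (PiM (A <+> B) (\<lambda>i. gauss (case_sum v w i))) (sum_join A B)) (Pi\<^sub>E (A <+> B) E)
      = (\<Prod>i\<in>A <+> B. emeasure (gauss (case_sum v w i)) (E i))"
      by (simp add: PAB_def)
  qed simp
qed

section \<open>Gaussian quantities of one block as coefficient data\<close>

type_synonym coeffs = "real \<times> real \<times> (nat \<Rightarrow> real) \<times> (nat \<Rightarrow> real)"
type_synonym noise = "(nat \<Rightarrow> real) \<times> (nat \<Rightarrow> real)"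
type_synonym word = "nat \<Rightarrow> real"

text \<open>Every Gaussian quantity of a block is linear in its two code symbols, its channel noise
  and its feedback noise. Storing only the coefficients, which are the same for every block, turns
  covariances into finite sums.\<close>

fun lform :: "nat \<Rightarrow> coeffs \<Rightarrow> nat \<Rightarrow> (word \<times> word) \<times> noise \<Rightarrow> real" where
  "lform \<eta> (p, q, r, s) k ((x, y), (z, w)) =
     p * x k + q * y k + (\<Sum>j<\<eta>. r j * z (k * \<eta> + j)) + (\<Sum>j<\<eta>. s j * w (k * \<eta> + j))"

text \<open>The covariance of two forms of the same block, for independent symbols of variance 1 and
  noise variances \<open>N\<close> and \<open>s2\<close>.\<close>

fun lform_cov :: "real \<Rightarrow> real \<Rightarrow> nat \<Rightarrow> coeffs \<Rightarrow> coeffs \<Rightarrow> real" where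
  "lform_cov N s2 \<eta> (p, q, r, s) (p', q', r', s') =
     p * p' + q * q' + N * (\<Sum>j<\<eta>. r j * r' j) + s2 * (\<Sum>j<\<eta>. s j * s' j)"

definition word_space :: "nat \<Rightarrow> word measure" where
  "word_space l = PiM {..<l} (\<lambda>_. gauss 1)"

definition joint_space :: "real \<Rightarrow> real \<Rightarrow> nat \<Rightarrow> nat \<Rightarrow> ((word \<times> word) \<times> noise) measure" where
  "joint_space N s2 l n = (word_space l \<Otimes>\<^sub>M word_space l) \<Otimes>\<^sub>M noise_space n N s2"

lemma prob_space_word_space: "prob_space (word_space l)"
  unfolding word_space_def by (intro prob_space_PiM prob_space_gauss) auto

lemma prob_space_noise_space: "0 \<le> N \<Longrightarrow> 0 \<le> s2 \<Longrightarrow> prob_space (noise_space n N s2)"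
  unfolding noise_space_def by (intro prob_space_pair prob_space_PiM prob_space_gauss) auto

text \<open>\<open>V\<close> may depend neither on the number of blocks nor on the blocklength:
  growth linear in \<open>l\<close> is what gives errors of order 1 / l in Chebyshev's inequality.
  \<open>n\<close> may exceed \<open>l * \<eta>\<close> since blocklengths need not be multiples of
  \<open>\<eta>\<close>.\<close>

definition moment_bound :: "real \<Rightarrow> real \<Rightarrow> nat \<Rightarrow> (nat \<Rightarrow> (word \<times> word) \<times> noise \<Rightarrow> real) \<Rightarrow> real \<Rightarrow> bool" where
  "moment_bound N s2 \<eta> F V \<longleftrightarrow> 0 \<le> V \<and> (\<forall>l n. l * \<eta> \<le> n \<longrightarrow>
     (\<integral>\<^sup>+\<omega>. ennreal ((\<Sum>k<l. F k \<omega>)\<^sup>2) \<partial>joint_space N s2 l n) \<le> ennreal (real l * V))"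

lemma moment_boundD:
  assumes "moment_bound N s2 \<eta> F V"
  shows "0 \<le> V"
    and "l * \<eta> \<le> n \<Longrightarrow> (\<integral>\<^sup>+\<omega>. ennreal ((\<Sum>k<l. F k \<omega>)\<^sup>2) \<partial>joint_space N s2 l n) \<le> ennreal (real l * V)"
  using assms by (auto simp: moment_bound_def)

lemma block_product_moment_bound:
  fixes D E :: coeffs
  assumes N: "0 \<le> N" and s2: "0 \<le> s2"
  shows "\<exists>V. moment_bound N s2 \<eta> (\<lambda>k \<omega>. lform \<eta> D k \<omega> * lform \<eta> E k \<omega> - lform_cov N s2 \<eta> D E) V"
proof -
  define cf :: "coeffs \<Rightarrow> (nat + nat) + (nat + nat) \<Rightarrow> real" where
    "cf = (\<lambda>(p, q, r, s). case_sum (case_sum (\<lambda>_. p) (\<lambda>_. q)) (case_sum r s))"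
  define u :: "(nat + nat) + (nat + nat) \<Rightarrow> real" where
    "u = case_sum (case_sum (\<lambda>_. 1) (\<lambda>_. 1)) (case_sum (\<lambda>_. N) (\<lambda>_. s2))"
  \<comment> \<open>The template has one coordinate for each code symbol and \<open>\<eta>\<close>
    for each noise; \<open>\<phi> k\<close> sends the symbols to position \<open>k\<close> and the
    noise to block \<open>k\<close>.\<close>
  define J where "J = ({0::nat} <+> {0::nat}) <+> ({..<\<eta>} <+> {..<\<eta>})"
  define \<phi> :: "nat \<Rightarrow> (nat + nat) + (nat + nat) \<Rightarrow> (nat + nat) + (nat + nat)" where
    "\<phi> k = map_sum (map_sum (\<lambda>_. k) (\<lambda>_. k)) (map_sum (\<lambda>j. k * \<eta> + j) (\<lambda>j. k * \<eta> + j))" for k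
  define m where "m = (\<Sum>j\<in>J. cf D j * cf E j * u j)"
  have finJ: "finite J" by (simp add: J_def)
  have u0: "0 \<le> u i" for i using N s2 by (auto simp: u_def split: sum.split)
  have m_eq: "m = lform_cov N s2 \<eta> D E"
    by (cases D; cases E) (simp add: m_def J_def cf_def u_def sum.Plus sum_distrib_left mult_ac)
  define V where "V = 2 * (real (card J) ^ 3 * (\<Sum>j\<in>J. cf D j ^ 4 * (\<integral>x. x ^ 4 \<partial>gauss (u j)))
          + real (card J) ^ 3 * (\<Sum>j\<in>J. cf E j ^ 4 * (\<integral>x. x ^ 4 \<partial>gauss (u j)))) + 2 * m\<^sup>2"
  have V: "0 \<le> V"
    unfolding V_def by (intro add_nonneg_nonneg mult_nonneg_nonneg sum_nonneg integral_nonneg) auto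
  show ?thesis
    unfolding moment_bound_def
  proof (intro exI[of _ V] conjI allI impI V)
    fix l n assume ln: "l * \<eta> \<le> n"
    define I1 I2 where "I1 = {..<l} <+> {..<l}" and "I2 = {..<n} <+> {..<n}"
    define u1 u2 :: "nat + nat \<Rightarrow> real" where "u1 = case_sum (\<lambda>_. 1) (\<lambda>_. 1)" and "u2 = case_sum (\<lambda>_. N) (\<lambda>_. s2)"
    have u12: "0 \<le> u1 i" "0 \<le> u2 i" for i using N s2 by (auto simp: u1_def u2_def split: sum.split)
    define P1 P2 P where "P1 = PiM I1 (\<lambda>i. gauss (u1 i))" and "P2 = PiM I2 (\<lambda>i. gauss (u2 i))"
      and "P = PiM (I1 <+> I2) (\<lambda>i. gauss (u i))"
    have u_eq: "u = case_sum u1 u2" by (simp add: u_def u1_def u2_def)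
    have fin: "finite I1" "finite I2" by (auto simp: I1_def I2_def)
    \<comment> \<open>\<open>\<Phi>\<close> flattens ((x, y), (z, w)) into one family. Its law is
      found by joining the two word spaces, then the two noise spaces, then the results.\<close>
    define \<Phi> where "\<Phi> = (\<lambda>\<omega>. sum_join I1 I2 (sum_join {..<l} {..<l} (fst \<omega>), sum_join {..<n} {..<n} (snd \<omega>)))"
    have j1 [measurable]: "sum_join {..<l} {..<l} \<in> word_space l \<Otimes>\<^sub>M word_space l \<rightarrow>\<^sub>M P1"
      and d1: "distr (word_space l \<Otimes>\<^sub>M word_space l) P1 (sum_join {..<l} {..<l}) = P1"
      using sum_join_measurable[of "{..<l}" "{..<l}" "\<lambda>_. 1" "\<lambda>_. 1"] distr_sum_join[of "{..<l}" "{..<l}" "\<lambda>_. 1" "\<lambda>_. 1"]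
      by (auto simp: word_space_def P1_def I1_def u1_def)
    have j2 [measurable]: "sum_join {..<n} {..<n} \<in> noise_space n N s2 \<rightarrow>\<^sub>M P2"
      and d2: "distr (noise_space n N s2) P2 (sum_join {..<n} {..<n}) = P2"
      using sum_join_measurable[of "{..<n}" "{..<n}" "\<lambda>_. N" "\<lambda>_. s2"] distr_sum_join[of "{..<n}" "{..<n}" "\<lambda>_. N" "\<lambda>_. s2"] N s2
      by (auto simp: noise_space_def P2_def I2_def u2_def)
    have j3 [measurable]: "sum_join I1 I2 \<in> P1 \<Otimes>\<^sub>M P2 \<rightarrow>\<^sub>M P"
      and d3: "distr (P1 \<Otimes>\<^sub>M P2) P (sum_join I1 I2) = P"
      using sum_join_measurable[OF fin u12] distr_sum_join[OF fin u12] by (auto simp: P1_def P2_def P_def u_eq)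
    have mPhi: "\<Phi> \<in> joint_space N s2 l n \<rightarrow>\<^sub>M P"
      unfolding \<Phi>_def joint_space_def by measurable
    have "prob_space P2" unfolding P2_def by (intro prob_space_PiM prob_space_gauss u12)
    then have sf: "sigma_finite_measure P2" by (rule prob_space_imp_sigma_finite)
    have "P = distr (P1 \<Otimes>\<^sub>M P2) P (sum_join I1 I2)" by (simp add: d3)
    also have "P1 \<Otimes>\<^sub>M P2 = distr (joint_space N s2 l n) (P1 \<Otimes>\<^sub>M P2)
        (\<lambda>(x, y). (sum_join {..<l} {..<l} x, sum_join {..<n} {..<n} y))"
      using pair_measure_distr[OF j1 j2] sf by (simp add: d1 d2 joint_space_def)
    also have "distr \<dots> P (sum_join I1 I2) = distr (joint_space N s2 l n) P \<Phi>"
      by (subst distr_distr) (auto simp: joint_space_def \<Phi>_def o_def case_prod_beta)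
    finally have dP: "distr (joint_space N s2 l n) P \<Phi> = P" by simp
    define T where "T = (\<lambda>\<omega>. (\<Sum>k<l. (\<Sum>j\<in>J. cf D j * \<omega> (\<phi> k j)) * (\<Sum>j\<in>J. cf E j * \<omega> (\<phi> k j)) - m)\<^sup>2)"
    have blk: "k * \<eta> + j < n" if "k < l" "j < \<eta>" for k j
    proof -
      have "k * \<eta> + j < (k + 1) * \<eta>" using that by simp
      also have "\<dots> \<le> l * \<eta>" using that by (intro mult_right_mono) auto
      finally show ?thesis using ln by simp
    qed
    have phi: "\<phi> k j \<in> I1 <+> I2 \<and> u (\<phi> k j) = u j" if "k \<in> {..<l}" "j \<in> J" for k j
      using that by (auto simp: J_def \<phi>_def I1_def I2_def u_def blk Plus_def)
    have inj: "inj_on (\<phi> k) J" for k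
      by (auto simp: inj_on_def J_def \<phi>_def Plus_def)
    \<comment> \<open>Division by \<open>\<eta>\<close> recovers the block number, so different
      blocks share no noise coordinate.\<close>
    have eqdiv: "k = k'" if "k * \<eta> + j = k' * \<eta> + j'" "j < \<eta>" "j' < \<eta>" for k k' j j' :: nat
    proof -
      have "(a * \<eta> + b) div \<eta> = a" if "b < \<eta>" for a b using that by simp
      then show ?thesis using that by metis
    qed
    have disj: "disjoint_family_on (\<lambda>k. \<phi> k ` J) {..<l}"
      by (auto simp: disjoint_family_on_def J_def \<phi>_def Plus_def dest: eqdiv)
    note bp = gauss_PiM_block_product_second_moment[where I = "I1 <+> I2" and v = u and J = J and K = "{..<l}" and \<phi> = \<phi> and u = u,
        OF u0 finJ finite_lessThan phi inj disj, of "cf D" "cf E", folded m_def, folded V_def, folded P_def]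
    have intT: "integrable P T" unfolding T_def using bp(1) by simp
    have leT: "(\<integral>\<omega>. T \<omega> \<partial>P) \<le> real l * V" unfolding T_def using bp(2) by simp
    have lf: "(\<Sum>j\<in>J. cf C j * \<Phi> \<omega> (\<phi> k j)) = lform \<eta> C k \<omega>" if "k < l" for C k \<omega>
    proof -
      obtain p q r s where C: "C = (p, q, r, s)" by (cases C)
      obtain x y z w where w: "\<omega> = ((x, y), (z, w))" by (metis surj_pair)
      show ?thesis using that
        by (simp add: J_def C w cf_def \<phi>_def \<Phi>_def sum_join_def I1_def I2_def sum.Plus blk InlI InrI)
    qed
    have "(\<integral>\<^sup>+\<omega>. ennreal ((\<Sum>k<l. lform \<eta> D k \<omega> * lform \<eta> E k \<omega> - lform_cov N s2 \<eta> D E)\<^sup>2) \<partial>joint_space N s2 l n)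
       = (\<integral>\<^sup>+\<omega>. ennreal (T (\<Phi> \<omega>)) \<partial>joint_space N s2 l n)"
      unfolding T_def by (intro nn_integral_cong) (simp add: lf m_eq)
    also have "\<dots> = (\<integral>\<^sup>+\<omega>. ennreal (T \<omega>) \<partial>distr (joint_space N s2 l n) P \<Phi>)"
      using borel_measurable_integrable[OF intT] mPhi by (subst nn_integral_distr) auto
    also have "\<dots> = ennreal (\<integral>\<omega>. T \<omega> \<partial>P)"
      unfolding dP by (rule nn_integral_eq_integral[OF intT]) (simp add: T_def)
    also have "\<dots> \<le> ennreal (real l * V)" by (rule ennreal_leI[OF leT])
    finally show "(\<integral>\<^sup>+\<omega>. ennreal ((\<Sum>k<l. lform \<eta> D k \<omega> * lform \<eta> E k \<omega> - lform_cov N s2 \<eta> D E)\<^sup>2) \<partial>joint_space N s2 l n)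
      \<le> ennreal (real l * V)" .
  qed
qed

lemma lform_measurable [measurable]:
  assumes "k < l" "l * \<eta> \<le> n"
  shows "lform \<eta> D k \<in> borel_measurable (joint_space N s2 l n)"
proof -
  obtain p q r s where D: "D = (p, q, r, s)" by (cases D)
  have blk: "k * \<eta> + j < n" if "j < \<eta>" for j
  proof -
    have "k * \<eta> + j < (k + 1) * \<eta>" using that by simp
    also have "\<dots> \<le> l * \<eta>" using assms by (intro mult_right_mono) auto
    finally show ?thesis using assms by simp
  qed
  have eq: "lform \<eta> D k = (\<lambda>\<omega>. p * fst (fst \<omega>) k + q * snd (fst \<omega>) k
      + (\<Sum>j<\<eta>. r j * fst (snd \<omega>) (k * \<eta> + j)) + (\<Sum>j<\<eta>. s j * snd (snd \<omega>) (k * \<eta> + j)))"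
    by (rule ext) (auto simp: D)
  have c: "(\<lambda>x. x i) \<in> borel_measurable (PiM {..<m} (\<lambda>_. gauss v))" if "i < m" for i m v
    using that by (subst measurable_cong_sets[OF refl sets_gauss[symmetric, of v]]) simp
  note [measurable] = c
  show ?thesis
    unfolding eq joint_space_def word_space_def noise_space_def using assms(1) blk
    by (intro borel_measurable_add borel_measurable_sum borel_measurable_times borel_measurable_const;
        measurable)
qed

lemma nn_integral_add_le:
  assumes [measurable]: "f \<in> borel_measurable M" "g \<in> borel_measurable M"
    and nn: "\<And>x. 0 \<le> f x" "\<And>x. 0 \<le> g x" "0 \<le> a" "0 \<le> b" "0 \<le> F" "0 \<le> K"
    and le: "(\<integral>\<^sup>+x. ennreal (f x) \<partial>M) \<le> ennreal F" "(\<integral>\<^sup>+x. ennreal (g x) \<partial>M) \<le> ennreal K"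
  shows "(\<integral>\<^sup>+x. ennreal (a * f x + b * g x) \<partial>M) \<le> ennreal (a * F + b * K)"
proof -
  have "(\<integral>\<^sup>+x. ennreal (a * f x + b * g x) \<partial>M)
      = ennreal a * (\<integral>\<^sup>+x. ennreal (f x) \<partial>M) + ennreal b * (\<integral>\<^sup>+x. ennreal (g x) \<partial>M)"
    using nn by (simp add: ennreal_mult ennreal_plus nn_integral_add nn_integral_cmult)
  also have "\<dots> \<le> ennreal a * ennreal F + ennreal b * ennreal K"
    by (intro add_mono mult_left_mono le) auto
  also have "\<dots> = ennreal (a * F + b * K)" using nn by (simp add: ennreal_mult ennreal_plus)
  finally show ?thesis .
qed

text \<open>(S + S')^2 \<le> 2 S^2 + 2 S'^2 for the sums over blocks; the two families may be
  dependent.\<close>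

lemma moment_bound_add:
  assumes F: "moment_bound N s2 \<eta> F V" and F': "moment_bound N s2 \<eta> F' V'"
    and [measurable]: "\<And>l n k. k < l \<Longrightarrow> l * \<eta> \<le> n \<Longrightarrow> F k \<in> borel_measurable (joint_space N s2 l n)"
      "\<And>l n k. k < l \<Longrightarrow> l * \<eta> \<le> n \<Longrightarrow> F' k \<in> borel_measurable (joint_space N s2 l n)"
  shows "moment_bound N s2 \<eta> (\<lambda>k \<omega>. F k \<omega> + F' k \<omega>) (2 * V + 2 * V')"
  unfolding moment_bound_def
proof (intro conjI allI impI)
  note V = moment_boundD[OF F] and V' = moment_boundD[OF F']
  show "0 \<le> 2 * V + 2 * V'" using V(1) V'(1) by simp
  fix l n assume ln: "l * \<eta> \<le> n"
  let ?J = "joint_space N s2 l n" and ?S = "\<lambda>\<omega>. \<Sum>k<l. F k \<omega>" and ?S' = "\<lambda>\<omega>. \<Sum>k<l. F' k \<omega>"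
  have [measurable]: "?S \<in> borel_measurable ?J" "?S' \<in> borel_measurable ?J" using ln by measurable
  have sq: "(?S \<omega> + ?S' \<omega>)\<^sup>2 \<le> 2 * (?S \<omega>)\<^sup>2 + 2 * (?S' \<omega>)\<^sup>2" for \<omega>
    using sum_squares_bound[of "?S \<omega>" "?S' \<omega>"] by (simp add: power2_sum)
  have "(\<integral>\<^sup>+\<omega>. ennreal ((\<Sum>k<l. F k \<omega> + F' k \<omega>)\<^sup>2) \<partial>?J) \<le> (\<integral>\<^sup>+\<omega>. ennreal (2 * (?S \<omega>)\<^sup>2 + 2 * (?S' \<omega>)\<^sup>2) \<partial>?J)"
    unfolding sum.distrib by (intro nn_integral_mono ennreal_leI sq)
  also have "\<dots> \<le> ennreal (2 * (real l * V) + 2 * (real l * V'))"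
    using V(1) V'(1) by (intro nn_integral_add_le V(2)[OF ln] V'(2)[OF ln]; (measurable | simp))
  also have "\<dots> = ennreal (real l * (2 * V + 2 * V'))" by (simp add: algebra_simps)
  finally show "(\<integral>\<^sup>+\<omega>. ennreal ((\<Sum>k<l. F k \<omega> + F' k \<omega>)\<^sup>2) \<partial>?J) \<le> ennreal (real l * (2 * V + 2 * V'))" .
qed

text \<open>Two products cover both quadratic forms that occur later, the score and the codeword
  energy of transmitter 2.\<close>

lemma block_two_products_moment_bound:
  fixes D E D' E' :: coeffs
  assumes "0 \<le> N" and "0 \<le> s2"
  shows "\<exists>V. moment_bound N s2 \<eta> (\<lambda>k \<omega>. lform \<eta> D k \<omega> * lform \<eta> E k \<omega> + lform \<eta> D' k \<omega> * lform \<eta> E' k \<omega>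
        - (lform_cov N s2 \<eta> D E + lform_cov N s2 \<eta> D' E')) V"
proof -
  obtain V V' where V: "moment_bound N s2 \<eta> (\<lambda>k \<omega>. lform \<eta> D k \<omega> * lform \<eta> E k \<omega> - lform_cov N s2 \<eta> D E) V"
    "moment_bound N s2 \<eta> (\<lambda>k \<omega>. lform \<eta> D' k \<omega> * lform \<eta> E' k \<omega> - lform_cov N s2 \<eta> D' E') V'"
    using block_product_moment_bound[OF assms] by blast
  have "moment_bound N s2 \<eta> (\<lambda>k \<omega>. lform \<eta> D k \<omega> * lform \<eta> E k \<omega> - lform_cov N s2 \<eta> D E
      + (lform \<eta> D' k \<omega> * lform \<eta> E' k \<omega> - lform_cov N s2 \<eta> D' E')) (2 * V + 2 * V')"
    by (rule moment_bound_add[OF V]) measurable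
  then show ?thesis by (auto simp: algebra_simps)
qed

section \<open>Random coding for a multiple-access channel\<close>

lemma nn_integral_PiM_component:
  assumes "prob_space G" "i \<in> I" and [measurable]: "f \<in> borel_measurable G"
  shows "(\<integral>\<^sup>+x. f (x i) \<partial>PiM I (\<lambda>_. G)) = (\<integral>\<^sup>+w. f w \<partial>G)"
proof -
  have d: "distr (PiM I (\<lambda>_. G)) G (\<lambda>x. x i) = G"
    using assms by (intro distr_PiM_component) auto
  have [measurable]: "(\<lambda>x. x i) \<in> PiM I (\<lambda>_. G) \<rightarrow>\<^sub>M G" using assms(2) by simp
  have "(\<integral>\<^sup>+w. f w \<partial>G) = (\<integral>\<^sup>+w. f w \<partial>distr (PiM I (\<lambda>_. G)) G (\<lambda>x. x i))" by (simp add: d)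
  also have "\<dots> = (\<integral>\<^sup>+x. f (x i) \<partial>PiM I (\<lambda>_. G))" by (simp add: nn_integral_distr)
  finally show ?thesis by simp
qed

text \<open>Coordinate \<open>i\<close> is separated and integrated innermost; for a codebook, one
  codeword is drawn after all others are known.\<close>

lemma nn_integral_PiM_resample:
  assumes G: "prob_space G" and I: "finite I" "i \<in> I" and f: "f \<in> borel_measurable (PiM I (\<lambda>_. G))"
  shows "(\<integral>\<^sup>+x. f x \<partial>PiM I (\<lambda>_. G)) = (\<integral>\<^sup>+x. \<integral>\<^sup>+y. f (x(i := y)) \<partial>G \<partial>PiM (I - {i}) (\<lambda>_. G))"
proof -
  interpret G: prob_space G by (rule G)
  interpret product_sigma_finite "\<lambda>_. G" by standard
  have "insert i (I - {i}) = I" using I by auto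
  then show ?thesis using product_nn_integral_insert[of "I - {i}" i f] I f by simp
qed

lemma nn_integral_PiM_resample_le:
  assumes G: "prob_space G" and I: "finite I" "i \<in> I" and f: "f \<in> borel_measurable (PiM I (\<lambda>_. G))"
    and le: "\<And>x. x \<in> space (PiM (I - {i}) (\<lambda>_. G)) \<Longrightarrow> (\<integral>\<^sup>+y. f (x(i := y)) \<partial>G) \<le> p"
  shows "(\<integral>\<^sup>+x. f x \<partial>PiM I (\<lambda>_. G)) \<le> p"
proof -
  have "(\<integral>\<^sup>+x. f x \<partial>PiM I (\<lambda>_. G)) \<le> (\<integral>\<^sup>+x. p \<partial>PiM (I - {i}) (\<lambda>_. G))"
    unfolding nn_integral_PiM_resample[OF G I f] by (intro nn_integral_mono le)
  also have "\<dots> = p"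
    using prob_space.emeasure_space_1[OF prob_space_PiM[of "I - {i}" "\<lambda>_. G"]] G by simp
  finally show ?thesis .
qed

lemma nn_integral_swap_le:
  assumes "sigma_finite_measure G" and U: "prob_space U"
    and f: "case_prod f \<in> borel_measurable (G \<Otimes>\<^sub>M U)"
    and le: "\<And>u. u \<in> space U \<Longrightarrow> (\<integral>\<^sup>+x. f x u \<partial>G) \<le> p"
  shows "(\<integral>\<^sup>+x. \<integral>\<^sup>+u. f x u \<partial>U \<partial>G) \<le> p"
proof -
  interpret U: prob_space U by (rule U)
  interpret pair_sigma_finite G U
    by (intro pair_sigma_finite.intro assms(1)) unfold_locales
  have "(\<integral>\<^sup>+x. \<integral>\<^sup>+u. f x u \<partial>U \<partial>G) = (\<integral>\<^sup>+u. \<integral>\<^sup>+x. f x u \<partial>G \<partial>U)"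
    by (rule Fubini'[OF f, symmetric])
  also have "\<dots> \<le> (\<integral>\<^sup>+u. p \<partial>U)" by (intro nn_integral_mono le)
  also have "\<dots> = p" by (simp add: U.emeasure_space_1)
  finally show ?thesis .
qed

text \<open>The random coding argument sees the channel only as a map \<open>Y\<close> of two words
  and a noise, so feedback has disappeared from it. \<open>A\<close> is the set of accepted triples
  of two words and an output. \<open>e0\<close> concerns the true pair; \<open>p1\<close>,
  \<open>p2\<close> and \<open>p12\<close> are demanded for every fixed output because a wrong word
  is independent of it. \<open>H\<close> is an additional cost of the transmitted pair and will
  carry the power penalty.\<close>

locale mac_ensemble =
  fixes G1 :: "'a measure" and G2 :: "'b measure" and W :: "'w measure" and S :: "'y measure"
    and Y :: "('a \<times> 'b) \<times> 'w \<Rightarrow> 'y" and A :: "(('a \<times> 'b) \<times> 'y) set"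
    and H :: "'a \<times> 'b \<Rightarrow> ennreal" and e0 p1 p2 p12 h :: ennreal
  assumes G1: "prob_space G1" and G2: "prob_space G2" and W: "prob_space W"
    and Y [measurable]: "Y \<in> (G1 \<Otimes>\<^sub>M G2) \<Otimes>\<^sub>M W \<rightarrow>\<^sub>M S"
    and A [measurable]: "A \<in> sets ((G1 \<Otimes>\<^sub>M G2) \<Otimes>\<^sub>M S)"
    and H [measurable]: "H \<in> borel_measurable (G1 \<Otimes>\<^sub>M G2)"
    and e0: "(\<integral>\<^sup>+x. indicator (- A) (fst x, Y x) \<partial>((G1 \<Otimes>\<^sub>M G2) \<Otimes>\<^sub>M W)) \<le> e0"
    and p1: "\<And>b y. b \<in> space G2 \<Longrightarrow> y \<in> space S \<Longrightarrow> (\<integral>\<^sup>+a. indicator A ((a, b), y) \<partial>G1) \<le> p1"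
    and p2: "\<And>a y. a \<in> space G1 \<Longrightarrow> y \<in> space S \<Longrightarrow> (\<integral>\<^sup>+b. indicator A ((a, b), y) \<partial>G2) \<le> p2"
    and p12: "\<And>y. y \<in> space S \<Longrightarrow> (\<integral>\<^sup>+b. \<integral>\<^sup>+a. indicator A ((a, b), y) \<partial>G1 \<partial>G2) \<le> p12"
    and h: "(\<integral>\<^sup>+x. H x \<partial>(G1 \<Otimes>\<^sub>M G2)) \<le> h"
begin

sublocale G1: prob_space G1 by (rule G1)
sublocale G2: prob_space G2 by (rule G2)
sublocale W: prob_space W by (rule W)

definition failure :: "nat \<Rightarrow> nat \<Rightarrow> (nat \<Rightarrow> 'a) \<Rightarrow> (nat \<Rightarrow> 'b) \<Rightarrow> nat \<Rightarrow> nat \<Rightarrow> 'w set" where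
  "failure M1 M2 c1 c2 m1 m2 = {\<omega> \<in> space W.
     ((c1 m1, c2 m2), Y ((c1 m1, c2 m2), \<omega>)) \<notin> A \<or>
     (\<exists>m1'<M1. \<exists>m2'<M2. (m1', m2') \<noteq> (m1, m2) \<and> ((c1 m1', c2 m2'), Y ((c1 m1, c2 m2), \<omega>)) \<in> A)}"

context
  fixes M1 M2 m1 m2 :: nat
  assumes m1: "m1 < M1" and m2: "m2 < M2"
begin

abbreviation "C1 \<equiv> PiM {..<M1} (\<lambda>_. G1)"
abbreviation "C2 \<equiv> PiM {..<M2} (\<lambda>_. G2)"

lemma codebook_component_measurable [measurable]:
  "m < M1 \<Longrightarrow> (\<lambda>x. x m) \<in> C1 \<rightarrow>\<^sub>M G1" "m < M2 \<Longrightarrow> (\<lambda>x. x m) \<in> C2 \<rightarrow>\<^sub>M G2"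
  by auto

text \<open>Only the codewords of the transmitted messages enter, and each has the law of a single
  word.\<close>

lemma ensemble_average_true:
  assumes [measurable]: "f \<in> borel_measurable ((G1 \<Otimes>\<^sub>M G2) \<Otimes>\<^sub>M W)"
  shows "(\<integral>\<^sup>+c1. \<integral>\<^sup>+c2. \<integral>\<^sup>+\<omega>. f ((c1 m1, c2 m2), \<omega>) \<partial>W \<partial>C2 \<partial>C1) = (\<integral>\<^sup>+x. f x \<partial>((G1 \<Otimes>\<^sub>M G2) \<Otimes>\<^sub>M W))"
proof -
  have "(\<integral>\<^sup>+c1. \<integral>\<^sup>+c2. \<integral>\<^sup>+\<omega>. f ((c1 m1, c2 m2), \<omega>) \<partial>W \<partial>C2 \<partial>C1)
      = (\<integral>\<^sup>+c1. (\<integral>\<^sup>+b. \<integral>\<^sup>+\<omega>. f ((c1 m1, b), \<omega>) \<partial>W \<partial>G2) \<partial>C1)"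
  proof (intro nn_integral_cong)
    fix c1 assume "c1 \<in> space C1"
    then have [measurable]: "c1 m1 \<in> space G1" using m1 by (auto simp: space_PiM)
    show "(\<integral>\<^sup>+c2. (\<integral>\<^sup>+\<omega>. f ((c1 m1, c2 m2), \<omega>) \<partial>W) \<partial>C2) = (\<integral>\<^sup>+b. \<integral>\<^sup>+\<omega>. f ((c1 m1, b), \<omega>) \<partial>W \<partial>G2)"
      by (rule nn_integral_PiM_component[OF G2]) (use m2 in auto)
  qed
  also have "\<dots> = (\<integral>\<^sup>+a. (\<integral>\<^sup>+b. \<integral>\<^sup>+\<omega>. f ((a, b), \<omega>) \<partial>W \<partial>G2) \<partial>G1)"
    by (rule nn_integral_PiM_component[OF G1]) (use m1 in auto)
  also have "\<dots> = (\<integral>\<^sup>+p. \<integral>\<^sup>+\<omega>. f (p, \<omega>) \<partial>W \<partial>(G1 \<Otimes>\<^sub>M G2))"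
    by (subst G2.nn_integral_fst[symmetric]) auto
  also have "\<dots> = (\<integral>\<^sup>+x. f x \<partial>((G1 \<Otimes>\<^sub>M G2) \<Otimes>\<^sub>M W))"
    by (subst W.nn_integral_fst) auto
  finally show ?thesis .
qed

context
  fixes \<omega> assumes \<omega>: "\<omega> \<in> space W"
begin

lemma received_in_space:
  "a \<in> space G1 \<Longrightarrow> b \<in> space G2 \<Longrightarrow> Y ((a, b), \<omega>) \<in> space S"
  using measurable_space[OF Y, of "((a, b), \<omega>)"] \<omega> by (simp add: space_pair_measure)

text \<open>The output depends on the codewords of \<open>m1\<close> and \<open>m2\<close> alone. A
  wrong first word can therefore be drawn last, with output and second word fixed, which is the
  situation of \<open>p1\<close>.\<close>

lemma ensemble_average_wrong1:
  assumes m: "m < M1" "m \<noteq> m1"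
  shows "(\<integral>\<^sup>+c1. \<integral>\<^sup>+c2. indicator A ((c1 m, c2 m2), Y ((c1 m1, c2 m2), \<omega>)) \<partial>C2 \<partial>C1) \<le> p1"
proof (rule nn_integral_swap_le)
  note [measurable] = \<omega>
  show "sigma_finite_measure C1" "prob_space C2"
    by (auto intro!: prob_space_imp_sigma_finite prob_space_PiM G1 G2)
  show "(\<lambda>(c1, c2). indicator A ((c1 m, c2 m2), Y ((c1 m1, c2 m2), \<omega>))) \<in> borel_measurable (C1 \<Otimes>\<^sub>M C2)"
    using m m1 m2 by measurable
  fix c2 assume "c2 \<in> space C2"
  then have b [measurable]: "c2 m2 \<in> space G2" using m2 by (auto simp: space_PiM)
  show "(\<integral>\<^sup>+c1. indicator A ((c1 m, c2 m2), Y ((c1 m1, c2 m2), \<omega>)) \<partial>C1) \<le> p1"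
  proof (rule nn_integral_PiM_resample_le[OF G1, of _ m])
    show "(\<lambda>c1. indicator A ((c1 m, c2 m2), Y ((c1 m1, c2 m2), \<omega>))) \<in> borel_measurable C1"
      using m m1 by measurable
    fix x assume "x \<in> space (PiM ({..<M1} - {m}) (\<lambda>_. G1))"
    then have "x m1 \<in> space G1" using m m1 by (auto simp: space_PiM)
    then show "(\<integral>\<^sup>+a. indicator A (((x(m := a)) m, c2 m2), Y (((x(m := a)) m1, c2 m2), \<omega>)) \<partial>G1) \<le> p1"
      using m b by (simp add: p1 received_in_space)
  qed (use m in auto)
qed

lemma ensemble_average_wrong2:
  assumes m: "m < M2" "m \<noteq> m2"
  shows "(\<integral>\<^sup>+c1. \<integral>\<^sup>+c2. indicator A ((c1 m1, c2 m), Y ((c1 m1, c2 m2), \<omega>)) \<partial>C2 \<partial>C1) \<le> p2"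
proof -
  note [measurable] = \<omega>
  have "(\<integral>\<^sup>+c2. indicator A ((c1 m1, c2 m), Y ((c1 m1, c2 m2), \<omega>)) \<partial>C2) \<le> p2" if "c1 \<in> space C1" for c1
  proof (rule nn_integral_PiM_resample_le[OF G2, of _ m])
    have a [measurable]: "c1 m1 \<in> space G1" using that m1 by (auto simp: space_PiM)
    show "(\<lambda>c2. indicator A ((c1 m1, c2 m), Y ((c1 m1, c2 m2), \<omega>))) \<in> borel_measurable C2"
      using m m2 by measurable
    fix x assume "x \<in> space (PiM ({..<M2} - {m}) (\<lambda>_. G2))"
    then have "x m2 \<in> space G2" using m m2 by (auto simp: space_PiM)
    then show "(\<integral>\<^sup>+b. indicator A ((c1 m1, (x(m := b)) m), Y ((c1 m1, (x(m := b)) m2), \<omega>)) \<partial>G2) \<le> p2"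
      using m a by (simp add: p2 received_in_space)
  qed (use m in auto)
  then have "(\<integral>\<^sup>+c1. \<integral>\<^sup>+c2. indicator A ((c1 m1, c2 m), Y ((c1 m1, c2 m2), \<omega>)) \<partial>C2 \<partial>C1) \<le> (\<integral>\<^sup>+c1. p2 \<partial>C1)"
    by (intro nn_integral_mono)
  then show ?thesis
    using prob_space.emeasure_space_1[OF prob_space_PiM[of "{..<M1}" "\<lambda>_. G1"]] G1 by simp
qed

text \<open>Both competing words are independent of the output. \<open>p12\<close> integrates the
  first word inside the second, so the codebooks are exchanged before the two wrong words are drawn
  last in turn.\<close>

lemma ensemble_average_wrong12:
  assumes m: "m < M1" "m \<noteq> m1" "m' < M2" "m' \<noteq> m2"
  shows "(\<integral>\<^sup>+c1. \<integral>\<^sup>+c2. indicator A ((c1 m, c2 m'), Y ((c1 m1, c2 m2), \<omega>)) \<partial>C2 \<partial>C1) \<le> p12"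
proof -
  note [measurable] = \<omega>
  let ?K = "PiM ({..<M1} - {m}) (\<lambda>_. G1)"
  have C: "prob_space C1" "prob_space C2" "prob_space ?K" by (auto intro!: prob_space_PiM G1 G2)
  interpret C12: pair_sigma_finite C1 C2
    by (intro pair_sigma_finite.intro prob_space_imp_sigma_finite C)
  have [measurable]: "(\<lambda>x. x m1) \<in> ?K \<rightarrow>\<^sub>M G1" using m m1 by simp
  have "(\<integral>\<^sup>+c1. \<integral>\<^sup>+c2. indicator A ((c1 m, c2 m'), Y ((c1 m1, c2 m2), \<omega>)) \<partial>C2 \<partial>C1)
      = (\<integral>\<^sup>+c2. \<integral>\<^sup>+c1. indicator A ((c1 m, c2 m'), Y ((c1 m1, c2 m2), \<omega>)) \<partial>C1 \<partial>C2)"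
    using m m1 m2 by (intro C12.Fubini'[symmetric]) measurable
  also have "\<dots> = (\<integral>\<^sup>+c2. \<integral>\<^sup>+x. (\<integral>\<^sup>+a. indicator A ((a, c2 m'), Y ((x m1, c2 m2), \<omega>)) \<partial>G1) \<partial>?K \<partial>C2)"
  proof (intro nn_integral_cong)
    fix c2 assume "c2 \<in> space C2"
    then have [measurable]: "c2 m2 \<in> space G2" "c2 m' \<in> space G2" using m m2 by (auto simp: space_PiM)
    have "(\<lambda>c1. indicator A ((c1 m, c2 m'), Y ((c1 m1, c2 m2), \<omega>)) :: ennreal) \<in> borel_measurable C1"
      using m m1 by measurable
    from nn_integral_PiM_resample[OF G1 _ _ this, of m]
    show "(\<integral>\<^sup>+c1. indicator A ((c1 m, c2 m'), Y ((c1 m1, c2 m2), \<omega>)) \<partial>C1)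
        = (\<integral>\<^sup>+x. (\<integral>\<^sup>+a. indicator A ((a, c2 m'), Y ((x m1, c2 m2), \<omega>)) \<partial>G1) \<partial>?K)"
      using m by simp
  qed
  also have "\<dots> \<le> p12"
  proof (rule nn_integral_swap_le[OF prob_space_imp_sigma_finite[OF C(2)] C(3)])
    show "(\<lambda>(c2, x). \<integral>\<^sup>+a. indicator A ((a, c2 m'), Y ((x m1, c2 m2), \<omega>)) \<partial>G1) \<in> borel_measurable (C2 \<Otimes>\<^sub>M ?K)"
      using m m2 by measurable
    fix x assume "x \<in> space ?K"
    then have a [measurable]: "x m1 \<in> space G1" using m m1 by (auto simp: space_PiM)
    show "(\<integral>\<^sup>+c2. (\<integral>\<^sup>+a. indicator A ((a, c2 m'), Y ((x m1, c2 m2), \<omega>)) \<partial>G1) \<partial>C2) \<le> p12"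
    proof (rule nn_integral_PiM_resample_le[OF G2, of _ m'])
      show "(\<lambda>c2. \<integral>\<^sup>+a. indicator A ((a, c2 m'), Y ((x m1, c2 m2), \<omega>)) \<partial>G1) \<in> borel_measurable C2"
        using m m2 by measurable
      fix x' assume "x' \<in> space (PiM ({..<M2} - {m'}) (\<lambda>_. G2))"
      then have "x' m2 \<in> space G2" using m m2 by (auto simp: space_PiM)
      then show "(\<integral>\<^sup>+b. \<integral>\<^sup>+a. indicator A ((a, (x'(m' := b)) m'), Y ((x m1, (x'(m' := b)) m2), \<omega>)) \<partial>G1 \<partial>G2) \<le> p12"
        using m a by (simp add: p12 received_in_space)
    qed (use m in auto)
  qed
  finally show ?thesis .
qed

end

text \<open>The union bound, with the wrong pairs sorted by whether the first message, the second or
  both differ from the transmitted ones.\<close>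

lemma ensemble_average_failure:
  "(\<integral>\<^sup>+c1. \<integral>\<^sup>+c2. emeasure W (failure M1 M2 c1 c2 m1 m2) + H (c1 m1, c2 m2) \<partial>C2 \<partial>C1)
   \<le> e0 + of_nat (M1 - 1) * p1 + of_nat (M2 - 1) * p2 + of_nat (M1 - 1) * of_nat (M2 - 1) * p12 + h"
proof -
  define K1 K2 where "K1 = {..<M1} - {m1}" and "K2 = {..<M2} - {m2}"
  have K: "finite K1" "finite K2" "card K1 = M1 - 1" "card K2 = M2 - 1"
    using m1 m2 by (auto simp: K1_def K2_def)
  have K1: "m < M1" "m \<noteq> m1" if "m \<in> K1" for m using that by (auto simp: K1_def)
  have K2: "m < M2" "m \<noteq> m2" if "m \<in> K2" for m using that by (auto simp: K2_def)
  note [measurable] = m1 m2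
  \<comment> \<open>The bounds for wrong words hold for each fixed noise, whereas the failure
    probability integrates the noise first. On the joint product \<open>Q\<close> either order is
    available.\<close>
  define Q where "Q = (C1 \<Otimes>\<^sub>M C2) \<Otimes>\<^sub>M W"
  have C1: "prob_space C1" and C2: "prob_space C2" by (auto intro!: prob_space_PiM G1 G2)
  interpret C1: prob_space C1 by (rule C1)
  interpret C2: prob_space C2 by (rule C2)
  define T where "T k k' x = (indicator A ((fst (fst x) k, snd (fst x) k'),
      Y ((fst (fst x) m1, snd (fst x) m2), snd x)) :: ennreal)" for k k' and x :: "((nat \<Rightarrow> 'a) \<times> (nat \<Rightarrow> 'b)) \<times> 'w"
  define T0 where "T0 x = (indicator (- A) ((fst (fst x) m1, snd (fst x) m2),
      Y ((fst (fst x) m1, snd (fst x) m2), snd x)) :: ennreal)" for x :: "((nat \<Rightarrow> 'a) \<times> (nat \<Rightarrow> 'b)) \<times> 'w"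
  define TH where "TH x = H (fst (fst x) m1, snd (fst x) m2)" for x :: "((nat \<Rightarrow> 'a) \<times> (nat \<Rightarrow> 'b)) \<times> 'w"
  have [measurable]: "T k k' \<in> borel_measurable Q" if "k < M1" "k' < M2" for k k'
    unfolding T_def Q_def using that m1 m2 by measurable
  have "T0 = (\<lambda>x. 1 - T m1 m2 x)"
    by (auto simp: T0_def T_def indicator_def)
  then have [measurable]: "T0 \<in> borel_measurable Q" using m1 m2 by simp
  have [measurable]: "TH \<in> borel_measurable Q" unfolding TH_def Q_def using m1 m2 by measurable
  have iter: "integral\<^sup>N Q f = (\<integral>\<^sup>+c1. \<integral>\<^sup>+c2. \<integral>\<^sup>+\<omega>. f ((c1, c2), \<omega>) \<partial>W \<partial>C2 \<partial>C1)"
    if f: "f \<in> borel_measurable Q" for f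
  proof -
    note [measurable] = f[unfolded Q_def]
    have "integral\<^sup>N Q f = (\<integral>\<^sup>+p. \<integral>\<^sup>+\<omega>. f (p, \<omega>) \<partial>W \<partial>(C1 \<Otimes>\<^sub>M C2))"
      unfolding Q_def by (rule W.nn_integral_fst[symmetric]) measurable
    also have "\<dots> = (\<integral>\<^sup>+c1. \<integral>\<^sup>+c2. \<integral>\<^sup>+\<omega>. f ((c1, c2), \<omega>) \<partial>W \<partial>C2 \<partial>C1)"
      by (rule C2.nn_integral_fst[symmetric]) measurable
    finally show ?thesis .
  qed
  have q0: "integral\<^sup>N Q T0 \<le> e0"
  proof -
    have [measurable]: "(\<lambda>x. indicator (- A) (fst x, Y x) :: ennreal) \<in> borel_measurable ((G1 \<Otimes>\<^sub>M G2) \<Otimes>\<^sub>M W)"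
    proof -
      have "(\<lambda>x. indicator (- A) (fst x, Y x) :: ennreal) = (\<lambda>x. 1 - indicator A (fst x, Y x))"
        by (auto simp: indicator_def)
      then show ?thesis by simp
    qed
    have "integral\<^sup>N Q T0 = (\<integral>\<^sup>+c1. \<integral>\<^sup>+c2. \<integral>\<^sup>+\<omega>. indicator (- A) ((c1 m1, c2 m2), Y ((c1 m1, c2 m2), \<omega>)) \<partial>W \<partial>C2 \<partial>C1)"
      by (subst iter) (auto simp: T0_def)
    also have "\<dots> = (\<integral>\<^sup>+x. indicator (- A) (fst x, Y x) \<partial>((G1 \<Otimes>\<^sub>M G2) \<Otimes>\<^sub>M W))"
      using ensemble_average_true[of "\<lambda>x. indicator (- A) (fst x, Y x)"] by simp
    finally show ?thesis using e0 by simp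
  qed
  have qH: "integral\<^sup>N Q TH \<le> h"
  proof -
    have "integral\<^sup>N Q TH = (\<integral>\<^sup>+c1. \<integral>\<^sup>+c2. \<integral>\<^sup>+\<omega>. H (c1 m1, c2 m2) \<partial>W \<partial>C2 \<partial>C1)"
      by (subst iter) (auto simp: TH_def)
    also have "\<dots> = (\<integral>\<^sup>+x. H (fst x) \<partial>((G1 \<Otimes>\<^sub>M G2) \<Otimes>\<^sub>M W))"
      using ensemble_average_true[of "\<lambda>x. H (fst x)"] by simp
    also have "\<dots> = (\<integral>\<^sup>+x. H x \<partial>(G1 \<Otimes>\<^sub>M G2))"
      by (subst W.nn_integral_fst[symmetric]) (auto simp: W.emeasure_space_1)
    finally show ?thesis using h by simp
  qed
  have swap: "integral\<^sup>N Q (T k k') \<le> p"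
    if k: "k < M1" "k' < M2" and le: "\<And>\<omega>. \<omega> \<in> space W \<Longrightarrow>
        (\<integral>\<^sup>+c1. \<integral>\<^sup>+c2. indicator A ((c1 k, c2 k'), Y ((c1 m1, c2 m2), \<omega>)) \<partial>C2 \<partial>C1) \<le> p" for k k' p
  proof -
    have Tm [measurable]: "T k k' \<in> borel_measurable ((C1 \<Otimes>\<^sub>M C2) \<Otimes>\<^sub>M W)" using k by (simp flip: Q_def)
    have "integral\<^sup>N Q (T k k') = (\<integral>\<^sup>+p. \<integral>\<^sup>+\<omega>. T k k' (p, \<omega>) \<partial>W \<partial>(C1 \<Otimes>\<^sub>M C2))"
      unfolding Q_def by (rule W.nn_integral_fst[symmetric]) measurable
    also have "\<dots> \<le> p"
    proof (rule nn_integral_swap_le)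
      show "sigma_finite_measure (C1 \<Otimes>\<^sub>M C2)" by (intro prob_space_imp_sigma_finite prob_space_pair C1 C2)
      fix \<omega> assume [measurable]: "\<omega> \<in> space W"
      have "(\<integral>\<^sup>+p. T k k' (p, \<omega>) \<partial>(C1 \<Otimes>\<^sub>M C2)) = (\<integral>\<^sup>+c1. \<integral>\<^sup>+c2. T k k' ((c1, c2), \<omega>) \<partial>C2 \<partial>C1)"
        by (rule C2.nn_integral_fst[symmetric]) measurable
      then show "(\<integral>\<^sup>+p. T k k' (p, \<omega>) \<partial>(C1 \<Otimes>\<^sub>M C2)) \<le> p"
        using le[OF \<open>\<omega> \<in> space W\<close>] by (simp add: T_def)
    qed (use W in auto)
    finally show ?thesis .
  qed
  have q1: "integral\<^sup>N Q (T k m2) \<le> p1" if "k \<in> K1" for k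
    using K1[OF that] m2 by (intro swap ensemble_average_wrong1)
  have q2: "integral\<^sup>N Q (T m1 k) \<le> p2" if "k \<in> K2" for k
    using K2[OF that] m1 by (intro swap ensemble_average_wrong2)
  have q12: "integral\<^sup>N Q (T k k') \<le> p12" if "k \<in> K1" "k' \<in> K2" for k k'
    using K1[OF that(1)] K2[OF that(2)] by (intro swap ensemble_average_wrong12)
  define F where "F x = T0 x + (\<Sum>k\<in>K1. T k m2 x) + (\<Sum>k\<in>K2. T m1 k x) + (\<Sum>k\<in>K1. \<Sum>k'\<in>K2. T k k' x) + TH x" for x
  have Fm: "F \<in> borel_measurable Q"
    unfolding F_def using K1 K2 m1 m2 by measurable
  have "emeasure W (failure M1 M2 c1 c2 m1 m2) + H (c1 m1, c2 m2) \<le> (\<integral>\<^sup>+\<omega>. F ((c1, c2), \<omega>) \<partial>W)"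
    if c: "c1 \<in> space C1" "c2 \<in> space C2" for c1 c2
  proof -
    have [measurable]: "k < M1 \<Longrightarrow> c1 k \<in> space G1" "k < M2 \<Longrightarrow> c2 k \<in> space G2" for k
      using c by (auto simp: space_PiM)
    have fm: "failure M1 M2 c1 c2 m1 m2 \<in> sets W"
      unfolding failure_def using m1 m2 by measurable
    have "emeasure W (failure M1 M2 c1 c2 m1 m2) + H (c1 m1, c2 m2)
        = (\<integral>\<^sup>+\<omega>. indicator (failure M1 M2 c1 c2 m1 m2) \<omega> + H (c1 m1, c2 m2) \<partial>W)"
      using fm by (subst nn_integral_add) (auto simp: W.emeasure_space_1)
    also have "\<dots> \<le> (\<integral>\<^sup>+\<omega>. F ((c1, c2), \<omega>) \<partial>W)"
    proof (intro nn_integral_mono)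
      fix \<omega> assume "\<omega> \<in> space W"
      have "(indicator (failure M1 M2 c1 c2 m1 m2) \<omega> :: ennreal)
          \<le> T0 ((c1, c2), \<omega>) + (\<Sum>k\<in>K1. T k m2 ((c1, c2), \<omega>)) + (\<Sum>k\<in>K2. T m1 k ((c1, c2), \<omega>))
            + (\<Sum>k\<in>K1. \<Sum>k'\<in>K2. T k k' ((c1, c2), \<omega>))" (is "_ \<le> ?a + ?b + ?c + ?d")
      proof (cases "\<omega> \<in> failure M1 M2 c1 c2 m1 m2")
        case True
        then consider (0) "T0 ((c1, c2), \<omega>) = 1" | (1) k where "k \<in> K1" "T k m2 ((c1, c2), \<omega>) = 1"
          | (2) k where "k \<in> K2" "T m1 k ((c1, c2), \<omega>) = 1"
          | (12) k k' where "k \<in> K1" "k' \<in> K2" "T k k' ((c1, c2), \<omega>) = 1"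
          by (auto simp: failure_def T0_def T_def K1_def K2_def indicator_def split: if_splits)
        then have "1 \<le> ?a \<or> 1 \<le> ?b \<or> 1 \<le> ?c \<or> 1 \<le> ?d"
        proof cases
          case 0 then show ?thesis by simp
        next
          case 1
          then have "1 \<le> ?b" using member_le_sum[of k K1 "\<lambda>k. T k m2 ((c1, c2), \<omega>)"] K by auto
          then show ?thesis by simp
        next
          case 2
          then have "1 \<le> ?c" using member_le_sum[of k K2 "\<lambda>k. T m1 k ((c1, c2), \<omega>)"] K by auto
          then show ?thesis by simp
        next
          case 12
          then have "1 \<le> (\<Sum>k'\<in>K2. T k k' ((c1, c2), \<omega>))"
            using member_le_sum[of k' K2 "\<lambda>k'. T k k' ((c1, c2), \<omega>)"] K by auto
          also have "\<dots> \<le> ?d"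
            using member_le_sum[of k K1 "\<lambda>k. \<Sum>k'\<in>K2. T k k' ((c1, c2), \<omega>)"] K 12 by auto
          finally show ?thesis by simp
        qed
        then have "1 \<le> ?a + ?b + ?c + ?d"
          by (elim disjE) (auto intro: order_trans add_increasing add_increasing2)
        then show ?thesis using True by simp
      qed simp
      then show "indicator (failure M1 M2 c1 c2 m1 m2) \<omega> + H (c1 m1, c2 m2) \<le> F ((c1, c2), \<omega>)"
        unfolding F_def TH_def by (intro add_mono) auto
    qed
    finally show ?thesis .
  qed
  then have "(\<integral>\<^sup>+c1. \<integral>\<^sup>+c2. emeasure W (failure M1 M2 c1 c2 m1 m2) + H (c1 m1, c2 m2) \<partial>C2 \<partial>C1)
     \<le> integral\<^sup>N Q F"
    unfolding iter[OF Fm] by (intro nn_integral_mono) auto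
  also have "\<dots> = integral\<^sup>N Q T0 + (\<Sum>k\<in>K1. integral\<^sup>N Q (T k m2)) + (\<Sum>k\<in>K2. integral\<^sup>N Q (T m1 k))
      + (\<Sum>k\<in>K1. \<Sum>k'\<in>K2. integral\<^sup>N Q (T k k')) + integral\<^sup>N Q TH"
    unfolding F_def using K1 K2 m1 m2 by (simp add: nn_integral_add nn_integral_sum)
  also have "\<dots> \<le> e0 + (\<Sum>k\<in>K1. p1) + (\<Sum>k\<in>K2. p2) + (\<Sum>k\<in>K1. \<Sum>k'\<in>K2. p12) + h"
    by (intro add_mono sum_mono q0 q1 q2 q12 qH)
  also have "\<dots> = e0 + of_nat (M1 - 1) * p1 + of_nat (M2 - 1) * p2 + of_nat (M1 - 1) * of_nat (M2 - 1) * p12 + h"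
    by (simp add: K mult.assoc)
  finally show ?thesis .
qed

text \<open>For fixed codebooks the failure event is a section of one measurable set of the joint
  space, and the measure of a section depends measurably on where it is taken.\<close>

lemma failure_measurable [measurable]:
  "(\<lambda>p. emeasure W (failure M1 M2 (fst p) (snd p) m1 m2)) \<in> borel_measurable (C1 \<Otimes>\<^sub>M C2)"
proof -
  define B where "B = {x \<in> space ((C1 \<Otimes>\<^sub>M C2) \<Otimes>\<^sub>M W). snd x \<in> failure M1 M2 (fst (fst x)) (snd (fst x)) m1 m2}"
  have B: "B = {x \<in> space ((C1 \<Otimes>\<^sub>M C2) \<Otimes>\<^sub>M W).
     ((fst (fst x) m1, snd (fst x) m2), Y ((fst (fst x) m1, snd (fst x) m2), snd x)) \<notin> A \<or>
     (\<exists>m1'<M1. \<exists>m2'<M2. (m1', m2') \<noteq> (m1, m2) \<and>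
        ((fst (fst x) m1', snd (fst x) m2'), Y ((fst (fst x) m1, snd (fst x) m2), snd x)) \<in> A)}"
    by (auto simp: B_def failure_def space_pair_measure)
  have mB [measurable]: "B \<in> sets ((C1 \<Otimes>\<^sub>M C2) \<Otimes>\<^sub>M W)"
    unfolding B using m1 m2 by measurable
  have "emeasure W (failure M1 M2 (fst p) (snd p) m1 m2) = emeasure W (Pair p -` B)"
    if "p \<in> space (C1 \<Otimes>\<^sub>M C2)" for p
    using that by (intro arg_cong[where f = "emeasure W"]) (auto simp: B_def failure_def space_pair_measure)
  then show ?thesis
    using W.measurable_emeasure_Pair[OF mB] by (subst measurable_cong) auto
qed

end

text \<open>If every pair of codebooks exceeded the right-hand side, so would the average, against
  the ensemble bound. Failure and cost stay in one sum, so that a single pair of codebooks controls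
  both.\<close>

lemma mac_codebook_exists:
  assumes M: "1 \<le> M1" "1 \<le> M2"
    and d: "e0 + of_nat (M1 - 1) * p1 + of_nat (M2 - 1) * p2 + of_nat (M1 - 1) * of_nat (M2 - 1) * p12 + h < d"
  obtains c1 c2 where "\<And>m. m < M1 \<Longrightarrow> c1 m \<in> space G1" "\<And>m. m < M2 \<Longrightarrow> c2 m \<in> space G2"
    "(\<Sum>m1<M1. \<Sum>m2<M2. emeasure W (failure M1 M2 c1 c2 m1 m2) + H (c1 m1, c2 m2)) \<le> of_nat M1 * of_nat M2 * d"
proof (rule ccontr)
  assume neg: "\<not> thesis"
  note witness = that
  let ?C1 = "PiM {..<M1} (\<lambda>_. G1)" and ?C2 = "PiM {..<M2} (\<lambda>_. G2)"
  let ?T = "\<lambda>c1 c2 m1 m2. emeasure W (failure M1 M2 c1 c2 m1 m2) + H (c1 m1, c2 m2)"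
  define B where "B = e0 + of_nat (M1 - 1) * p1 + of_nat (M2 - 1) * p2 + of_nat (M1 - 1) * of_nat (M2 - 1) * p12 + h"
  interpret C1: prob_space ?C1 by (auto intro!: prob_space_PiM G1)
  interpret C2: prob_space ?C2 by (auto intro!: prob_space_PiM G2)
  note [measurable] = failure_measurable codebook_component_measurable
  have mT [measurable]: "(\<lambda>p. ?T (fst p) (snd p) m1 m2) \<in> borel_measurable (?C1 \<Otimes>\<^sub>M ?C2)"
    if "m1 < M1" "m2 < M2" for m1 m2 using that by measurable
  have mT1: "(\<lambda>c2. ?T c1 c2 m1 m2) \<in> borel_measurable ?C2"
    if "m1 < M1" "m2 < M2" "c1 \<in> space ?C1" for m1 m2 c1
    using measurable_compose[OF measurable_Pair1'[OF that(3)] mT[OF that(1,2)]] by simp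
  have mT2: "(\<lambda>c1. \<integral>\<^sup>+c2. ?T c1 c2 m1 m2 \<partial>?C2) \<in> borel_measurable ?C1"
    if "m1 < M1" "m2 < M2" for m1 m2
    using C2.borel_measurable_nn_integral_fst[OF mT[OF that]] by simp
  have "of_nat M1 * of_nat M2 * d \<le> (\<Sum>m1<M1. \<Sum>m2<M2. ?T c1 c2 m1 m2)"
    if "c1 \<in> space ?C1" "c2 \<in> space ?C2" for c1 c2
  proof (rule ccontr)
    assume "\<not> ?thesis"
    then have "(\<Sum>m1<M1. \<Sum>m2<M2. ?T c1 c2 m1 m2) \<le> of_nat M1 * of_nat M2 * d" by (simp add: not_le less_imp_le)
    moreover have "\<And>m. m < M1 \<Longrightarrow> c1 m \<in> space G1" "\<And>m. m < M2 \<Longrightarrow> c2 m \<in> space G2"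
      using that by (auto simp: space_PiM)
    ultimately have thesis by (intro witness)
    with neg show False ..
  qed
  then have "(\<integral>\<^sup>+c1. \<integral>\<^sup>+c2. of_nat M1 * of_nat M2 * d \<partial>?C2 \<partial>?C1)
      \<le> (\<integral>\<^sup>+c1. \<integral>\<^sup>+c2. (\<Sum>m1<M1. \<Sum>m2<M2. ?T c1 c2 m1 m2) \<partial>?C2 \<partial>?C1)"
    by (intro nn_integral_mono) auto
  also have "\<dots> = (\<integral>\<^sup>+c1. (\<Sum>m1<M1. \<Sum>m2<M2. \<integral>\<^sup>+c2. ?T c1 c2 m1 m2 \<partial>?C2) \<partial>?C1)"
    by (intro nn_integral_cong, subst nn_integral_sum, force intro!: borel_measurable_sum mT1,
        intro sum.cong refl nn_integral_sum mT1) auto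
  also have "\<dots> = (\<Sum>m1<M1. \<Sum>m2<M2. \<integral>\<^sup>+c1. \<integral>\<^sup>+c2. ?T c1 c2 m1 m2 \<partial>?C2 \<partial>?C1)"
    by (subst nn_integral_sum, force intro!: borel_measurable_sum mT2,
        intro sum.cong refl nn_integral_sum mT2) auto
  also have "\<dots> \<le> (\<Sum>m1<M1. \<Sum>m2<M2. B)"
    unfolding B_def by (intro sum_mono ensemble_average_failure) auto
  also have "\<dots> = of_nat M1 * of_nat M2 * B" by (simp add: mult.assoc)
  \<comment> \<open>The strict inequality survives the multiplication because the factor is positive
    and finite.\<close>
  also have "\<dots> < of_nat M1 * of_nat M2 * d"
  proof (rule ennreal_mult_strict_left_mono)
    show "B < d" using d by (simp add: B_def)
    show "of_nat M1 * of_nat M2 < (top_class.top :: ennreal)"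
      by (simp add: ennreal_mult_less_top of_nat_less_top)
    show "0 < (of_nat M1 * of_nat M2 :: ennreal)"
      using M by (simp add: ennreal_zero_less_mult_iff)
  qed
  finally show False
    by (simp add: C1.emeasure_space_1 C2.emeasure_space_1)
qed

end

section \<open>Matched filters\<close>

lemma det_mat_2:
  fixes A :: "'a :: comm_ring_1 mat"
  assumes A: "A \<in> carrier_mat 2 2"
  shows "det A = A $$ (0,0) * A $$ (1,1) - A $$ (0,1) * A $$ (1,0)"
proof -
  have "det (mat_delete A 0 0) = A $$ (1,1)" "det (mat_delete A 0 (Suc 0)) = A $$ (1,0)"
    using A by (subst det_single; auto simp: mat_delete_def)+
  then show ?thesis
    using A by (subst laplace_expansion_row[OF A, of 0]) (auto simp: cofactor_def numeral_2_eq_2)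
qed

text \<open>The matrix determinant lemma for K + u u^T with K symmetric of size 2. The pair (s, t)
  stands for K^-1 u and is given through u = K (s, t), which avoids the inverse.\<close>

lemma det2_rank_one_update:
  fixes p q r s t :: real
  assumes "u0 = p * s + q * t" "u1 = q * s + r * t"
  shows "(u0 * u0 + p) * (u1 * u1 + r) - (u0 * u1 + q) * (u0 * u1 + q) = (p * r - q * q) * (1 + (s * u0 + t * u1))"
  unfolding assms by (simp add: algebra_simps)

text \<open>Sylvester's identity det (K + U U^T) = det K det (I + U^T K^-1 U), where U has the
  columns u and w; (s, t) and (x, y) stand for K^-1 u and K^-1 w.\<close>

lemma det2_rank_two_update:
  fixes p q r s t x y :: real
  assumes "u0 = p * s + q * t" "u1 = q * s + r * t" "w0 = p * x + q * y" "w1 = q * x + r * y"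
  shows "(u0 * u0 + w0 * w0 + p) * (u1 * u1 + w1 * w1 + r)
      - (u0 * u1 + w0 * w1 + q) * (u0 * u1 + w0 * w1 + q)
    = (p * r - q * q) * ((1 + (s * u0 + t * u1)) * (1 + (x * w0 + y * w1)) - (s * w0 + t * w1)\<^sup>2)"
  unfolding assms power2_eq_square by (simp add: algebra_simps)
lemma mat_inverse_exists:
  fixes A :: "real mat"
  assumes A: "A \<in> carrier_mat n n" and det: "det A \<noteq> 0"
  obtains B where "B \<in> carrier_mat n n" "A * B = 1\<^sub>m n" "B * A = 1\<^sub>m n"
  using det_non_zero_imp_unit[OF A det, of undefined]
  unfolding Units_def ring_mat_def by auto

lemma conjugate_outer_mat:
  assumes D: "D \<in> carrier_mat k \<eta>" and a: "a \<in> carrier_vec \<eta>"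
  shows "D * outer_mat a * transpose_mat D = outer_mat (D *\<^sub>v a)"
proof (rule eq_matI)
  fix i j assume ij: "i < dim_row (outer_mat (D *\<^sub>v a))" "j < dim_col (outer_mat (D *\<^sub>v a))"
  then have i: "i < k" and j: "j < k" using D by (auto simp: outer_mat_def)
  have o: "outer_mat a \<in> carrier_mat \<eta> \<eta>" using a by (simp add: outer_mat_def)
  have row: "(D * outer_mat a) $$ (i, l) = (D *\<^sub>v a) $ i * a $ l" if "l < \<eta>" for l
    using D a i that
    by (auto simp: outer_mat_def scalar_prod_def sum_distrib_left sum_distrib_right mult_ac)
  have "(D * outer_mat a * transpose_mat D) $$ (i, j) = (\<Sum>l<\<eta>. (D * outer_mat a) $$ (i, l) * D $$ (j, l))"
    using D o i j by (simp add: scalar_prod_def atLeast0LessThan del: assoc_mult_mat)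
  also have "\<dots> = (\<Sum>l<\<eta>. (D *\<^sub>v a) $ i * (a $ l * D $$ (j, l)))"
    by (intro sum.cong) (auto simp: row)
  also have "\<dots> = (D *\<^sub>v a) $ i * (\<Sum>l<\<eta>. D $$ (j, l) * a $ l)"
    by (simp add: sum_distrib_left mult.commute)
  also have "(\<Sum>l<\<eta>. D $$ (j, l) * a $ l) = (D *\<^sub>v a) $ j"
    using D a j by (simp add: scalar_prod_def atLeast0LessThan)
  finally show "(D * outer_mat a * transpose_mat D) $$ (i, j) = outer_mat (D *\<^sub>v a) $$ (i, j)"
    using i j D by (simp add: outer_mat_def)
qed (use D a in \<open>auto simp: outer_mat_def\<close>)

text \<open>This bilinear form is the covariance of x . (z + B w) and y . (z + B w), which links
  \<open>QP\<close> to the covariances of linear forms.\<close>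

lemma scalar_prod_QP:
  assumes B: "B \<in> carrier_mat \<eta> \<eta>" and x: "x \<in> carrier_vec \<eta>" and y: "y \<in> carrier_vec \<eta>"
  shows "x \<bullet> (QP N s2 \<eta> B *\<^sub>v y) = N * (x \<bullet> y) + s2 * ((transpose_mat B *\<^sub>v x) \<bullet> (transpose_mat B *\<^sub>v y))"
proof -
  have BB: "B * transpose_mat B \<in> carrier_mat \<eta> \<eta>" using B by simp
  have sm: "(c \<cdot>\<^sub>m A) *\<^sub>v y = c \<cdot>\<^sub>v (A *\<^sub>v y)" if "A \<in> carrier_mat \<eta> \<eta>" for c A
    using that y by (intro eq_vecI) (auto simp: scalar_prod_def sum_distrib_left mult.assoc)
  have "QP N s2 \<eta> B *\<^sub>v y = N \<cdot>\<^sub>v y + s2 \<cdot>\<^sub>v (B *\<^sub>v (transpose_mat B *\<^sub>v y))"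
    unfolding QP_def using B y BB
    by (subst add_mult_distrib_mat_vec[of _ \<eta> \<eta>]) (auto simp: sm)
  also have "x \<bullet> \<dots> = N * (x \<bullet> y) + s2 * (x \<bullet> (B *\<^sub>v (transpose_mat B *\<^sub>v y)))"
    using B x y by (subst scalar_prod_add_distrib[of _ \<eta>]) auto
  also have "x \<bullet> (B *\<^sub>v (transpose_mat B *\<^sub>v y)) = (transpose_mat B *\<^sub>v x) \<bullet> (transpose_mat B *\<^sub>v y)"
    using B x y by (intro transpose_vec_mult_scalar[symmetric]) auto
  finally show ?thesis .
qed

text \<open>Q dominates N I, so a vector v in the kernel of D Q D^T satisfies D^T v = 0 and lies in
  the kernel of D D^T.\<close>

lemma det_conjugate_QP_nonzero:
  assumes B: "B \<in> carrier_mat \<eta> \<eta>" and D: "D \<in> carrier_mat k \<eta>" and N: "N > 0" and s2: "s2 \<ge> 0"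
    and det: "det (D * transpose_mat D) \<noteq> 0"
  shows "det (D * QP N s2 \<eta> B * transpose_mat D) \<noteq> 0"
proof
  let ?K = "D * QP N s2 \<eta> B * transpose_mat D" and ?Dt = "transpose_mat D"
  have Q: "QP N s2 \<eta> B \<in> carrier_mat \<eta> \<eta>" using B by (simp add: QP_def)
  have K: "?K \<in> carrier_mat k k" using D Q by simp
  assume "det ?K = 0"
  then obtain v where v: "v \<in> carrier_vec k" "v \<noteq> 0\<^sub>v k" "?K *\<^sub>v v = 0\<^sub>v k"
    using det_0_iff_vec_prod_zero_field[OF K] by auto
  define x where "x = ?Dt *\<^sub>v v"
  have x: "x \<in> carrier_vec \<eta>" using D v by (simp add: x_def)
  have Kv: "?K *\<^sub>v v = D *\<^sub>v (QP N s2 \<eta> B *\<^sub>v x)"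
    unfolding x_def using D Q v(1) by (simp add: assoc_mult_mat_vec[of _ k \<eta>] assoc_mult_mat_vec[of _ k \<eta> _ k])
  have "0 = v \<bullet> (?K *\<^sub>v v)" using v by simp
  also have "\<dots> = x \<bullet> (QP N s2 \<eta> B *\<^sub>v x)"
    unfolding Kv unfolding x_def using D Q v(1) by (intro transpose_vec_mult_scalar[symmetric]) auto
  also have "\<dots> = N * (x \<bullet> x) + s2 * ((transpose_mat B *\<^sub>v x) \<bullet> (transpose_mat B *\<^sub>v x))"
    by (rule scalar_prod_QP[OF B x x])
  finally have z: "N * (x \<bullet> x) + s2 * ((transpose_mat B *\<^sub>v x) \<bullet> (transpose_mat B *\<^sub>v x)) = 0" by simp
  have nn: "0 \<le> y \<bullet> y" for y :: "real vec" by (simp add: scalar_prod_def sum_nonneg)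
  have "x \<bullet> x = 0"
    using z N s2 nn[of x] nn[of "transpose_mat B *\<^sub>v x"]
    by (smt (verit) mult_nonneg_nonneg mult_pos_pos)
  then have x0: "x = 0\<^sub>v \<eta>" using conjugate_square_eq_0_vec[OF x] by simp
  have "(D * ?Dt) *\<^sub>v v = D *\<^sub>v x" using D v(1) by (simp add: x_def assoc_mult_mat_vec[of _ k \<eta> _ k])
  also have "\<dots> = 0\<^sub>v k" using D unfolding x0 by (intro eq_vecI) (auto simp: scalar_prod_def)
  finally have "det (D * ?Dt) = 0"
    using det_0_iff_vec_prod_zero_field[of "D * ?Dt" k] v D by auto
  with det show False by simp
qed

text \<open>The vectors \<open>\<beta>\<^sub>i = D\<^sup>T (D Q D\<^sup>T)\<^sup>-\<^sup>1 D a\<^sub>i\<close> are the matched filters: the two scalars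
  \<open>\<beta>\<^sub>i \<bullet> y\<close> are sufficient for decoding, and their signal gains equal their noise covariances.\<close>

lemma matched_filters:
  assumes B: "B \<in> carrier_mat \<eta> \<eta>" and D: "D \<in> carrier_mat k \<eta>" and k: "k = 1 \<or> k = 2"
    and N: "N > 0" and s2: "s2 \<ge> 0" and det: "det (D * transpose_mat D) \<noteq> 0"
    and a1: "a1 \<in> carrier_vec \<eta>" and a2: "a2 \<in> carrier_vec \<eta>"
  obtains b1 b2 :: "real vec" and c11 c12 c22 :: real where "b1 \<in> carrier_vec \<eta>" "b2 \<in> carrier_vec \<eta>"
    "b1 \<bullet> a1 = c11" "b1 \<bullet> a2 = c12" "b2 \<bullet> a1 = c12" "b2 \<bullet> a2 = c22"
    "b1 \<bullet> (QP N s2 \<eta> B *\<^sub>v b1) = c11" "b1 \<bullet> (QP N s2 \<eta> B *\<^sub>v b2) = c12" "b2 \<bullet> (QP N s2 \<eta> B *\<^sub>v b2) = c22"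
    "rate_bound \<eta> D (outer_mat a1) (QP N s2 \<eta> B) = ln (1 + c11) / (2 * real \<eta>)"
    "rate_bound \<eta> D (outer_mat a2) (QP N s2 \<eta> B) = ln (1 + c22) / (2 * real \<eta>)"
    "rate_bound \<eta> D (outer_mat a1 + outer_mat a2) (QP N s2 \<eta> B) = ln ((1 + c11) * (1 + c22) - c12\<^sup>2) / (2 * real \<eta>)"
proof -
  define Q where "Q = QP N s2 \<eta> B"
  define K where "K = D * Q * transpose_mat D"
  have Q: "Q \<in> carrier_mat \<eta> \<eta>" using B by (simp add: Q_def QP_def)
  have K: "K \<in> carrier_mat k k" using D Q by (simp add: K_def)
  have detK: "det K \<noteq> 0"
    unfolding K_def Q_def by (rule det_conjugate_QP_nonzero[OF B D N s2 det])
  then obtain Ki where Ki: "Ki \<in> carrier_mat k k" "K * Ki = 1\<^sub>m k" by (rule mat_inverse_exists[OF K])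
  define t where "t a = Ki *\<^sub>v (D *\<^sub>v a)" for a
  have t: "t a \<in> carrier_vec k" and Kt: "K *\<^sub>v t a = D *\<^sub>v a" if "a \<in> carrier_vec \<eta>" for a
    using that D K Ki by (auto simp: t_def assoc_mult_mat_vec[of _ k k _ k, symmetric])
  define b where "b a = transpose_mat D *\<^sub>v t a" for a
  have b: "b a \<in> carrier_vec \<eta>" if "a \<in> carrier_vec \<eta>" for a using D t[OF that] by (simp add: b_def)
  have ba: "b a \<bullet> a' = t a \<bullet> (D *\<^sub>v a')" if "a \<in> carrier_vec \<eta>" "a' \<in> carrier_vec \<eta>" for a a'
    unfolding b_def using D t[OF that(1)] that by (intro transpose_vec_mult_scalar) auto
  have bQb: "b a \<bullet> (Q *\<^sub>v b a') = t a \<bullet> (D *\<^sub>v a')" if "a \<in> carrier_vec \<eta>" "a' \<in> carrier_vec \<eta>" for a a'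
  proof -
    have "b a \<bullet> (Q *\<^sub>v b a') = t a \<bullet> (D *\<^sub>v (Q *\<^sub>v b a'))"
      unfolding b_def[of a] using D Q t[OF that(1)] b[OF that(2)] by (intro transpose_vec_mult_scalar) auto
    also have "D *\<^sub>v (Q *\<^sub>v b a') = K *\<^sub>v t a'"
      unfolding b_def K_def using D Q t[OF that(2)]
      by (simp add: assoc_mult_mat_vec[of _ k \<eta>] assoc_mult_mat_vec[of _ k \<eta> _ k])
    finally show ?thesis using Kt[OF that(2)] by simp
  qed
  have sym: "b a \<bullet> (Q *\<^sub>v b a') = b a' \<bullet> (Q *\<^sub>v b a)" if "a \<in> carrier_vec \<eta>" "a' \<in> carrier_vec \<eta>" for a a'
    unfolding Q_def using b[OF that(1)] b[OF that(2)] B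
    by (simp add: scalar_prod_QP comm_scalar_prod[of "b a" \<eta> "b a'"]
        comm_scalar_prod[of "transpose_mat B *\<^sub>v b a" \<eta> "transpose_mat B *\<^sub>v b a'"])
  define c where "c a a' = t a \<bullet> (D *\<^sub>v a')" for a a'
  \<comment> \<open>\<open>c\<close> is a gain and at the same time a noise covariance, and so
    inherits the symmetry of \<open>Q\<close>.\<close>
  have csym: "c a2 a1 = c a1 a2" unfolding c_def using sym[OF a1 a2] bQb a1 a2 by simp
  have Ksym: "K $$ (j, i) = K $$ (i, j)" if "i < k" "j < k" for i j
  proof -
    have Qt: "transpose_mat Q = Q"
    proof (rule eq_matI)
      fix i j assume "i < dim_row Q" "j < dim_col Q"
      then show "transpose_mat Q $$ (i, j) = Q $$ (i, j)" using B Q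
        by (auto simp: Q_def QP_def scalar_prod_def mult.commute)
    qed (use Q in auto)
    have "transpose_mat K = K"
      unfolding K_def using D Q
      by (subst transpose_mult[of _ k \<eta> _ k], simp, simp, subst transpose_mult[of _ k \<eta> _ \<eta>])
         (auto simp: Qt assoc_mult_mat[of _ k \<eta> _ \<eta> _ k])
    then show ?thesis using K that by (metis carrier_matD index_transpose_mat(1))
  qed
  have split: "D * (S + Q) * transpose_mat D = D * S * transpose_mat D + K" if "S \<in> carrier_mat \<eta> \<eta>" for S
    unfolding K_def using D Q that
    by (simp add: mult_add_distrib_mat[of _ k \<eta>] add_mult_distrib_mat[of _ k \<eta> _ _ k])
  have oc: "outer_mat a \<in> carrier_mat (dim_vec a) (dim_vec a)" for a by (simp add: outer_mat_def)
  define u where "u = D *\<^sub>v a1"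
  define w where "w = D *\<^sub>v a2"
  have u: "u \<in> carrier_vec k" and w: "w \<in> carrier_vec k" using D a1 a2 by (auto simp: u_def w_def)
  have one: "det (D * (outer_mat a + Q) * transpose_mat D) = det (outer_mat (D *\<^sub>v a) + K)"
    if "a \<in> carrier_vec \<eta>" for a
    using that oc[of a] by (subst split) (auto simp: conjugate_outer_mat[OF D])
  have "D * (outer_mat a1 + outer_mat a2) * transpose_mat D = outer_mat u + outer_mat w"
    using D a1 a2 oc[of a1] oc[of a2]
    by (simp add: mult_add_distrib_mat[of _ k \<eta>] add_mult_distrib_mat[of _ k \<eta> _ _ k] conjugate_outer_mat[OF D] u_def w_def del: assoc_mult_mat)
  then have two: "det (D * (outer_mat a1 + outer_mat a2 + Q) * transpose_mat D) = det (outer_mat u + outer_mat w + K)"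
    using a1 a2 oc[of a1] oc[of a2] by (subst split) auto
  have dets: "det (outer_mat u + K) = det K * (1 + c a1 a1)"
    "det (outer_mat w + K) = det K * (1 + c a2 a2)"
    "det (outer_mat u + outer_mat w + K) = det K * ((1 + c a1 a1) * (1 + c a2 a2) - (c a1 a2)\<^sup>2)"
  proof -
    have out: "outer_mat v $$ (i, j) = v $ i * v $ j" if "v \<in> carrier_vec k" "i < k" "j < k" for v i j
      using that by (simp add: outer_mat_def)
    have outc: "outer_mat v \<in> carrier_mat k k" if "v \<in> carrier_vec k" for v
      using that by (simp add: outer_mat_def)
    have row: "(D *\<^sub>v a) $ i = (\<Sum>j<k. K $$ (i, j) * t a $ j)" if "a \<in> carrier_vec \<eta>" "i < k" for a i
      using Kt[OF that(1), symmetric] K t[OF that(1)] that(2) by (simp add: scalar_prod_def atLeast0LessThan)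
    have cc: "c a a' = (\<Sum>j<k. t a $ j * (D *\<^sub>v a') $ j)" if "a \<in> carrier_vec \<eta>" "a' \<in> carrier_vec \<eta>" for a a'
      using t[OF that(1)] D that(2) by (simp add: c_def scalar_prod_def atLeast0LessThan)
    \<comment> \<open>\<open>D\<close> has one or two rows, so the determinants are expanded entry
      by entry; \<open>t a1\<close> and \<open>t a2\<close> are the vectors K^-1 u and K^-1 w of the
      update identities.\<close>
    have goals: "det (outer_mat u + K) = det K * (1 + c a1 a1) \<and>
      det (outer_mat w + K) = det K * (1 + c a2 a2) \<and>
      det (outer_mat u + outer_mat w + K) = det K * ((1 + c a1 a1) * (1 + c a2 a2) - (c a1 a2)\<^sup>2)"
      using k
    proof
      assume k1: "k = 1"
      have K1: "K \<in> carrier_mat 1 1" and o1: "outer_mat u \<in> carrier_mat 1 1" "outer_mat w \<in> carrier_mat 1 1"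
        using K outc[OF u] outc[OF w] k1 by auto
      have u0: "u $ 0 = K $$ (0,0) * t a1 $ 0" "w $ 0 = K $$ (0,0) * t a2 $ 0"
        using row[OF a1, of 0] row[OF a2, of 0] k1 by (auto simp: u_def w_def)
      have cs: "c a1 a1 = t a1 $ 0 * u $ 0" "c a2 a2 = t a2 $ 0 * w $ 0" "c a1 a2 = t a1 $ 0 * w $ 0"
        using cc[OF a1 a1] cc[OF a2 a2] cc[OF a1 a2] k1 by (auto simp: u_def w_def)
      have d: "det K = K $$ (0,0)" by (rule det_single[OF K1])
      have d1: "det (outer_mat u + K) = u $ 0 * u $ 0 + K $$ (0,0)" "det (outer_mat w + K) = w $ 0 * w $ 0 + K $$ (0,0)"
        "det (outer_mat u + outer_mat w + K) = (u $ 0)\<^sup>2 + (w $ 0)\<^sup>2 + K $$ (0,0)"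
        using det_single[of "outer_mat u + K"] det_single[of "outer_mat w + K"]
          det_single[of "outer_mat u + outer_mat w + K"] K1 o1 out[OF u] out[OF w] k1 by (auto simp: power2_eq_square)
      show ?thesis
        unfolding d d1 cs u0 power2_eq_square by (simp add: algebra_simps)
    next
      assume k2: "k = 2"
      have s2: "(\<Sum>j<(2::nat). f j) = f 0 + f 1" for f :: "nat \<Rightarrow> real" by (simp add: numeral_2_eq_2)
      have K10: "K $$ (1, 0) = K $$ (0, 1)" using Ksym[of 0 1] k2 by simp
      have u01: "u $ 0 = K $$ (0,0) * t a1 $ 0 + K $$ (0,1) * t a1 $ 1" "u $ 1 = K $$ (0,1) * t a1 $ 0 + K $$ (1,1) * t a1 $ 1"
        using row[OF a1, of 0] row[OF a1, of 1] K10 unfolding k2 by (auto simp: u_def s2)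
      have w01: "w $ 0 = K $$ (0,0) * t a2 $ 0 + K $$ (0,1) * t a2 $ 1" "w $ 1 = K $$ (0,1) * t a2 $ 0 + K $$ (1,1) * t a2 $ 1"
        using row[OF a2, of 0] row[OF a2, of 1] K10 unfolding k2 by (auto simp: w_def s2)
      have cs: "c a1 a1 = t a1 $ 0 * u $ 0 + t a1 $ 1 * u $ 1" "c a2 a2 = t a2 $ 0 * w $ 0 + t a2 $ 1 * w $ 1"
        "c a1 a2 = t a1 $ 0 * w $ 0 + t a1 $ 1 * w $ 1"
        using cc[OF a1 a1] cc[OF a2 a2] cc[OF a1 a2] unfolding k2 by (auto simp: u_def w_def s2)
      have K2: "K \<in> carrier_mat 2 2" and o2: "outer_mat u \<in> carrier_mat 2 2" "outer_mat w \<in> carrier_mat 2 2"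
        using K outc[OF u] outc[OF w] k2 by auto
      have d: "det K = K $$ (0,0) * K $$ (1,1) - K $$ (0,1) * K $$ (0,1)"
        using det_mat_2[OF K2] K10 by simp
      have d1: "det (outer_mat v + K) = (v $ 0 * v $ 0 + K $$ (0,0)) * (v $ 1 * v $ 1 + K $$ (1,1))
          - (v $ 0 * v $ 1 + K $$ (0,1)) * (v $ 0 * v $ 1 + K $$ (0,1))" if v: "v \<in> carrier_vec k" for v
      proof -
        have "det (outer_mat v + K) = (outer_mat v + K) $$ (0,0) * (outer_mat v + K) $$ (1,1)
            - (outer_mat v + K) $$ (0,1) * (outer_mat v + K) $$ (1,0)"
          using K2 by (intro det_mat_2) simp
        moreover have "(outer_mat v + K) $$ (i, j) = v $ i * v $ j + K $$ (i, j)" if "i < 2" "j < 2" for i j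
          using that K2 out[OF v] k2 by simp
        ultimately show ?thesis using K10 by (simp add: mult.commute[of "v $ 1" "v $ 0"] flip: One_nat_def)
      qed
      define u0 u1 where "u0 = u $ 0" and "u1 = u $ 1"
      define w0 w1 where "w0 = w $ 0" and "w1 = w $ 1"
      have d2: "det (outer_mat u + outer_mat w + K)
          = (u0 * u0 + w0 * w0 + K $$ (0,0)) * (u1 * u1 + w1 * w1 + K $$ (1,1))
          - (u0 * u1 + w0 * w1 + K $$ (0,1)) * (u0 * u1 + w0 * w1 + K $$ (0,1))"
      proof -
        let ?M = "outer_mat u + outer_mat w + K"
        have "det ?M = ?M $$ (0,0) * ?M $$ (1,1) - ?M $$ (0,1) * ?M $$ (1,0)"
          using K2 by (intro det_mat_2) simp
        moreover have "?M $$ (i, j) = u $ i * u $ j + w $ i * w $ j + K $$ (i, j)" if "i < 2" "j < 2" for i j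
          using that K2 o2 out[OF u] out[OF w] k2 by simp
        ultimately show ?thesis using K10
          by (simp add: mult.commute[of u1 u0] mult.commute[of w1 w0] flip: One_nat_def u0_def u1_def w0_def w1_def)
      qed
      show ?thesis
        unfolding d1[OF u] d1[OF w] d2 d cs
        unfolding u0_def[symmetric] u1_def[symmetric] w0_def[symmetric] w1_def[symmetric]
        by (intro conjI det2_rank_one_update det2_rank_two_update
            u01[folded u0_def u1_def] w01[folded w0_def w1_def])
    qed
    then show "det (outer_mat u + K) = det K * (1 + c a1 a1)"
      "det (outer_mat w + K) = det K * (1 + c a2 a2)"
      "det (outer_mat u + outer_mat w + K) = det K * ((1 + c a1 a1) * (1 + c a2 a2) - (c a1 a2)\<^sup>2)"
      by auto
  qed
  show ?thesis
  proof (rule that[of "b a1" "b a2" "c a1 a1" "c a1 a2" "c a2 a2"])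
    show "rate_bound \<eta> D (outer_mat a1) (QP N s2 \<eta> B) = ln (1 + c a1 a1) / (2 * real \<eta>)"
      "rate_bound \<eta> D (outer_mat a2) (QP N s2 \<eta> B) = ln (1 + c a2 a2) / (2 * real \<eta>)"
      "rate_bound \<eta> D (outer_mat a1 + outer_mat a2) (QP N s2 \<eta> B)
        = ln ((1 + c a1 a1) * (1 + c a2 a2) - (c a1 a2)\<^sup>2) / (2 * real \<eta>)"
      using detK dets one[OF a1] one[OF a2] two
      by (simp_all add: rate_bound_def Q_def[symmetric] K_def[symmetric] u_def w_def)
  qed (use b ba bQb a1 a2 csym in \<open>auto simp: c_def Q_def\<close>)
qed

section \<open>Solving the feedback loop of one block\<close>

lemma strictly_lower_inverse:
  assumes "strictly_lower \<eta> B"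
  shows "inv_mat (1\<^sub>m \<eta> - B) \<in> carrier_mat \<eta> \<eta>" "inv_mat (1\<^sub>m \<eta> - B) * (1\<^sub>m \<eta> - B) = 1\<^sub>m \<eta>"
proof -
  have B: "B \<in> carrier_mat \<eta> \<eta>" and z: "\<And>i j. i < \<eta> \<Longrightarrow> j < \<eta> \<Longrightarrow> i \<le> j \<Longrightarrow> B $$ (i, j) = 0"
    using assms by (auto simp: strictly_lower_def)
  let ?A = "1\<^sub>m \<eta> - B"
  have A: "?A \<in> carrier_mat \<eta> \<eta>" by (rule minus_carrier_mat[OF B])
  have "det ?A = prod_list (diag_mat ?A)"
    using B z by (intro det_lower_triangular[OF _ A]) auto
  also have "diag_mat ?A = map (\<lambda>_. 1) [0..<\<eta>]" using B z by (auto simp: diag_mat_def)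
  also have "prod_list \<dots> = 1" by (simp add: map_replicate_const)
  finally have "det ?A \<noteq> 0" by simp
  then obtain G where G: "G \<in> carrier_mat \<eta> \<eta>" "?A * G = 1\<^sub>m \<eta>" "G * ?A = 1\<^sub>m \<eta>"
    by (rule mat_inverse_exists[OF A])
  have dr: "dim_row ?A = \<eta>" using B by simp
  \<comment> \<open>\<open>inv_mat\<close> is a choice, so it behaves as an inverse only once one is
    known to exist. Here I - B is lower triangular with unit diagonal and has determinant 1.\<close>
  have "inv_mat ?A \<in> carrier_mat \<eta> \<eta> \<and> inverts_mat ?A (inv_mat ?A) \<and> inverts_mat (inv_mat ?A) ?A"
    unfolding inv_mat_def dr by (rule someI[of _ G]) (use G B in \<open>auto simp: inverts_mat_def\<close>)
  then show "inv_mat ?A \<in> carrier_mat \<eta> \<eta>" "inv_mat ?A * ?A = 1\<^sub>m \<eta>"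
    by (auto simp: inverts_mat_def)
qed

text \<open>The hypothesis is (I - B) x = r. It is phrased with functions on indices so that the
  coding scheme can be developed without matrices.\<close>

lemma strictly_lower_solve:
  assumes B: "strictly_lower \<eta> B"
    and x: "\<And>i. i < \<eta> \<Longrightarrow> x i = r i + (\<Sum>j<\<eta>. B $$ (i, j) * x j)" and i: "i < \<eta>"
  shows "x i = (\<Sum>j<\<eta>. inv_mat (1\<^sub>m \<eta> - B) $$ (i, j) * r j)"
proof -
  let ?G = "inv_mat (1\<^sub>m \<eta> - B)"
  have Bc: "B \<in> carrier_mat \<eta> \<eta>" using B by (simp add: strictly_lower_def)
  note G = strictly_lower_inverse[OF B]
  have "vec \<eta> r = (1\<^sub>m \<eta> - B) *\<^sub>v vec \<eta> x"
  proof (rule eq_vecI)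
    fix j assume j: "j < dim_vec ((1\<^sub>m \<eta> - B) *\<^sub>v vec \<eta> x)"
    then have j: "j < \<eta>" using Bc by simp
    have "((1\<^sub>m \<eta> - B) *\<^sub>v vec \<eta> x) $ j = (\<Sum>l<\<eta>. ((if j = l then 1 else 0) - B $$ (j, l)) * x l)"
      using Bc j by (simp add: scalar_prod_def atLeast0LessThan)
    also have "\<dots> = (\<Sum>l<\<eta>. if j = l then x l else 0) - (\<Sum>l<\<eta>. B $$ (j, l) * x l)"
      by (simp add: left_diff_distrib sum_subtractf if_distrib[of "\<lambda>c. c * _"] cong: if_cong)
    also have "\<dots> = r j" using x[OF j] j by simp
    finally show "vec \<eta> r $ j = ((1\<^sub>m \<eta> - B) *\<^sub>v vec \<eta> x) $ j" using j by simp
  qed (use Bc in simp)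
  then have "?G *\<^sub>v vec \<eta> r = (?G * (1\<^sub>m \<eta> - B)) *\<^sub>v vec \<eta> x"
    using assoc_mult_mat_vec[OF G(1) minus_carrier_mat[OF Bc], of "vec \<eta> x"] by simp
  then have "?G *\<^sub>v vec \<eta> r = vec \<eta> x" using G by simp
  then have "vec \<eta> x $ i = (?G *\<^sub>v vec \<eta> r) $ i" by simp
  then show ?thesis using i G(1) by (simp add: scalar_prod_def atLeast0LessThan)
qed

section \<open>The feedback coding scheme\<close>

fun lcomb :: "real \<Rightarrow> coeffs \<Rightarrow> real \<Rightarrow> coeffs \<Rightarrow> coeffs" where
  "lcomb u (p, q, r, s) v (p', q', r', s') =
     (u * p + v * p', u * q + v * q', (\<lambda>j. u * r j + v * r' j), (\<lambda>j. u * s j + v * s' j))"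

lemma lform_lcomb: "lform \<eta> (lcomb u X v Y) k \<omega> = u * lform \<eta> X k \<omega> + v * lform \<eta> Y k \<omega>"
proof -
  obtain p q r s where X: "X = (p, q, r, s)" by (cases X)
  obtain p' q' r' s' where Y: "Y = (p', q', r', s')" by (cases Y)
  obtain x y z w where w: "\<omega> = ((x, y), (z, w))" by (metis surj_pair)
  show ?thesis unfolding X Y w
    by (simp add: distrib_left distrib_right sum.distrib sum_distrib_left mult.assoc)
qed

lemma lform_cov_commute: "lform_cov N s2 \<eta> X Y = lform_cov N s2 \<eta> Y X"
  by (cases X; cases Y) (simp add: mult.commute)

lemma lform_cov_lcomb:
  "lform_cov N s2 \<eta> Z (lcomb u X v Y) = u * lform_cov N s2 \<eta> Z X + v * lform_cov N s2 \<eta> Z Y"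
  by (cases X; cases Y; cases Z) (simp add: algebra_simps sum.distrib sum_distrib_left)

lemma lform_cov_nonneg: "0 \<le> N \<Longrightarrow> 0 \<le> s2 \<Longrightarrow> 0 \<le> lform_cov N s2 \<eta> X X"
  by (cases X) (simp add: sum_nonneg)

text \<open>\<open>X\<close> is the symbol under test and \<open>Y\<close> the residual noise of a
  filter whose signal gain equals its noise variance \<open>c\<close>.\<close>

definition block_score :: "nat \<Rightarrow> real \<Rightarrow> coeffs \<Rightarrow> coeffs \<Rightarrow> nat \<Rightarrow> (word \<times> word) \<times> noise \<Rightarrow> real" where
  "block_score \<eta> c X Y k \<omega> = score c (c * lform \<eta> X k \<omega> + lform \<eta> Y k \<omega>) (lform \<eta> X k \<omega>)"

text \<open>The quadratic part of the score has mean c - c / 2 - c (1 + c) / (2 (1 + c)) = 0. The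
  mean of the score is therefore ln (1 + c) / 2, the mutual information of one block.\<close>

lemma block_score_moment_bound:
  assumes N: "0 \<le> N" and s2: "0 \<le> s2"
    and XX: "lform_cov N s2 \<eta> X X = 1" and XY: "lform_cov N s2 \<eta> X Y = 0" and YY: "lform_cov N s2 \<eta> Y Y = c"
  shows "\<exists>V. moment_bound N s2 \<eta> (\<lambda>k \<omega>. block_score \<eta> c X Y k \<omega> - ln (1 + c) / 2) V"
proof -
  have c: "0 \<le> c" using lform_cov_nonneg[OF N s2] YY by metis
  \<comment> \<open>With b = c X + Y the quadratic part is X (c / 2 X + Y) + b (- b / (2 (1 + c))),
    two products of linear forms. The weight 0 in \<open>E'\<close> turns \<open>lcomb\<close> into
    a rescaling.\<close>
  define E where "E = lcomb (c / 2) X 1 Y"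
  define D' where "D' = lcomb c X 1 Y"
  define E' where "E' = lcomb (- 1 / (2 * (1 + c))) D' 0 X"
  have YX: "lform_cov N s2 \<eta> Y X = 0" using XY by (simp add: lform_cov_commute)
  have DD: "lform_cov N s2 \<eta> D' D' = c * (1 + c)"
    unfolding D'_def
    by (simp add: lform_cov_lcomb lform_cov_commute[of _ _ _ "lcomb _ _ _ _"] XX XY YX YY algebra_simps)
  have cov: "lform_cov N s2 \<eta> X E + lform_cov N s2 \<eta> D' E' = 0"
    unfolding E_def E'_def using c by (simp add: lform_cov_lcomb XX XY DD field_simps)
  have "lform \<eta> X k \<omega> * lform \<eta> E k \<omega> + lform \<eta> D' k \<omega> * lform \<eta> E' k \<omega>
        - (lform_cov N s2 \<eta> X E + lform_cov N s2 \<eta> D' E')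
     = block_score \<eta> c X Y k \<omega> - ln (1 + c) / 2" for k \<omega>
    unfolding cov unfolding E_def E'_def D'_def lform_lcomb score_def block_score_def
    by (simp add: algebra_simps power2_eq_square add_divide_distrib)
  then show ?thesis using block_two_products_moment_bound[OF N s2, of \<eta> X E D' E'] by simp
qed

text \<open>The numbers \<open>b k\<close> are arbitrary but fixed, as they are for a codeword drawn
  independently of the output; the factors are then independent with mean 1.\<close>

lemma nn_integral_exp_score_sum:
  assumes c: "0 \<le> c"
  shows "(\<integral>\<^sup>+x. ennreal (exp (\<Sum>k<l. score c (b k) (x k))) \<partial>word_space l) = 1"
proof -
  interpret product_prob_space "\<lambda>_. gauss 1" "{..<l}"
    by (intro product_prob_spaceI prob_space_gauss) simp
  have "(\<integral>\<^sup>+x. ennreal (exp (\<Sum>k<l. score c (b k) (x k))) \<partial>word_space l)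
      = (\<integral>\<^sup>+x. (\<Prod>k<l. ennreal (exp (score c (b k) (x k)))) \<partial>word_space l)"
    by (simp add: exp_sum prod_ennreal)
  also have "\<dots> = (\<Prod>k<l. \<integral>\<^sup>+x. ennreal (exp (score c (b k) x)) \<partial>gauss 1)"
    unfolding word_space_def by (rule product_nn_integral_prod, simp, subst measurable_cong_sets[OF sets_gauss refl], measurable)
  also have "\<dots> = 1" by (simp add: nn_integral_exp_score[OF c])
  finally show ?thesis .
qed

text \<open>The noise has mean zero, so \<open>u\<close>, which will be the share of the codewords,
  contributes its square and no cross term. Both noises carry the same coefficient because
  transmitter 2 sees only their sum.\<close>

lemma nn_integral_noise_affine_square:
  fixes f :: "nat \<Rightarrow> nat"
  assumes N: "0 \<le> N" and s2: "0 \<le> s2" and f: "\<And>j. j < \<eta> \<Longrightarrow> f j < n" and inj: "inj_on f {..<\<eta>}"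
  shows "(\<integral>\<^sup>+\<omega>. ennreal ((u + (\<Sum>j<\<eta>. h j * (fst \<omega> (f j) + snd \<omega> (f j))))\<^sup>2) \<partial>noise_space n N s2)
    = ennreal (u\<^sup>2 + (N + s2) * (\<Sum>j<\<eta>. (h j)\<^sup>2))"
proof -
  define v :: "nat + nat \<Rightarrow> real" where "v = case_sum (\<lambda>_. N) (\<lambda>_. s2)"
  define I where "I = {..<n} <+> {..<n}"
  define P where "P = PiM I (\<lambda>i. gauss (v i))"
  define J where "J = {..<\<eta>} <+> {..<\<eta>}"
  \<comment> \<open>A single block, indexed by the unit type, makes the block lemmas
    applicable.\<close>
  define \<phi> where "\<phi> = (\<lambda>_::unit. map_sum f f)"
  define d :: "nat + nat \<Rightarrow> real" where "d = case_sum h h"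
  have finJ: "finite J" by (simp add: J_def)
  have v: "0 \<le> v i" for i using N s2 by (auto simp: v_def split: sum.split)
  interpret P: prob_space P unfolding P_def by (intro prob_space_PiM prob_space_gauss v)
  have jm: "sum_join {..<n} {..<n} \<in> noise_space n N s2 \<rightarrow>\<^sub>M P"
    and jd: "distr (noise_space n N s2) P (sum_join {..<n} {..<n}) = P"
    using sum_join_measurable[of "{..<n}" "{..<n}" "\<lambda>_. N" "\<lambda>_. s2"] distr_sum_join[of "{..<n}" "{..<n}" "\<lambda>_. N" "\<lambda>_. s2"] N s2
    by (auto simp: noise_space_def P_def I_def v_def)
  define L where "L \<omega> = (\<Sum>j\<in>J. d j * \<omega> (\<phi> () j))" for \<omega> :: "nat + nat \<Rightarrow> real"
  have phi: "\<phi> k j \<in> I \<and> v (\<phi> k j) = v j" if "k \<in> {()}" "j \<in> J" for k j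
    using that by (auto simp: \<phi>_def I_def J_def v_def Plus_def f)
  have injphi: "inj_on (\<phi> k) J" for k
    using inj by (auto simp: inj_on_def \<phi>_def J_def Plus_def)
  note LF = gauss_PiM_linear_form_covariance[where I = I and v = v and J = J and K = "{()}" and \<phi> = \<phi> and u = v,
      OF v finJ _ phi injphi _ _, of "()" d d,
      simplified, folded P_def L_def]
  have i2: "integrable P (\<lambda>\<omega>. (L \<omega>)\<^sup>2)" and e2: "(\<integral>\<omega>. (L \<omega>)\<^sup>2 \<partial>P) = (\<Sum>j\<in>J. d j * d j * v j)"
    using LF by (auto simp: power2_eq_square disjoint_family_on_def)
  have mc: "(\<lambda>\<omega>. \<omega> (\<phi> () j)) \<in> borel_measurable P" if "j \<in> J" for j
    unfolding P_def using phi[of "()" j] that by (intro component_measurable_gauss_PiM) (auto simp: v)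
  have mL [measurable]: "L \<in> borel_measurable P"
    unfolding L_def by (intro borel_measurable_sum borel_measurable_times mc) auto
  have i1: "integrable P L" by (rule P.integrable_of_square[OF mL i2])
  have e1: "(\<integral>\<omega>. L \<omega> \<partial>P) = 0"
  proof -
    have c: "integrable P (\<lambda>\<omega>. \<omega> (\<phi> () j)) \<and> (\<integral>\<omega>. \<omega> (\<phi> () j) \<partial>P) = 0" if "j \<in> J" for j
      using gauss_PiM_component[where I = I and v = v and i = "\<phi> () j" and g = "\<lambda>x. x", folded P_def] v phi[of "()" j] that
        integrable_gauss_power[of "v j" 1] integral_gauss_id[of "v j"] by simp
    have "(\<integral>\<omega>. L \<omega> \<partial>P) = (\<Sum>j\<in>J. d j * (\<integral>\<omega>. \<omega> (\<phi> () j) \<partial>P))"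
      unfolding L_def using c by (subst Bochner_Integration.integral_sum) auto
    also have "\<dots> = 0" using c by simp
    finally show ?thesis .
  qed
  have sq: "(u + L \<omega>)\<^sup>2 = u\<^sup>2 + (2 * u * L \<omega> + (L \<omega>)\<^sup>2)" for \<omega> by (simp add: power2_sum)
  have iu: "integrable P (\<lambda>\<omega>. (u + L \<omega>)\<^sup>2)" unfolding sq using i1 i2 by simp
  have eu: "(\<integral>\<omega>. (u + L \<omega>)\<^sup>2 \<partial>P) = u\<^sup>2 + (N + s2) * (\<Sum>j<\<eta>. (h j)\<^sup>2)"
  proof -
    have "(\<Sum>j\<in>J. d j * d j * v j) = (\<Sum>j<\<eta>. (h j)\<^sup>2) * N + (\<Sum>j<\<eta>. (h j)\<^sup>2) * s2"
      by (simp add: J_def d_def v_def sum.Plus sum_distrib_right power2_eq_square)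
    then show ?thesis
      unfolding sq using i1 i2 e1 e2 by (simp add: P.prob_space algebra_simps)
  qed
  have Lj: "L (sum_join {..<n} {..<n} \<omega>) = (\<Sum>j<\<eta>. h j * (fst \<omega> (f j) + snd \<omega> (f j)))" for \<omega>
    unfolding L_def by (simp add: J_def d_def \<phi>_def sum_join_def sum.Plus f InlI InrI distrib_left sum.distrib)
  have "(\<integral>\<^sup>+\<omega>. ennreal ((u + (\<Sum>j<\<eta>. h j * (fst \<omega> (f j) + snd \<omega> (f j))))\<^sup>2) \<partial>noise_space n N s2)
      = (\<integral>\<^sup>+\<omega>. ennreal ((u + L (sum_join {..<n} {..<n} \<omega>))\<^sup>2) \<partial>noise_space n N s2)"
    by (simp add: Lj)
  also have "\<dots> = (\<integral>\<^sup>+\<omega>. ennreal ((u + L \<omega>)\<^sup>2) \<partial>distr (noise_space n N s2) P (sum_join {..<n} {..<n}))"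
    using jm by (subst nn_integral_distr) auto
  also have "\<dots> = ennreal (\<integral>\<omega>. (u + L \<omega>)\<^sup>2 \<partial>P)"
    unfolding jd by (rule nn_integral_eq_integral[OF iu]) simp
  finally show ?thesis unfolding eu .
qed

section \<open>Encoders and the closed form of the feedback input\<close>

lemma vlist_eq:
  "vlist c m1 m2 z w t = map (\<lambda>s. enc1 c s m1 + x2 c m1 m2 z w s + z s + w s) [0..<t]"
  by (induction t) (simp_all add: x2_def Let_def)

text \<open>Coefficients are functions on indices instead of matrices. \<open>lower\<close> is the
  strict causality of the feedback, and \<open>solve\<close> describes \<open>G\<close> as the
  inverse of I - B.\<close>

locale fb_scheme =
  fixes N s2 :: real and \<eta> :: nat and a1 a2 :: "nat \<Rightarrow> real" and B G :: "nat \<Rightarrow> nat \<Rightarrow> real"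
  assumes eta: "0 < \<eta>" and N: "0 \<le> N" and s2: "0 \<le> s2"
    and lower: "\<And>i j. i \<le> j \<Longrightarrow> j < \<eta> \<Longrightarrow> B i j = 0"
    and solve: "\<And>x r i. (\<And>i. i < \<eta> \<Longrightarrow> x i = r i + (\<Sum>j<\<eta>. B i j * x j)) \<Longrightarrow> i < \<eta> \<Longrightarrow> x i = (\<Sum>j<\<eta>. G i j * r j)"
begin

text \<open>The transfer coefficients to the input of transmitter 2 from its own symbol, from the
  other symbol and from each noise sample: the entries of G a2, G B a1 and G B.\<close>

definition gain2 :: "nat \<Rightarrow> real" where "gain2 i = (\<Sum>j<\<eta>. G i j * a2 j)"
definition gain1 :: "nat \<Rightarrow> real" where "gain1 i = (\<Sum>j<\<eta>. G i j * (\<Sum>l<\<eta>. B j l * a1 l))"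
definition gainz :: "nat \<Rightarrow> nat \<Rightarrow> real" where "gainz i l = (\<Sum>j<\<eta>. G i j * B j l)"

text \<open>Channel uses after the last complete block stay silent.\<close>

definition sent1 :: "nat \<Rightarrow> word \<Rightarrow> nat \<Rightarrow> real" where
  "sent1 l x t = (if t < l * \<eta> then a1 (t mod \<eta>) * x (t div \<eta>) else 0)"

text \<open>What transmitter 2 sends once the feedback loop is solved. The sum runs over the whole
  block; causality is enforced by the encoder in \<open>fb_code\<close>.\<close>

definition sent2 :: "nat \<Rightarrow> (word \<times> word) \<times> noise \<Rightarrow> nat \<Rightarrow> real" where
  "sent2 l \<omega> t = (if t < l * \<eta> then
     snd (fst \<omega>) (t div \<eta>) * gain2 (t mod \<eta>) + fst (fst \<omega>) (t div \<eta>) * gain1 (t mod \<eta>)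
     + (\<Sum>j<\<eta>. gainz (t mod \<eta>) j * (fst (snd \<omega>) (t div \<eta> * \<eta> + j) + snd (snd \<omega>) (t div \<eta> * \<eta> + j))) else 0)"

definition received :: "nat \<Rightarrow> nat \<Rightarrow> (word \<times> word) \<times> noise \<Rightarrow> nat \<Rightarrow> real" where
  "received l n \<omega> = (\<lambda>t\<in>{..<n}. sent1 l (fst (fst \<omega>)) t + sent2 l \<omega> t + fst (snd \<omega>) t)"

text \<open>The feedback sum stops before \<open>t mod \<eta>\<close>: only feedback from earlier in
  the current block is used, so the blocks do not interact.\<close>

definition fb_code :: "nat \<Rightarrow> nat \<Rightarrow> nat \<Rightarrow> (nat \<Rightarrow> word) \<Rightarrow> (nat \<Rightarrow> word) \<Rightarrow> ((nat \<Rightarrow> real) \<Rightarrow> nat \<times> nat) \<Rightarrow> code" where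
  "fb_code l M1 M2 c1 c2 D = \<lparr>msz1 = M1, msz2 = M2, enc1 = (\<lambda>t m. sent1 l (c1 m) t),
     enc2 = (\<lambda>t m vs. if t < l * \<eta> then a2 (t mod \<eta>) * c2 m (t div \<eta>)
       + (\<Sum>j<t mod \<eta>. B (t mod \<eta>) j * vs ! (t div \<eta> * \<eta> + j)) else 0), dec = D\<rparr>"

lemma fb_code_simps [simp]:
  "msz1 (fb_code l M1 M2 c1 c2 D) = M1" "msz2 (fb_code l M1 M2 c1 c2 D) = M2"
  "enc1 (fb_code l M1 M2 c1 c2 D) t m = sent1 l (c1 m) t" "dec (fb_code l M1 M2 c1 c2 D) = D"
  by (simp_all add: fb_code_def)

lemma block_index_less: "k < l \<Longrightarrow> i < \<eta> \<Longrightarrow> k * \<eta> + i < l * \<eta>"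
proof -
  assume "k < l" "i < \<eta>"
  then have "k * \<eta> + i < (k + 1) * \<eta>" by simp
  also have "\<dots> \<le> l * \<eta>" using \<open>k < l\<close> by (intro mult_right_mono) auto
  finally show ?thesis .
qed

lemma block_index_divmod [simp]: "i < \<eta> \<Longrightarrow> (k * \<eta> + i) div \<eta> = k" "i < \<eta> \<Longrightarrow> (k * \<eta> + i) mod \<eta> = i"
  by auto

text \<open>Strict triangularity lets the causal sum over earlier positions be extended to the whole
  block, which yields a linear system.\<close>

lemma x2_fb_code_recursion:
  fixes l M1 M2 m1 m2 k i :: nat and c1 c2 D z w
  assumes k: "k < l" and i: "i < \<eta>"
  defines "x \<equiv> x2 (fb_code l M1 M2 c1 c2 D) m1 m2 z w"
  shows "x (k * \<eta> + i) = a2 i * c2 m2 k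
    + (\<Sum>j<\<eta>. B i j * (a1 j * c1 m1 k + x (k * \<eta> + j) + z (k * \<eta> + j) + w (k * \<eta> + j)))"
proof -
  have lt: "k * \<eta> + i < l * \<eta>" using k i by (rule block_index_less)
  have "x (k * \<eta> + i) = a2 i * c2 m2 k
      + (\<Sum>j<i. B i j * vlist (fb_code l M1 M2 c1 c2 D) m1 m2 z w (k * \<eta> + i) ! (k * \<eta> + j))"
    using i lt by (simp add: x_def x2_def fb_code_def)
  also have "(\<Sum>j<i. B i j * vlist (fb_code l M1 M2 c1 c2 D) m1 m2 z w (k * \<eta> + i) ! (k * \<eta> + j))
      = (\<Sum>j<i. B i j * (a1 j * c1 m1 k + x (k * \<eta> + j) + z (k * \<eta> + j) + w (k * \<eta> + j)))"
    using i k by (intro sum.cong refl) (auto simp: vlist_eq x_def sent1_def block_index_less)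
  also have "\<dots> = (\<Sum>j<\<eta>. B i j * (a1 j * c1 m1 k + x (k * \<eta> + j) + z (k * \<eta> + j) + w (k * \<eta> + j)))"
    using i by (intro sum.mono_neutral_left) (auto simp: lower)
  finally show ?thesis .
qed

text \<open>Inside a block the recursion reads x = r + B x with \<open>r\<close> free of x, so
  \<open>solve\<close> applies.\<close>

lemma x2_fb_code: "x2 (fb_code l M1 M2 c1 c2 D) m1 m2 z w t = sent2 l ((c1 m1, c2 m2), (z, w)) t"
proof (cases "t < l * \<eta>")
  case False
  then show ?thesis by (simp add: x2_def fb_code_def sent2_def)
next
  case True
  define k i where "k = t div \<eta>" and "i = t mod \<eta>"
  have t: "t = k * \<eta> + i" and i: "i < \<eta>" using eta by (simp_all add: k_def i_def)
  have k: "k < l" using True eta by (simp add: k_def less_mult_imp_div_less)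
  define x where "x = x2 (fb_code l M1 M2 c1 c2 D) m1 m2 z w"
  define r where "r i = a2 i * c2 m2 k + (\<Sum>j<\<eta>. B i j * (a1 j * c1 m1 k + z (k * \<eta> + j) + w (k * \<eta> + j)))" for i
  have "x (k * \<eta> + i) = r i + (\<Sum>j<\<eta>. B i j * x (k * \<eta> + j))" if "i < \<eta>" for i
    unfolding r_def x_def x2_fb_code_recursion[OF k that, of M1 M2 c1 c2 D m1 m2 z w]
    by (simp add: distrib_left sum.distrib)
  then have "x (k * \<eta> + i) = (\<Sum>j<\<eta>. G i j * r j)"
    by (rule solve[of "\<lambda>i. x (k * \<eta> + i)", OF _ i])
  also have "\<dots> = c2 m2 k * gain2 i + c1 m1 k * gain1 i + (\<Sum>j<\<eta>. \<Sum>l<\<eta>. G i j * B j l * (z (k * \<eta> + l) + w (k * \<eta> + l)))"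
    unfolding r_def gain1_def gain2_def
    by (simp add: distrib_left sum.distrib sum_distrib_left mult_ac)
  also have "(\<Sum>j<\<eta>. \<Sum>l<\<eta>. G i j * B j l * (z (k * \<eta> + l) + w (k * \<eta> + l)))
      = (\<Sum>l<\<eta>. gainz i l * (z (k * \<eta> + l) + w (k * \<eta> + l)))"
    unfolding gainz_def by (subst sum.swap) (simp add: sum_distrib_right)
  finally show ?thesis using True by (simp add: sent2_def x_def t[symmetric] k_def i_def)
qed

lemma sent2_recursion:
  assumes k: "k < l" and i: "i < \<eta>"
  shows "sent2 l ((x, y), (z, w)) (k * \<eta> + i) = a2 i * y k
    + (\<Sum>j<\<eta>. B i j * (a1 j * x k + sent2 l ((x, y), (z, w)) (k * \<eta> + j) + z (k * \<eta> + j) + w (k * \<eta> + j)))"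
  \<comment> \<open>A code with constant codebooks and an arbitrary decoder transfers the recursion
    of the encoder to \<open>sent2\<close>.\<close>
  using x2_fb_code_recursion[OF k i, of 1 1 "\<lambda>_. x" "\<lambda>_. y" "\<lambda>_. (0,0)" 0 0 z w]
  by (simp add: x2_fb_code)

definition stat :: "(nat \<Rightarrow> real) \<Rightarrow> (nat \<Rightarrow> real) \<Rightarrow> nat \<Rightarrow> real" where
  "stat \<beta> y k = (\<Sum>j<\<eta>. \<beta> j * (y (k * \<eta> + j) - (\<Sum>i<\<eta>. B j i * y (k * \<eta> + i))))"

text \<open>Subtracting \<open>B\<close> times the output cancels the feedback: the filtered output depends on the
  noise only through \<open>z + B w\<close>.\<close>

lemma stat_received:
  assumes k: "k < l" and n: "l * \<eta> \<le> n"
  shows "stat \<beta> (received l n \<omega>) k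
    = lform \<eta> (\<Sum>j<\<eta>. \<beta> j * a1 j, \<Sum>j<\<eta>. \<beta> j * a2 j, \<beta>, \<lambda>i. \<Sum>j<\<eta>. \<beta> j * B j i) k \<omega>"
proof -
  obtain x y z w where w: "\<omega> = ((x, y), (z, w))" by (metis surj_pair)
  define s where "s = (\<lambda>j. sent2 l \<omega> (k * \<eta> + j))"
  have lt: "k * \<eta> + j < n" if "j < \<eta>" for j using block_index_less[OF k that] n by simp
  have rec: "received l n \<omega> (k * \<eta> + j) = a1 j * x k + s j + z (k * \<eta> + j)" if "j < \<eta>" for j
    using that lt[OF that] block_index_less[OF k that] by (simp add: received_def sent1_def w s_def)
  have sj: "s j = a2 j * y k + (\<Sum>i<\<eta>. B j i * (a1 i * x k + s i + z (k * \<eta> + i) + w (k * \<eta> + i)))" if "j < \<eta>" for j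
    unfolding s_def w by (rule sent2_recursion[OF k that])
  have "received l n \<omega> (k * \<eta> + j) - (\<Sum>i<\<eta>. B j i * received l n \<omega> (k * \<eta> + i))
      = a1 j * x k + a2 j * y k + z (k * \<eta> + j) + (\<Sum>i<\<eta>. B j i * w (k * \<eta> + i))" if j: "j < \<eta>" for j
  proof -
    have "(\<Sum>i<\<eta>. B j i * received l n \<omega> (k * \<eta> + i)) = (\<Sum>i<\<eta>. B j i * (a1 i * x k + s i + z (k * \<eta> + i)))"
      by (intro sum.cong refl) (simp add: rec)
    then show ?thesis
      unfolding rec[OF j] by (subst sj[OF j]) (simp add: distrib_left sum.distrib)
  qed
  then have "stat \<beta> (received l n \<omega>) k = (\<Sum>j<\<eta>. \<beta> j * (a1 j * x k + a2 j * y k + z (k * \<eta> + j) + (\<Sum>i<\<eta>. B j i * w (k * \<eta> + i))))"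
    unfolding stat_def by (intro sum.cong refl) simp
  also have "\<dots> = (\<Sum>j<\<eta>. \<beta> j * a1 j) * x k + (\<Sum>j<\<eta>. \<beta> j * a2 j) * y k + (\<Sum>j<\<eta>. \<beta> j * z (k * \<eta> + j))
      + (\<Sum>j<\<eta>. \<Sum>i<\<eta>. \<beta> j * B j i * w (k * \<eta> + i))"
    by (simp add: distrib_left sum.distrib sum_distrib_left sum_distrib_right mult_ac)
  also have "(\<Sum>j<\<eta>. \<Sum>i<\<eta>. \<beta> j * B j i * w (k * \<eta> + i)) = (\<Sum>i<\<eta>. (\<Sum>j<\<eta>. \<beta> j * B j i) * w (k * \<eta> + i))"
    by (subst sum.swap) (simp add: sum_distrib_right)
  finally show ?thesis by (simp add: w)
qed

section \<open>Measurability of inputs and outputs\<close>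

lemma word_space_component_measurable [measurable]:
  "i < l \<Longrightarrow> (\<lambda>x. x i) \<in> borel_measurable (word_space l)"
  unfolding word_space_def
  by (subst measurable_cong_sets[OF refl sets_gauss[symmetric, of 1]]) simp

lemma noise_space_component_measurable [measurable]:
  "i < n \<Longrightarrow> (\<lambda>\<omega>. fst \<omega> i) \<in> borel_measurable (noise_space n N s2)"
  "i < n \<Longrightarrow> (\<lambda>\<omega>. snd \<omega> i) \<in> borel_measurable (noise_space n N s2)"
proof -
  have "(\<lambda>x. x i) \<in> borel_measurable (PiM {..<n} (\<lambda>_. gauss v))" if "i < n" for v
    using that by (subst measurable_cong_sets[OF refl sets_gauss[symmetric, of v]]) simp
  then show "i < n \<Longrightarrow> (\<lambda>\<omega>. fst \<omega> i) \<in> borel_measurable (noise_space n N s2)"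
    "i < n \<Longrightarrow> (\<lambda>\<omega>. snd \<omega> i) \<in> borel_measurable (noise_space n N s2)"
    unfolding noise_space_def by (auto intro: measurable_compose[OF measurable_fst] measurable_compose[OF measurable_snd])
qed

lemma sent2_measurable [measurable]:
  assumes n: "l * \<eta> \<le> n"
  shows "(\<lambda>\<omega>. sent2 l \<omega> t) \<in> borel_measurable (joint_space N s2 l n)"
proof (cases "t < l * \<eta>")
  case True
  have k: "t div \<eta> < l" using True eta by (simp add: less_mult_imp_div_less)
  have lt: "t div \<eta> * \<eta> + j < n" if "j < \<eta>" for j using block_index_less[OF k that] n by simp
  show ?thesis
    unfolding sent2_def joint_space_def using True k lt by measurable
qed (simp add: sent2_def)

lemma received_measurable [measurable]:
  assumes n: "l * \<eta> \<le> n"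
  shows "received l n \<in> joint_space N s2 l n \<rightarrow>\<^sub>M PiM {..<n} (\<lambda>_. borel)"
proof -
  have "(\<lambda>\<omega>. sent1 l (fst (fst \<omega>)) t + sent2 l \<omega> t + fst (snd \<omega>) t) \<in> borel_measurable (joint_space N s2 l n)"
    if "t < n" for t
  proof -
    have "(\<lambda>\<omega>. sent1 l (fst (fst \<omega>)) t) \<in> borel_measurable (joint_space N s2 l n)"
    proof (cases "t < l * \<eta>")
      case True
      then have "t div \<eta> < l" using eta by (simp add: less_mult_imp_div_less)
      then show ?thesis unfolding sent1_def joint_space_def by measurable
    qed (simp add: sent1_def)
    moreover have "(\<lambda>\<omega>. fst (snd \<omega>) t) \<in> borel_measurable (joint_space N s2 l n)"
      unfolding joint_space_def using that by measurable
    ultimately show ?thesis using n by measurable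
  qed
  then show ?thesis
    unfolding received_def by (intro measurable_restrict) auto
qed

end

text \<open>Cauchy-Schwarz turns an average of squares bounded by K^2 into an average bounded by K.
  The \<open>S i\<close> will be energy deviations of codeword pairs.\<close>

lemma sum_le_of_penalty:
  fixes S p :: "'i \<Rightarrow> real"
  assumes K: "0 < K" and p: "\<And>i. i \<in> I \<Longrightarrow> 1 / K\<^sup>2 * (S i)\<^sup>2 \<le> p i" and le: "(\<Sum>i\<in>I. p i) \<le> real (card I)"
  shows "(\<Sum>i\<in>I. S i) \<le> real (card I) * K"
proof -
  have "(\<Sum>i\<in>I. S i)\<^sup>2 \<le> (\<Sum>i\<in>I. (S i)\<^sup>2) * real (card I)" by (rule sum_squared_le_sum_of_squares)
  also have "(\<Sum>i\<in>I. (S i)\<^sup>2) = K\<^sup>2 * (\<Sum>i\<in>I. 1 / K\<^sup>2 * (S i)\<^sup>2)" using K by (simp add: sum_distrib_left)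
  also have "\<dots> * real (card I) \<le> (K\<^sup>2 * real (card I)) * real (card I)"
    using order_trans[OF sum_mono[OF p] le] by (intro mult_right_mono mult_left_mono) auto
  also have "\<dots> = (real (card I) * K)\<^sup>2" by (simp add: power2_eq_square)
  finally show ?thesis using K by (intro power2_le_imp_le[of "sum S I" "real (card I) * K"]) auto
qed

text \<open>\<open>b1\<close> and \<open>b2\<close> are the matched filters,
  \<open>\<epsilon>\<close> is the decoding margin per block and \<open>\<theta>\<close> the
  relative power margin. The factor 1 + \<theta> multiplies only the codeword share of the power,
  since the noise share is the same for every codebook.\<close>

locale fb_coding = fb_scheme +
  fixes b1 b2 :: "nat \<Rightarrow> real" and c11 c12 c22 \<epsilon> \<theta> P1 P2 :: real
  assumes gain: "(\<Sum>j<\<eta>. b1 j * a1 j) = c11" "(\<Sum>j<\<eta>. b1 j * a2 j) = c12"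
      "(\<Sum>j<\<eta>. b2 j * a1 j) = c12" "(\<Sum>j<\<eta>. b2 j * a2 j) = c22"
    and cov: "N * (\<Sum>j<\<eta>. b1 j * b1 j) + s2 * (\<Sum>i<\<eta>. (\<Sum>j<\<eta>. b1 j * B j i) * (\<Sum>j<\<eta>. b1 j * B j i)) = c11"
      "N * (\<Sum>j<\<eta>. b1 j * b2 j) + s2 * (\<Sum>i<\<eta>. (\<Sum>j<\<eta>. b1 j * B j i) * (\<Sum>j<\<eta>. b2 j * B j i)) = c12"
      "N * (\<Sum>j<\<eta>. b2 j * b2 j) + s2 * (\<Sum>i<\<eta>. (\<Sum>j<\<eta>. b2 j * B j i) * (\<Sum>j<\<eta>. b2 j * B j i)) = c22"
    and eps: "0 < \<epsilon>" and theta: "0 < \<theta>"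
    and power1: "(1 + \<theta>) * (\<Sum>i<\<eta>. (a1 i)\<^sup>2) \<le> real \<eta> * P1"
    and power2: "(1 + \<theta>) * ((\<Sum>i<\<eta>. (gain2 i)\<^sup>2) + (\<Sum>i<\<eta>. (gain1 i)\<^sup>2))
      + (N + s2) * (\<Sum>i<\<eta>. \<Sum>j<\<eta>. (gainz i j)\<^sup>2) \<le> real \<eta> * P2"
    and P1: "0 \<le> P1" and P2: "0 \<le> P2"
begin

text \<open>When the first word counts as noise, the Sherman-Morrison formula replaces the filter
  \<open>b2\<close> by b2 - \<kappa> b1. Its gain \<open>c22'\<close> is a Schur complement: (1 +
  c11) (1 + c22') = (1 + c11) (1 + c22) - c12^2, the argument of the logarithm in the sum
  rate.\<close>

definition \<kappa> :: real where "\<kappa> = c12 / (1 + c11)"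
definition c22' :: real where "c22' = c22 - \<kappa> * c12"
definition I1 :: real where "I1 = ln (1 + c11) / 2"
definition I2 :: real where "I2 = ln (1 + c22) / 2"
definition I3 :: real where "I3 = ln (1 + c22') / 2"

abbreviation "zero_coeffs \<equiv> (\<lambda>_::nat. 0::real)"
definition cX1 :: coeffs where "cX1 = (1, 0, zero_coeffs, zero_coeffs)"
definition cX2 :: coeffs where "cX2 = (0, 1, zero_coeffs, zero_coeffs)"
definition cY1 :: coeffs where "cY1 = (0, 0, b1, \<lambda>i. \<Sum>j<\<eta>. b1 j * B j i)"
definition cY2 :: coeffs where "cY2 = (0, 0, b2, \<lambda>i. \<Sum>j<\<eta>. b2 j * B j i)"
text \<open>The residual noise of the filter b2 - \<kappa> b1; its last term is the interference of
  the first word that the subtraction leaves.\<close>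

definition cY3 :: coeffs where "cY3 = lcomb 1 (lcomb 1 cY2 (- \<kappa>) cY1) \<kappa> cX1"

abbreviation "lcov \<equiv> lform_cov N s2 \<eta>"

lemma lcov_basic:
  "lcov cX1 cX1 = 1" "lcov cX2 cX2 = 1" "lcov cX1 cX2 = 0" "lcov cX2 cX1 = 0"
  "lcov cX1 cY1 = 0" "lcov cX1 cY2 = 0" "lcov cX2 cY1 = 0" "lcov cX2 cY2 = 0"
  "lcov cY1 cX1 = 0" "lcov cY2 cX1 = 0" "lcov cY1 cX2 = 0" "lcov cY2 cX2 = 0"
  "lcov cY1 cY1 = c11" "lcov cY1 cY2 = c12" "lcov cY2 cY1 = c12" "lcov cY2 cY2 = c22"
  using cov by (simp_all add: cX1_def cX2_def cY1_def cY2_def mult.commute)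

lemma c_nonneg: "0 \<le> c11" "0 \<le> c22"
  using lform_cov_nonneg[OF N s2, of \<eta> cY1] lform_cov_nonneg[OF N s2, of \<eta> cY2] by (simp_all add: lcov_basic)

lemma kappa_mult: "\<kappa> * (1 + c11) = c12"
  using c_nonneg by (simp add: \<kappa>_def)

text \<open>The relation \<kappa> (1 + c11) = c12 collapses the variance of the residual to the gain
  \<open>c22'\<close>, so the same scalar score also serves when the first word is unknown.\<close>

lemma lcov_cY3: "lcov cX2 cY3 = 0" "lcov cY3 cY3 = c22'"
proof -
  show "lcov cX2 cY3 = 0" unfolding cY3_def by (simp add: lform_cov_lcomb lcov_basic)
  have "lcov cY3 cY3 = c22 - 2 * \<kappa> * c12 + \<kappa> * (\<kappa> * (1 + c11))"
    unfolding cY3_def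
    by (simp add: lform_cov_lcomb lform_cov_commute[of _ _ _ "lcomb _ _ _ _"] lcov_basic algebra_simps)
  then show "lcov cY3 cY3 = c22'" unfolding kappa_mult by (simp add: c22'_def)
qed

lemma c22'_nonneg: "0 \<le> c22'"
  using lform_cov_nonneg[OF N s2, of \<eta> cY3] by (simp add: lcov_cY3)

lemma lform_cX: "lform \<eta> cX1 k \<omega> = fst (fst \<omega>) k" "lform \<eta> cX2 k \<omega> = snd (fst \<omega>) k"
proof -
  obtain x y z w where w: "\<omega> = ((x, y), (z, w))" by (metis surj_pair)
  show "lform \<eta> cX1 k \<omega> = fst (fst \<omega>) k" "lform \<eta> cX2 k \<omega> = snd (fst \<omega>) k"
    by (simp_all add: w cX1_def cX2_def)
qed

lemma lform_split: "lform \<eta> (p, q, r, s) k \<omega> = p * lform \<eta> cX1 k \<omega> + q * lform \<eta> cX2 k \<omega> + lform \<eta> (0, 0, r, s) k \<omega>"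
proof -
  obtain x y z w where w: "\<omega> = ((x, y), (z, w))" by (metis surj_pair)
  show ?thesis by (simp add: w cX1_def cX2_def)
qed

text \<open>The test of the first word takes the second as given and subtracts its contribution to
  the filter output; \<open>S2\<close> exchanges the roles.\<close>

definition S1 :: "nat \<Rightarrow> (word \<times> word) \<times> (nat \<Rightarrow> real) \<Rightarrow> real" where
  "S1 l q = (\<Sum>k<l. score c11 (stat b1 (snd q) k - c12 * snd (fst q) k) (fst (fst q) k))"
definition S2 :: "nat \<Rightarrow> (word \<times> word) \<times> (nat \<Rightarrow> real) \<Rightarrow> real" where
  "S2 l q = (\<Sum>k<l. score c22 (stat b2 (snd q) k - c12 * fst (fst q) k) (snd (fst q) k))"
text \<open>By the chain rule \<open>S1 + S3\<close> is the ratio for the pair: \<open>S3\<close> decodes the second word while the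
  first one acts as noise.\<close>

definition S3 :: "nat \<Rightarrow> (word \<times> word) \<times> (nat \<Rightarrow> real) \<Rightarrow> real" where
  "S3 l q = (\<Sum>k<l. score c22' (stat b2 (snd q) k - \<kappa> * stat b1 (snd q) k) (snd (fst q) k))"

definition out_space :: "nat \<Rightarrow> (nat \<Rightarrow> real) measure" where
  "out_space n = PiM {..<n} (\<lambda>_. borel)"

text \<open>Each threshold lies \<open>\<epsilon>\<close> per block below the mean of its ratio
  under the true pair.\<close>

definition accept :: "nat \<Rightarrow> nat \<Rightarrow> ((word \<times> word) \<times> (nat \<Rightarrow> real)) set" where
  "accept l n = {q \<in> space ((word_space l \<Otimes>\<^sub>M word_space l) \<Otimes>\<^sub>M out_space n).
     real l * (I1 - \<epsilon>) \<le> S1 l q \<and> real l * (I2 - \<epsilon>) \<le> S2 l q \<and> real l * (I1 + I3 - \<epsilon>) \<le> S1 l q + S3 l q}"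

lemma stat_measurable [measurable]:
  assumes "k < l" "l * \<eta> \<le> n"
  shows "(\<lambda>y. stat b y k) \<in> borel_measurable (out_space n)"
proof -
  have "k * \<eta> + j < n" if "j < \<eta>" for j using block_index_less[OF assms(1) that] assms(2) by simp
  then have [measurable]: "(\<lambda>y. y (k * \<eta> + j)) \<in> borel_measurable (out_space n)" if "j < \<eta>" for j
    unfolding out_space_def using that by simp
  show ?thesis unfolding stat_def by measurable
qed

lemma S_measurable [measurable]:
  assumes n: "l * \<eta> \<le> n"
  shows "S1 l \<in> borel_measurable ((word_space l \<Otimes>\<^sub>M word_space l) \<Otimes>\<^sub>M out_space n)"
    and "S2 l \<in> borel_measurable ((word_space l \<Otimes>\<^sub>M word_space l) \<Otimes>\<^sub>M out_space n)"
    and "S3 l \<in> borel_measurable ((word_space l \<Otimes>\<^sub>M word_space l) \<Otimes>\<^sub>M out_space n)"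
  unfolding S1_def S2_def S3_def using n by (auto intro!: borel_measurable_sum)

lemma accept_sets [measurable]:
  "l * \<eta> \<le> n \<Longrightarrow> accept l n \<in> sets ((word_space l \<Otimes>\<^sub>M word_space l) \<Otimes>\<^sub>M out_space n)"
  unfolding accept_def by measurable

lemma S_received:
  assumes n: "l * \<eta> \<le> n"
  shows "S1 l (fst \<omega>, received l n \<omega>) = (\<Sum>k<l. block_score \<eta> c11 cX1 cY1 k \<omega>)"
    and "S2 l (fst \<omega>, received l n \<omega>) = (\<Sum>k<l. block_score \<eta> c22 cX2 cY2 k \<omega>)"
    and "S3 l (fst \<omega>, received l n \<omega>) = (\<Sum>k<l. block_score \<eta> c22' cX2 cY3 k \<omega>)"
proof -
  have st1: "stat b1 (received l n \<omega>) k = c11 * lform \<eta> cX1 k \<omega> + c12 * lform \<eta> cX2 k \<omega> + lform \<eta> cY1 k \<omega>" if "k < l" for k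
    unfolding stat_received[OF that n] by (subst lform_split) (simp add: gain cY1_def)
  have st2: "stat b2 (received l n \<omega>) k = c12 * lform \<eta> cX1 k \<omega> + c22 * lform \<eta> cX2 k \<omega> + lform \<eta> cY2 k \<omega>" if "k < l" for k
    unfolding stat_received[OF that n] by (subst lform_split) (simp add: gain cY2_def)
  show "S1 l (fst \<omega>, received l n \<omega>) = (\<Sum>k<l. block_score \<eta> c11 cX1 cY1 k \<omega>)"
    unfolding S1_def block_score_def by (intro sum.cong refl) (simp add: st1 lform_cX)
  show "S2 l (fst \<omega>, received l n \<omega>) = (\<Sum>k<l. block_score \<eta> c22 cX2 cY2 k \<omega>)"
    unfolding S2_def block_score_def by (intro sum.cong refl) (simp add: st2 lform_cX)
  have e: "stat b2 (received l n \<omega>) k - \<kappa> * stat b1 (received l n \<omega>) k = c22' * lform \<eta> cX2 k \<omega> + lform \<eta> cY3 k \<omega>"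
    if "k < l" for k
  proof -
    \<comment> \<open>The share of the first symbol that is left after the subtraction.\<close>
    have "c12 - \<kappa> * c11 = \<kappa>" using kappa_mult by (simp add: algebra_simps)
    then have "(c12 - \<kappa> * c11) * lform \<eta> cX1 k \<omega> = \<kappa> * lform \<eta> cX1 k \<omega>" by simp
    then show ?thesis
      unfolding st1[OF that] st2[OF that] cY3_def lform_lcomb c22'_def by (simp add: algebra_simps)
  qed
  show "S3 l (fst \<omega>, received l n \<omega>) = (\<Sum>k<l. block_score \<eta> c22' cX2 cY3 k \<omega>)"
    unfolding S3_def block_score_def by (intro sum.cong refl) (simp add: e, simp add: lform_cX)
qed

text \<open>Chebyshev's inequality in pointwise form: a missed threshold makes one of the centred
  ratios large, so the indicator is dominated by a combination of their squares.\<close>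

lemma reject_probability:
  obtains V where "0 \<le> V" "\<And>l n. 0 < l \<Longrightarrow> l * \<eta> \<le> n \<Longrightarrow>
    (\<integral>\<^sup>+x. indicator (- accept l n) (fst x, received l n x) \<partial>joint_space N s2 l n) \<le> ennreal (V / real l)"
proof -
  obtain V1 where V1: "moment_bound N s2 \<eta> (\<lambda>k \<omega>. block_score \<eta> c11 cX1 cY1 k \<omega> - ln (1 + c11) / 2) V1"
    using block_score_moment_bound[OF N s2, of \<eta> cX1 cY1 c11] by (auto simp: lcov_basic)
  obtain V2 where V2: "moment_bound N s2 \<eta> (\<lambda>k \<omega>. block_score \<eta> c22 cX2 cY2 k \<omega> - ln (1 + c22) / 2) V2"
    using block_score_moment_bound[OF N s2, of \<eta> cX2 cY2 c22] by (auto simp: lcov_basic)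
  obtain V3 where V3: "moment_bound N s2 \<eta> (\<lambda>k \<omega>. block_score \<eta> c22' cX2 cY3 k \<omega> - ln (1 + c22') / 2) V3"
    using block_score_moment_bound[OF N s2, of \<eta> cX2 cY3 c22'] by (auto simp: lcov_basic lcov_cY3)
  note V1 = moment_boundD[OF V1] and V2 = moment_boundD[OF V2] and V3 = moment_boundD[OF V3]
  define V where "V = (5 * V1 + (V2 + 4 * V3)) / \<epsilon>\<^sup>2"
  show ?thesis
  proof (rule that[of V])
    show "0 \<le> V" using V1 V2 V3 by (simp add: V_def)
    fix l n assume l: "0 < l" and n: "l * \<eta> \<le> n"
    define T1 where "T1 \<omega> = S1 l (fst \<omega>, received l n \<omega>) - real l * I1" for \<omega>
    define T2 where "T2 \<omega> = S2 l (fst \<omega>, received l n \<omega>) - real l * I2" for \<omega>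
    define T3 where "T3 \<omega> = S3 l (fst \<omega>, received l n \<omega>) - real l * I3" for \<omega>
    let ?J = "joint_space N s2 l n"
    note received_measurable[OF n, measurable]
    have mY: "(\<lambda>\<omega>. (fst \<omega>, received l n \<omega>)) \<in> ?J \<rightarrow>\<^sub>M (word_space l \<Otimes>\<^sub>M word_space l) \<Otimes>\<^sub>M out_space n"
      using received_measurable[OF n] unfolding joint_space_def out_space_def
      by (intro measurable_Pair) auto
    have mT [measurable]: "T1 \<in> borel_measurable ?J" "T2 \<in> borel_measurable ?J" "T3 \<in> borel_measurable ?J"
      unfolding T1_def T2_def T3_def
      by (intro borel_measurable_diff borel_measurable_const measurable_compose[OF mY] S_measurable[OF n])+
    have b1: "(\<integral>\<^sup>+\<omega>. ennreal ((T1 \<omega>)\<^sup>2) \<partial>?J) \<le> ennreal (real l * V1)"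
      using V1(2)[OF n] by (simp add: T1_def S_received[OF n] sum_subtractf I1_def)
    have b2: "(\<integral>\<^sup>+\<omega>. ennreal ((T2 \<omega>)\<^sup>2) \<partial>?J) \<le> ennreal (real l * V2)"
      using V2(2)[OF n] by (simp add: T2_def S_received[OF n] sum_subtractf I2_def)
    have b3: "(\<integral>\<^sup>+\<omega>. ennreal ((T3 \<omega>)\<^sup>2) \<partial>?J) \<le> ennreal (real l * V3)"
      using V3(2)[OF n] by (simp add: T3_def S_received[OF n] sum_subtractf I3_def)
    define e where "e = real l * \<epsilon>"
    have e: "0 < e" using l eps by (simp add: e_def)
    have "indicator (- accept l n) (fst \<omega>, received l n \<omega>)
        \<le> ennreal (5 / e\<^sup>2 * (T1 \<omega>)\<^sup>2 + 1 * (1 / e\<^sup>2 * (T2 \<omega>)\<^sup>2 + 4 / e\<^sup>2 * (T3 \<omega>)\<^sup>2))"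
      if w: "\<omega> \<in> space ?J" for \<omega>
    proof (cases "(fst \<omega>, received l n \<omega>) \<in> accept l n")
      case False
      have "(fst \<omega>, received l n \<omega>) \<in> space ((word_space l \<Otimes>\<^sub>M word_space l) \<Otimes>\<^sub>M out_space n)"
        using measurable_space[OF mY w] .
      with False have "T1 \<omega> < - e \<or> T2 \<omega> < - e \<or> T1 \<omega> + T3 \<omega> < - e"
        by (auto simp: accept_def T1_def T2_def T3_def e_def algebra_simps)
      \<comment> \<open>A deficit e of \<open>T1 + T3\<close> is a deficit e / 2 of one of them.
        Halving costs a factor 4, and the weight 5 = 1 + 4 lets \<open>T1\<close> answer for its own
        threshold as well.\<close>
      then have "T1 \<omega> < - e / 2 \<or> T2 \<omega> < - e \<or> T3 \<omega> < - e / 2" using e by linarith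
      moreover have half: "e\<^sup>2 \<le> 4 * t\<^sup>2" if "t < - e / 2" for t
      proof -
        have "e\<^sup>2 \<le> (- 2 * t)\<^sup>2" using that e by (intro power_mono) auto
        then show ?thesis by (simp add: power_mult_distrib)
      qed
      moreover have "e\<^sup>2 \<le> t\<^sup>2" if "t < - e" for t
        using power_mono[of e "- t" 2] that e by simp
      ultimately have "e\<^sup>2 \<le> 4 * (T1 \<omega>)\<^sup>2 \<or> e\<^sup>2 \<le> (T2 \<omega>)\<^sup>2 \<or> e\<^sup>2 \<le> 4 * (T3 \<omega>)\<^sup>2" by blast
      then have "e\<^sup>2 \<le> 5 * (T1 \<omega>)\<^sup>2 + ((T2 \<omega>)\<^sup>2 + 4 * (T3 \<omega>)\<^sup>2)"
        by (smt (verit) zero_le_power2)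
      then have "1 \<le> (5 * (T1 \<omega>)\<^sup>2 + ((T2 \<omega>)\<^sup>2 + 4 * (T3 \<omega>)\<^sup>2)) / e\<^sup>2"
        using e by (simp add: le_divide_eq)
      also have "\<dots> = 5 / e\<^sup>2 * (T1 \<omega>)\<^sup>2 + 1 * (1 / e\<^sup>2 * (T2 \<omega>)\<^sup>2 + 4 / e\<^sup>2 * (T3 \<omega>)\<^sup>2)"
        by (simp add: add_divide_distrib)
      finally show ?thesis using False
        by (simp add: ennreal_ge_1 del: ennreal_plus)
    qed simp
    then have "(\<integral>\<^sup>+x. indicator (- accept l n) (fst x, received l n x) \<partial>?J)
        \<le> (\<integral>\<^sup>+\<omega>. ennreal (5 / e\<^sup>2 * (T1 \<omega>)\<^sup>2 + 1 * (1 / e\<^sup>2 * (T2 \<omega>)\<^sup>2 + 4 / e\<^sup>2 * (T3 \<omega>)\<^sup>2)) \<partial>?J)"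
      by (intro nn_integral_mono)
    also have "\<dots> \<le> ennreal (5 / e\<^sup>2 * (real l * V1) + 1 * (1 / e\<^sup>2 * (real l * V2) + 4 / e\<^sup>2 * (real l * V3)))"
      using V1(1) V2(1) V3(1) by (intro nn_integral_add_le b1 b2 b3 add_nonneg_nonneg mult_nonneg_nonneg; (measurable | simp))
    also have "5 / e\<^sup>2 * (real l * V1) + 1 * (1 / e\<^sup>2 * (real l * V2) + 4 / e\<^sup>2 * (real l * V3)) = V / real l"
      using l eps by (simp add: V_def e_def power2_eq_square field_simps)
    finally show "(\<integral>\<^sup>+x. indicator (- accept l n) (fst x, received l n x) \<partial>?J) \<le> ennreal (V / real l)" .
  qed
qed


section \<open>Acceptance of wrong codewords\<close>

lemma score_sum_measurable [measurable]:
  "(\<lambda>x. \<Sum>k<l. score c (b k) (x k)) \<in> borel_measurable (word_space l)"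
  by measurable

lemma indicator_accept_le:
  assumes "q \<in> accept l n \<Longrightarrow> t \<le> s"
  shows "(indicator (accept l n) q :: ennreal) \<le> ennreal (exp (- t)) * ennreal (exp s)"
proof (cases "q \<in> accept l n")
  case True
  then have "1 \<le> exp (- t) * exp s" using assms by (simp add: exp_add[symmetric])
  then show ?thesis using True by (simp add: ennreal_mult[symmetric] ennreal_ge_1)
qed simp

text \<open>The output and the other word are constants here, so the exponential of the score sum
  has mean 1 and the threshold contributes the factor exp (- t).\<close>

lemma wrong1_probability:
  "(\<integral>\<^sup>+a. indicator (accept l n) ((a, b), y) \<partial>word_space l) \<le> ennreal (exp (- (real l * (I1 - \<epsilon>))))"
proof -
  let ?t = "real l * (I1 - \<epsilon>)" and ?s = "\<lambda>a. \<Sum>k<l. score c11 (stat b1 y k - c12 * b k) (a k)"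
  have "(\<integral>\<^sup>+a. indicator (accept l n) ((a, b), y) \<partial>word_space l)
      \<le> (\<integral>\<^sup>+a. ennreal (exp (- ?t)) * ennreal (exp (?s a)) \<partial>word_space l)"
    by (intro nn_integral_mono indicator_accept_le) (simp add: accept_def S1_def)
  also have "\<dots> = ennreal (exp (- ?t)) * (\<integral>\<^sup>+a. ennreal (exp (?s a)) \<partial>word_space l)"
    by (rule nn_integral_cmult) measurable
  finally show ?thesis by (simp add: nn_integral_exp_score_sum c_nonneg)
qed

lemma wrong2_probability:
  "(\<integral>\<^sup>+b. indicator (accept l n) ((a, b), y) \<partial>word_space l) \<le> ennreal (exp (- (real l * (I2 - \<epsilon>))))"
proof -
  let ?t = "real l * (I2 - \<epsilon>)" and ?s = "\<lambda>b. \<Sum>k<l. score c22 (stat b2 y k - c12 * a k) (b k)"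
  have "(\<integral>\<^sup>+b. indicator (accept l n) ((a, b), y) \<partial>word_space l)
      \<le> (\<integral>\<^sup>+b. ennreal (exp (- ?t)) * ennreal (exp (?s b)) \<partial>word_space l)"
    by (intro nn_integral_mono indicator_accept_le) (simp add: accept_def S2_def)
  also have "\<dots> = ennreal (exp (- ?t)) * (\<integral>\<^sup>+b. ennreal (exp (?s b)) \<partial>word_space l)"
    by (rule nn_integral_cmult) measurable
  finally show ?thesis by (simp add: nn_integral_exp_score_sum c_nonneg)
qed

text \<open>The inner integral over the first word removes \<open>S1\<close> for each second word.
  What remains of \<open>S3\<close> involves the second word only and is removed by the outer
  integral.\<close>

lemma wrong12_probability:
  "(\<integral>\<^sup>+b. \<integral>\<^sup>+a. indicator (accept l n) ((a, b), y) \<partial>word_space l \<partial>word_space l)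
    \<le> ennreal (exp (- (real l * (I1 + I3 - \<epsilon>))))"
proof -
  let ?t = "real l * (I1 + I3 - \<epsilon>)"
    and ?s1 = "\<lambda>a b. \<Sum>k<l. score c11 (stat b1 y k - c12 * b k) (a k)"
    and ?s3 = "\<lambda>b. \<Sum>k<l. score c22' (stat b2 y k - \<kappa> * stat b1 y k) (b k)"
  have "(\<integral>\<^sup>+a. indicator (accept l n) ((a, b), y) \<partial>word_space l) \<le> ennreal (exp (- ?t)) * ennreal (exp (?s3 b))" for b
  proof -
    have "(\<integral>\<^sup>+a. indicator (accept l n) ((a, b), y) \<partial>word_space l)
        \<le> (\<integral>\<^sup>+a. ennreal (exp (- ?t)) * ennreal (exp (?s1 a b + ?s3 b)) \<partial>word_space l)"
      by (intro nn_integral_mono indicator_accept_le) (simp add: accept_def S1_def S3_def)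
    also have "\<dots> = (\<integral>\<^sup>+a. ennreal (exp (- ?t)) * ennreal (exp (?s3 b)) * ennreal (exp (?s1 a b)) \<partial>word_space l)"
      by (intro nn_integral_cong) (simp add: exp_add ennreal_mult[symmetric] mult_ac)
    also have "\<dots> = ennreal (exp (- ?t)) * ennreal (exp (?s3 b)) * (\<integral>\<^sup>+a. ennreal (exp (?s1 a b)) \<partial>word_space l)"
      by (rule nn_integral_cmult) measurable
    finally show ?thesis by (simp add: nn_integral_exp_score_sum c_nonneg)
  qed
  then have "(\<integral>\<^sup>+b. \<integral>\<^sup>+a. indicator (accept l n) ((a, b), y) \<partial>word_space l \<partial>word_space l)
      \<le> (\<integral>\<^sup>+b. ennreal (exp (- ?t)) * ennreal (exp (?s3 b)) \<partial>word_space l)"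
    by (intro nn_integral_mono)
  also have "\<dots> = ennreal (exp (- ?t)) * (\<integral>\<^sup>+b. ennreal (exp (?s3 b)) \<partial>word_space l)"
    by (rule nn_integral_cmult) measurable
  finally show ?thesis by (simp add: nn_integral_exp_score_sum c22'_nonneg)
qed

section \<open>Energy deviations of the codewords\<close>

definition E2 :: real where "E2 = (\<Sum>i<\<eta>. (gain2 i)\<^sup>2) + (\<Sum>i<\<eta>. (gain1 i)\<^sup>2)"
text \<open>The codeword share of the energy that transmitter 2 spends on a block. Its mean for
  independent standard symbols is \<open>E2\<close>, as the cross term averages out.\<close>

definition quad :: "real \<Rightarrow> real \<Rightarrow> real" where "quad x y = (\<Sum>i<\<eta>. (y * gain2 i + x * gain1 i)\<^sup>2)"

definition dev1 :: "nat \<Rightarrow> word \<times> word \<Rightarrow> real" where "dev1 l p = (\<Sum>k<l. (fst p k)\<^sup>2 - 1)"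
definition dev2 :: "nat \<Rightarrow> word \<times> word \<Rightarrow> real" where "dev2 l p = (\<Sum>k<l. quad (fst p k) (snd p k) - E2)"

text \<open>If \<open>E2 = 0\<close> then \<open>quad\<close> vanishes identically, and division by zero drops the second summand.\<close>

definition pen :: "nat \<Rightarrow> word \<times> word \<Rightarrow> real" where
  "pen l p = 1 / (real l * \<theta>)\<^sup>2 * (dev1 l p)\<^sup>2 + 1 / (real l * \<theta> * E2)\<^sup>2 * (dev2 l p)\<^sup>2"

lemma dev_measurable [measurable]:
  "dev1 l \<in> borel_measurable (word_space l \<Otimes>\<^sub>M word_space l)"
  "dev2 l \<in> borel_measurable (word_space l \<Otimes>\<^sub>M word_space l)"
  unfolding dev1_def dev2_def quad_def by measurable

lemma joint_space_fst:
  assumes [measurable]: "f \<in> borel_measurable (word_space l \<Otimes>\<^sub>M word_space l)"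
  shows "(\<integral>\<^sup>+x. f (fst x) \<partial>joint_space N s2 l n) = (\<integral>\<^sup>+p. f p \<partial>(word_space l \<Otimes>\<^sub>M word_space l))"
proof -
  interpret W: prob_space "noise_space n N s2" by (rule prob_space_noise_space[OF N s2])
  show ?thesis unfolding joint_space_def
    by (subst W.nn_integral_fst[symmetric]) (auto simp: W.emeasure_space_1)
qed

lemma pen_expectation:
  obtains V where "0 \<le> V" "\<And>l. 0 < l \<Longrightarrow> (\<integral>\<^sup>+p. ennreal (pen l p) \<partial>(word_space l \<Otimes>\<^sub>M word_space l)) \<le> ennreal (V / real l)"
proof -
  obtain V1 where "moment_bound N s2 \<eta> (\<lambda>k \<omega>. lform \<eta> cX1 k \<omega> * lform \<eta> cX1 k \<omega> - lcov cX1 cX1) V1"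
    using block_product_moment_bound[OF N s2] by blast
  note V1 = moment_boundD[OF this]
  \<comment> \<open>The quadratic form is written as y times a form in both symbols plus x times a
    form in x, with the whole cross term put into the first product.\<close>
  define E where "E = lcomb (\<Sum>i<\<eta>. (gain2 i)\<^sup>2) cX2 (2 * (\<Sum>i<\<eta>. gain1 i * gain2 i)) cX1"
  define E' where "E' = lcomb (\<Sum>i<\<eta>. (gain1 i)\<^sup>2) cX1 0 cX1"
  obtain V2 where "moment_bound N s2 \<eta> (\<lambda>k \<omega>. lform \<eta> cX2 k \<omega> * lform \<eta> E k \<omega> + lform \<eta> cX1 k \<omega> * lform \<eta> E' k \<omega>
        - (lcov cX2 E + lcov cX1 E')) V2"
    using block_two_products_moment_bound[OF N s2] by blast
  note V2 = moment_boundD[OF this]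
  have eqE: "lcov cX2 E + lcov cX1 E' = E2"
    unfolding E_def E'_def by (simp add: lform_cov_lcomb lcov_basic E2_def)
  have eqq: "lform \<eta> cX2 k \<omega> * lform \<eta> E k \<omega> + lform \<eta> cX1 k \<omega> * lform \<eta> E' k \<omega> = quad (fst (fst \<omega>) k) (snd (fst \<omega>) k)" for k \<omega>
    unfolding E_def E'_def lform_lcomb lform_cX quad_def
    by (simp add: power2_sum power_mult_distrib sum.distrib sum_distrib_left algebra_simps power2_eq_square)
  define V where "V = V1 / \<theta>\<^sup>2 + V2 / (\<theta> * E2)\<^sup>2"
  show ?thesis
  proof (rule that[of V])
    show "0 \<le> V" using V1 V2 by (simp add: V_def)
    fix l :: nat assume l: "0 < l"
    let ?W = "word_space l \<Otimes>\<^sub>M word_space l"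
    \<comment> \<open>The moment bounds live on the joint space, so a blocklength has to be named;
      the shortest one is taken and the noise is integrated out.\<close>
    have d1: "(\<integral>\<^sup>+p. ennreal ((dev1 l p)\<^sup>2) \<partial>?W) \<le> ennreal (real l * V1)"
      using V1(2)[of l "l * \<eta>", OF order_refl] joint_space_fst[of "\<lambda>p. ennreal ((dev1 l p)\<^sup>2)" l "l * \<eta>"]
      by (simp add: dev1_def lform_cX lcov_basic power2_eq_square)
    have d2: "(\<integral>\<^sup>+p. ennreal ((dev2 l p)\<^sup>2) \<partial>?W) \<le> ennreal (real l * V2)"
    proof -
      have "(\<integral>\<^sup>+p. ennreal ((dev2 l p)\<^sup>2) \<partial>?W) = (\<integral>\<^sup>+x. ennreal ((dev2 l (fst x))\<^sup>2) \<partial>joint_space N s2 l (l * \<eta>))"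
        by (rule joint_space_fst[symmetric]) measurable
      then show ?thesis using V2(2)[of l "l * \<eta>", OF order_refl] unfolding eqE eqq by (simp add: dev2_def)
    qed
    have "(\<integral>\<^sup>+p. ennreal (pen l p) \<partial>?W)
        \<le> ennreal (1 / (real l * \<theta>)\<^sup>2 * (real l * V1) + 1 / (real l * \<theta> * E2)\<^sup>2 * (real l * V2))"
      unfolding pen_def using V1(1) V2(1) by (intro nn_integral_add_le d1 d2; (measurable | simp))
    also have "1 / (real l * \<theta>)\<^sup>2 * (real l * V1) + 1 / (real l * \<theta> * E2)\<^sup>2 * (real l * V2) = V / real l"
      using l theta by (cases "E2 = 0") (simp_all add: V_def power2_eq_square field_simps)
    finally show "(\<integral>\<^sup>+p. ennreal (pen l p) \<partial>?W) \<le> ennreal (V / real l)" .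
  qed
qed

text \<open>Pairs are searched in the order of their codes, which makes the choice measurable. If no
  pair is accepted the least index is unspecified, and the outcome belongs to the failure
  event.\<close>

definition decoder :: "nat \<Rightarrow> nat \<Rightarrow> nat \<Rightarrow> nat \<Rightarrow> (nat \<Rightarrow> word) \<Rightarrow> (nat \<Rightarrow> word) \<Rightarrow> (nat \<Rightarrow> real) \<Rightarrow> nat \<times> nat" where
  "decoder l n M1 M2 c1 c2 y = prod_decode (LEAST i. fst (prod_decode i) < M1 \<and> snd (prod_decode i) < M2 \<and>
     ((c1 (fst (prod_decode i)), c2 (snd (prod_decode i))), y) \<in> accept l n)"

lemma decoder_correct:
  assumes m: "m1 < M1" "m2 < M2" and acc: "((c1 m1, c2 m2), y) \<in> accept l n"
    and uniq: "\<And>i j. i < M1 \<Longrightarrow> j < M2 \<Longrightarrow> ((c1 i, c2 j), y) \<in> accept l n \<Longrightarrow> (i, j) = (m1, m2)"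
  shows "decoder l n M1 M2 c1 c2 y = (m1, m2)"
proof -
  define Q where "Q i \<longleftrightarrow> fst (prod_decode i) < M1 \<and> snd (prod_decode i) < M2 \<and>
     ((c1 (fst (prod_decode i)), c2 (snd (prod_decode i))), y) \<in> accept l n" for i
  have "Q (prod_encode (m1, m2))" using m acc by (simp add: Q_def)
  then have "Q (LEAST i. Q i)" by (rule LeastI)
  then have "(fst (prod_decode (LEAST i. Q i)), snd (prod_decode (LEAST i. Q i))) = (m1, m2)"
    unfolding Q_def by (intro uniq) auto
  then show ?thesis by (simp add: decoder_def Q_def)
qed

lemma restrict_yout:
  "restrict (yout (fb_code l M1 M2 c1 c2 D) m1 m2 (fst \<omega>) (snd \<omega>)) {..<n} = received l n ((c1 m1, c2 m2), \<omega>)"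
  by (rule ext) (simp add: received_def yout_def x2_fb_code restrict_def)

text \<open>For fixed codebooks the search consults countably many sections of
  \<open>accept\<close>, each of them measurable.\<close>

lemma decoder_measurable:
  assumes n: "l * \<eta> \<le> n" and c1: "\<And>m. m < M1 \<Longrightarrow> c1 m \<in> space (word_space l)"
    and c2: "\<And>m. m < M2 \<Longrightarrow> c2 m \<in> space (word_space l)"
  shows "decoder l n M1 M2 c1 c2 \<in> out_space n \<rightarrow>\<^sub>M count_space UNIV"
proof -
  have "Measurable.pred (out_space n) (\<lambda>y. i < M1 \<and> j < M2 \<and> ((c1 i, c2 j), y) \<in> accept l n)" for i j
  proof (cases "i < M1 \<and> j < M2")
    case True
    then have "(c1 i, c2 j) \<in> space (word_space l \<Otimes>\<^sub>M word_space l)"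
      using c1 c2 by (simp add: space_pair_measure)
    then have [measurable]: "(\<lambda>y. ((c1 i, c2 j), y)) \<in> out_space n \<rightarrow>\<^sub>M (word_space l \<Otimes>\<^sub>M word_space l) \<Otimes>\<^sub>M out_space n"
      by (rule measurable_Pair1')
    show ?thesis using n by measurable
  qed simp
  then have "(\<lambda>y. LEAST i. fst (prod_decode i) < M1 \<and> snd (prod_decode i) < M2 \<and>
     ((c1 (fst (prod_decode i)), c2 (snd (prod_decode i))), y) \<in> accept l n) \<in> out_space n \<rightarrow>\<^sub>M count_space UNIV"
    by (intro measurable_Least)
  then show ?thesis
    unfolding decoder_def by (rule measurable_compose) simp
qed


section \<open>Energy of the transmitted blocks\<close>

lemma sum_block:
  fixes f :: "nat \<Rightarrow> 'c :: comm_monoid_add"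
  assumes n: "l * \<eta> \<le> n" and z: "\<And>t. l * \<eta> \<le> t \<Longrightarrow> f t = 0"
  shows "(\<Sum>t<n. f t) = (\<Sum>k<l. \<Sum>i<\<eta>. f (k * \<eta> + i))"
proof -
  have "(\<Sum>t<n. f t) = (\<Sum>t<l * \<eta>. f t)"
    using n z by (intro sum.mono_neutral_right) auto
  also have "\<dots> = (\<Sum>k<l. \<Sum>t = k * \<eta>..<k * \<eta> + \<eta>. f t)" by (rule sum.nat_group[symmetric])
  also have "\<dots> = (\<Sum>k<l. \<Sum>i<\<eta>. f (k * \<eta> + i))"
  proof (rule sum.cong[OF refl])
    fix k
    show "(\<Sum>t = k * \<eta>..<k * \<eta> + \<eta>. f t) = (\<Sum>i<\<eta>. f (k * \<eta> + i))"
      using sum.shift_bounds_nat_ivl[of f 0 "k * \<eta>" \<eta>] by (simp add: atLeast0LessThan add.commute)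
  qed
  finally show ?thesis .
qed

lemma sum_sent1_square:
  assumes n: "l * \<eta> \<le> n"
  shows "(\<Sum>t<n. (sent1 l x t)\<^sup>2) = (\<Sum>i<\<eta>. (a1 i)\<^sup>2) * (\<Sum>k<l. (x k)\<^sup>2)"
proof -
  have "(\<Sum>t<n. (sent1 l x t)\<^sup>2) = (\<Sum>k<l. \<Sum>i<\<eta>. (sent1 l x (k * \<eta> + i))\<^sup>2)"
    by (rule sum_block[OF n]) (simp add: sent1_def)
  also have "\<dots> = (\<Sum>k<l. \<Sum>i<\<eta>. (a1 i)\<^sup>2 * (x k)\<^sup>2)"
    by (intro sum.cong refl) (simp add: sent1_def block_index_less power_mult_distrib)
  also have "\<dots> = (\<Sum>i<\<eta>. (a1 i)\<^sup>2) * (\<Sum>k<l. (x k)\<^sup>2)"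
    by (simp add: sum_distrib_left sum_distrib_right)
  finally show ?thesis .
qed

definition noise_power :: real where "noise_power = (N + s2) * (\<Sum>i<\<eta>. \<Sum>j<\<eta>. (gainz i j)\<^sup>2)"

text \<open>For fixed codewords the zero mean noise gives no cross term and adds exactly
  \<open>noise_power\<close> to each block. Only the \<open>quad\<close> part depends on the
  codebook.\<close>

lemma sum_sent2_square:
  assumes n: "l * \<eta> \<le> n"
  shows "(\<Sum>t<n. \<integral>\<^sup>+\<omega>. ennreal ((sent2 l ((x, y), \<omega>) t)\<^sup>2) \<partial>noise_space n N s2)
    = ennreal ((\<Sum>k<l. quad (x k) (y k)) + real l * noise_power)"
proof -
  have blk: "(\<integral>\<^sup>+\<omega>. ennreal ((sent2 l ((x, y), \<omega>) (k * \<eta> + i))\<^sup>2) \<partial>noise_space n N s2)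
      = ennreal ((y k * gain2 i + x k * gain1 i)\<^sup>2 + (N + s2) * (\<Sum>j<\<eta>. (gainz i j)\<^sup>2))"
    if k: "k < l" and i: "i < \<eta>" for k i
  proof -
    have "k * \<eta> + j < n" if "j < \<eta>" for j using block_index_less[OF k that] n by simp
    moreover have "inj_on (\<lambda>j. k * \<eta> + j) {..<\<eta>}" by (auto simp: inj_on_def)
    ultimately show ?thesis
      using nn_integral_noise_affine_square[OF N s2, of \<eta> "\<lambda>j. k * \<eta> + j" n "y k * gain2 i + x k * gain1 i" "gainz i"]
        i block_index_less[OF k i] by (simp add: sent2_def)
  qed
  have "(\<Sum>t<n. \<integral>\<^sup>+\<omega>. ennreal ((sent2 l ((x, y), \<omega>) t)\<^sup>2) \<partial>noise_space n N s2)
      = (\<Sum>k<l. \<Sum>i<\<eta>. \<integral>\<^sup>+\<omega>. ennreal ((sent2 l ((x, y), \<omega>) (k * \<eta> + i))\<^sup>2) \<partial>noise_space n N s2)"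
    by (rule sum_block[OF n]) (simp add: sent2_def)
  also have "\<dots> = (\<Sum>k<l. \<Sum>i<\<eta>. ennreal ((y k * gain2 i + x k * gain1 i)\<^sup>2 + (N + s2) * (\<Sum>j<\<eta>. (gainz i j)\<^sup>2)))"
    by (intro sum.cong refl blk) auto
  also have "\<dots> = ennreal (\<Sum>k<l. \<Sum>i<\<eta>. (y k * gain2 i + x k * gain1 i)\<^sup>2 + (N + s2) * (\<Sum>j<\<eta>. (gainz i j)\<^sup>2))"
    using N s2 by (simp add: sum_ennreal sum_nonneg add_nonneg_nonneg del: ennreal_plus)
  also have "(\<Sum>k<l. \<Sum>i<\<eta>. (y k * gain2 i + x k * gain1 i)\<^sup>2 + (N + s2) * (\<Sum>j<\<eta>. (gainz i j)\<^sup>2))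
      = (\<Sum>k<l. quad (x k) (y k)) + real l * noise_power"
    by (simp add: quad_def noise_power_def sum.distrib sum_distrib_left)
  finally show ?thesis .
qed

text \<open>\<open>V\<close> collects the Chebyshev constants of the rejection event and of the
  power penalty. The condition \<open>d < 1\<close> is there for the penalty: an average penalty
  below 1 enforces both power constraints.\<close>

lemma code_exists:
  obtains V where "0 \<le> V" "\<And>l n M1 M2 d. 0 < l \<Longrightarrow> l * \<eta> \<le> n \<Longrightarrow> 1 \<le> M1 \<Longrightarrow> 1 \<le> M2 \<Longrightarrow>
    V / real l + real (M1 - 1) * exp (- (real l * (I1 - \<epsilon>))) + real (M2 - 1) * exp (- (real l * (I2 - \<epsilon>)))
      + real (M1 - 1) * real (M2 - 1) * exp (- (real l * (I1 + I3 - \<epsilon>))) < d \<Longrightarrow> d < 1 \<Longrightarrow>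
    \<exists>c. msz1 c = M1 \<and> msz2 c = M2 \<and> valid_code P1 P2 N s2 n c \<and> err_prob N s2 n c \<le> d"
proof -
  obtain V0 where V0: "0 \<le> V0" "\<And>l n. 0 < l \<Longrightarrow> l * \<eta> \<le> n \<Longrightarrow>
    (\<integral>\<^sup>+x. indicator (- accept l n) (fst x, received l n x) \<partial>joint_space N s2 l n) \<le> ennreal (V0 / real l)"
    using reject_probability by blast
  obtain V1 where V1: "0 \<le> V1" "\<And>l. 0 < l \<Longrightarrow> (\<integral>\<^sup>+p. ennreal (pen l p) \<partial>(word_space l \<Otimes>\<^sub>M word_space l)) \<le> ennreal (V1 / real l)"
    using pen_expectation by blast
  show ?thesis
  proof (rule that[of "V0 + V1"])
    show "0 \<le> V0 + V1" using V0 V1 by simp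
    fix l n M1 M2 :: nat and d :: real
    assume l: "0 < l" and n: "l * \<eta> \<le> n" and M: "1 \<le> M1" "1 \<le> M2" and d1: "d < 1"
      and lt: "(V0 + V1) / real l + real (M1 - 1) * exp (- (real l * (I1 - \<epsilon>))) + real (M2 - 1) * exp (- (real l * (I2 - \<epsilon>)))
        + real (M1 - 1) * real (M2 - 1) * exp (- (real l * (I1 + I3 - \<epsilon>))) < d"
    let ?W = "noise_space n N s2"
    define p1 p2 p12 where "p1 = exp (- (real l * (I1 - \<epsilon>)))" and "p2 = exp (- (real l * (I2 - \<epsilon>)))"
      and "p12 = exp (- (real l * (I1 + I3 - \<epsilon>)))"
    have p: "0 \<le> p1" "0 \<le> p2" "0 \<le> p12" by (simp_all add: p1_def p2_def p12_def)
    interpret mac_ensemble "word_space l" "word_space l" ?W "out_space n" "received l n" "accept l n"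
      "\<lambda>p. ennreal (pen l p)" "ennreal (V0 / real l)" "ennreal p1" "ennreal p2" "ennreal p12" "ennreal (V1 / real l)"
    proof (rule mac_ensemble.intro)
      show "received l n \<in> (word_space l \<Otimes>\<^sub>M word_space l) \<Otimes>\<^sub>M ?W \<rightarrow>\<^sub>M out_space n"
        using received_measurable[OF n] by (simp add: joint_space_def out_space_def)
      show "accept l n \<in> sets ((word_space l \<Otimes>\<^sub>M word_space l) \<Otimes>\<^sub>M out_space n)" using n by measurable
      show "(\<lambda>p. ennreal (pen l p)) \<in> borel_measurable (word_space l \<Otimes>\<^sub>M word_space l)"
        unfolding pen_def by measurable
      show "(\<integral>\<^sup>+x. indicator (- accept l n) (fst x, received l n x) \<partial>((word_space l \<Otimes>\<^sub>M word_space l) \<Otimes>\<^sub>M ?W)) \<le> ennreal (V0 / real l)"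
        using V0(2)[OF l n] by (simp add: joint_space_def)
      show "(\<integral>\<^sup>+a. indicator (accept l n) ((a, b), y) \<partial>word_space l) \<le> ennreal p1" for b y
        unfolding p1_def by (rule wrong1_probability)
      show "(\<integral>\<^sup>+b. indicator (accept l n) ((a, b), y) \<partial>word_space l) \<le> ennreal p2" for a y
        unfolding p2_def by (rule wrong2_probability)
      show "(\<integral>\<^sup>+b. \<integral>\<^sup>+a. indicator (accept l n) ((a, b), y) \<partial>word_space l \<partial>word_space l) \<le> ennreal p12" for y
        unfolding p12_def by (rule wrong12_probability)
      show "(\<integral>\<^sup>+p. ennreal (pen l p) \<partial>(word_space l \<Otimes>\<^sub>M word_space l)) \<le> ennreal (V1 / real l)" by (rule V1(2)[OF l])
    qed (intro prob_space_word_space prob_space_noise_space N s2)+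
    have nn: "0 \<le> V0 / real l" "0 \<le> V1 / real l" using V0(1) V1(1) by auto
    have d0: "0 \<le> d"
    proof -
      have "0 \<le> (V0 + V1) / real l + real (M1 - 1) * exp (- (real l * (I1 - \<epsilon>))) + real (M2 - 1) * exp (- (real l * (I2 - \<epsilon>)))
        + real (M1 - 1) * real (M2 - 1) * exp (- (real l * (I1 + I3 - \<epsilon>)))"
        using V0(1) V1(1) by (intro add_nonneg_nonneg mult_nonneg_nonneg divide_nonneg_nonneg) auto
      with lt show ?thesis by linarith
    qed
    have "ennreal (V0 / real l) + of_nat (M1 - 1) * ennreal p1 + of_nat (M2 - 1) * ennreal p2
        + of_nat (M1 - 1) * of_nat (M2 - 1) * ennreal p12 + ennreal (V1 / real l)
      = ennreal (V0 / real l + real (M1 - 1) * p1 + real (M2 - 1) * p2 + real (M1 - 1) * real (M2 - 1) * p12 + V1 / real l)"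
      using nn p by (simp add: ennreal_of_nat_eq_real_of_nat ennreal_mult[symmetric] ennreal_plus[symmetric] del: ennreal_plus)
    also have "\<dots> < ennreal d"
      using lt nn p by (intro ennreal_lessI) (auto simp: p1_def p2_def p12_def add_divide_distrib intro: le_less_trans[OF _ lt])
    finally obtain c1 c2 where c1: "\<And>m. m < M1 \<Longrightarrow> c1 m \<in> space (word_space l)"
      and c2: "\<And>m. m < M2 \<Longrightarrow> c2 m \<in> space (word_space l)"
      and tot: "(\<Sum>m1<M1. \<Sum>m2<M2. emeasure ?W (failure M1 M2 c1 c2 m1 m2) + ennreal (pen l (c1 m1, c2 m2)))
        \<le> of_nat M1 * of_nat M2 * ennreal d"
      using mac_codebook_exists[OF M] by blast
    have pen0: "0 \<le> pen l q" for q by (simp add: pen_def)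
    have tot': "(\<Sum>m1<M1. \<Sum>m2<M2. measure ?W (failure M1 M2 c1 c2 m1 m2) + pen l (c1 m1, c2 m2)) \<le> real M1 * real M2 * d"
    proof -
      have "(\<Sum>m1<M1. \<Sum>m2<M2. emeasure ?W (failure M1 M2 c1 c2 m1 m2) + ennreal (pen l (c1 m1, c2 m2)))
          = ennreal (\<Sum>m1<M1. \<Sum>m2<M2. measure ?W (failure M1 M2 c1 c2 m1 m2) + pen l (c1 m1, c2 m2))"
        using pen0 by (simp add: W.emeasure_eq_measure ennreal_plus[symmetric] sum_ennreal sum_nonneg del: ennreal_plus)
      moreover have "of_nat M1 * of_nat M2 * ennreal d = ennreal (real M1 * real M2 * d)"
        using d0 by (simp add: ennreal_of_nat_eq_real_of_nat ennreal_mult[symmetric])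
      ultimately show ?thesis using tot d0 by (simp add: ennreal_le_iff)
    qed
    define D where "D = decoder l n M1 M2 c1 c2"
    define c where "c = fb_code l M1 M2 c1 c2 D"
    have dec: "decoded c n m1 m2 \<omega> = decoder l n M1 M2 c1 c2 (received l n ((c1 m1, c2 m2), \<omega>))" for m1 m2 \<omega>
      by (simp add: decoded_def c_def restrict_yout D_def)
    define I where "I = {..<M1} \<times> {..<M2}"
    have cardI: "real (card I) = real M1 * real M2" by (simp add: I_def)
    have sumI: "(\<Sum>m1<M1. \<Sum>m2<M2. f m1 m2) = (\<Sum>q\<in>I. f (fst q) (snd q))" for f :: "nat \<Rightarrow> nat \<Rightarrow> real"
      by (simp add: I_def sum.cartesian_product case_prod_beta)
    define w where "w q = (c1 (fst q), c2 (snd q))" for q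
    have penI: "(\<Sum>q\<in>I. pen l (w q)) \<le> real (card I)"
    proof -
      have "(\<Sum>q\<in>I. pen l (w q)) \<le> (\<Sum>m1<M1. \<Sum>m2<M2. measure ?W (failure M1 M2 c1 c2 m1 m2) + pen l (c1 m1, c2 m2))"
        unfolding sumI w_def by (intro sum_mono) simp
      also have "\<dots> \<le> real M1 * real M2 * d" by (rule tot')
      also have "\<dots> \<le> real M1 * real M2 * 1" using d1 by (intro mult_left_mono) auto
      finally show ?thesis by (simp add: cardI)
    qed
    have errI: "(\<Sum>m1<M1. \<Sum>m2<M2. measure ?W (failure M1 M2 c1 c2 m1 m2)) \<le> real M1 * real M2 * d"
    proof -
      have "(\<Sum>m1<M1. \<Sum>m2<M2. measure ?W (failure M1 M2 c1 c2 m1 m2))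
          \<le> (\<Sum>m1<M1. \<Sum>m2<M2. measure ?W (failure M1 M2 c1 c2 m1 m2) + pen l (c1 m1, c2 m2))"
        using pen0 by (intro sum_mono) simp
      with tot' show ?thesis by linarith
    qed
    \<comment> \<open>The scale of the penalty was chosen for this: the energy of the first word
      exceeds its mean \<open>l\<close> on average by at most the fraction
      \<open>\<theta>\<close>.\<close>
    have dev1_le: "(\<Sum>q\<in>I. dev1 l (w q)) \<le> real (card I) * (real l * \<theta>)"
      by (rule sum_le_of_penalty[OF _ _ penI]) (use l theta in \<open>auto simp: pen_def\<close>)
    have E2_nonneg: "0 \<le> E2" by (simp add: E2_def sum_nonneg)
    have dev2_le: "(\<Sum>q\<in>I. dev2 l (w q)) \<le> real (card I) * (real l * \<theta> * E2)"
    proof (cases "E2 = 0")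
      case True
      then have "(\<Sum>i<\<eta>. (gain2 i)\<^sup>2) = 0" "(\<Sum>i<\<eta>. (gain1 i)\<^sup>2) = 0"
        by (simp_all add: E2_def add_nonneg_eq_0_iff sum_nonneg)
      then have "gain2 i = 0" "gain1 i = 0" if "i < \<eta>" for i
        using that by (simp_all add: sum_nonneg_eq_0_iff)
      then have "quad x y = 0" for x y by (simp add: quad_def)
      then show ?thesis using True by (simp add: dev2_def)
    next
      case False
      then show ?thesis
        using E2_nonneg by (intro sum_le_of_penalty[OF _ _ penI]) (use l theta in \<open>auto simp: pen_def\<close>)
    qed
    have ln: "real l * real \<eta> \<le> real n" using n by (metis of_nat_le_iff of_nat_mult)
    have pw1: "(\<Sum>t<n. \<Sum>m1<M1. (enc1 c t m1)\<^sup>2) \<le> real n * real M1 * P1"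
    proof -
      \<comment> \<open>\<open>dev1\<close> does not see the second word, so each first word is
        counted \<open>M2\<close> times; the factor is cancelled afterwards.\<close>
      have "(\<Sum>q\<in>I. dev1 l (w q)) = real M2 * ((\<Sum>m1<M1. \<Sum>k<l. (c1 m1 k)\<^sup>2) - real M1 * real l)"
      proof -
        have "(\<Sum>q\<in>I. dev1 l (w q)) = (\<Sum>m1<M1. \<Sum>m2<M2. dev1 l (c1 m1, c2 m2))"
          unfolding sumI w_def ..
        also have "\<dots> = real M2 * (\<Sum>m1<M1. (\<Sum>k<l. (c1 m1 k)\<^sup>2) - real l)"
          by (simp add: dev1_def sum_subtractf sum_distrib_left right_diff_distrib)
        finally show ?thesis by (simp add: sum_subtractf)
      qed
      then have "real M2 * ((\<Sum>m1<M1. \<Sum>k<l. (c1 m1 k)\<^sup>2) - real M1 * real l) \<le> real M2 * (real M1 * (real l * \<theta>))"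
        using dev1_le by (simp add: cardI mult_ac)
      then have "(\<Sum>m1<M1. \<Sum>k<l. (c1 m1 k)\<^sup>2) - real M1 * real l \<le> real M1 * (real l * \<theta>)"
        by (rule mult_left_le_imp_le) (use M in simp)
      then have s: "(\<Sum>m1<M1. \<Sum>k<l. (c1 m1 k)\<^sup>2) \<le> real M1 * real l * (1 + \<theta>)"
        by (simp add: algebra_simps)
      have "(\<Sum>t<n. \<Sum>m1<M1. (enc1 c t m1)\<^sup>2) = (\<Sum>m1<M1. \<Sum>t<n. (sent1 l (c1 m1) t)\<^sup>2)"
        by (subst sum.swap) (simp add: c_def)
      also have "\<dots> = (\<Sum>i<\<eta>. (a1 i)\<^sup>2) * (\<Sum>m1<M1. \<Sum>k<l. (c1 m1 k)\<^sup>2)"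
        by (simp add: sum_sent1_square[OF n] sum_distrib_left)
      also have "\<dots> \<le> (\<Sum>i<\<eta>. (a1 i)\<^sup>2) * (real M1 * real l * (1 + \<theta>))"
        by (intro mult_left_mono s sum_nonneg) auto
      also have "\<dots> = real M1 * real l * ((1 + \<theta>) * (\<Sum>i<\<eta>. (a1 i)\<^sup>2))" by (simp add: mult_ac)
      also have "\<dots> \<le> real M1 * real l * (real \<eta> * P1)" by (intro mult_left_mono power1) auto
      also have "\<dots> = (real l * real \<eta>) * (real M1 * P1)" by (simp add: mult_ac)
      \<comment> \<open>The silent channel uses after the last block only relax the
        constraint.\<close>
      also have "\<dots> \<le> real n * (real M1 * P1)" using P1 by (intro mult_right_mono ln) auto
      finally show ?thesis by (simp add: mult_ac)
    qed
    have pw2: "(\<Sum>t<n. \<Sum>m1<M1. \<Sum>m2<M2. \<integral>\<^sup>+\<omega>. ennreal ((x2 c m1 m2 (fst \<omega>) (snd \<omega>) t)\<^sup>2) \<partial>?W)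
      \<le> ennreal (real n * real M1 * real M2 * P2)"
    proof -
      have np: "0 \<le> noise_power" using N s2 by (simp add: noise_power_def sum_nonneg)
      have q0: "0 \<le> quad x y" for x y by (simp add: quad_def sum_nonneg)
      have "(\<Sum>t<n. \<Sum>m1<M1. \<Sum>m2<M2. \<integral>\<^sup>+\<omega>. ennreal ((x2 c m1 m2 (fst \<omega>) (snd \<omega>) t)\<^sup>2) \<partial>?W)
          = (\<Sum>m1<M1. \<Sum>m2<M2. \<Sum>t<n. \<integral>\<^sup>+\<omega>. ennreal ((sent2 l ((c1 m1, c2 m2), \<omega>) t)\<^sup>2) \<partial>?W)"
      proof -
        have "(\<Sum>t<n. \<Sum>m1<M1. \<Sum>m2<M2. f t m1 m2) = (\<Sum>m1<M1. \<Sum>m2<M2. \<Sum>t<n. f t m1 m2)"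
          for f :: "nat \<Rightarrow> nat \<Rightarrow> nat \<Rightarrow> ennreal"
          by (subst sum.swap) (rule sum.cong[OF refl], rule sum.swap)
        then show ?thesis by (simp add: c_def x2_fb_code)
      qed
      also have "\<dots> = (\<Sum>m1<M1. \<Sum>m2<M2. ennreal ((\<Sum>k<l. quad (c1 m1 k) (c2 m2 k)) + real l * noise_power))"
        by (simp add: sum_sent2_square[OF n])
      also have "\<dots> = ennreal (\<Sum>m1<M1. \<Sum>m2<M2. (\<Sum>k<l. quad (c1 m1 k) (c2 m2 k)) + real l * noise_power)"
        using np q0 by (simp add: sum_ennreal sum_nonneg add_nonneg_nonneg del: ennreal_plus)
      also have "\<dots> \<le> ennreal (real n * real M1 * real M2 * P2)"
      proof (rule ennreal_leI)
        have "(\<Sum>m1<M1. \<Sum>m2<M2. (\<Sum>k<l. quad (c1 m1 k) (c2 m2 k)) + real l * noise_power)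
            = (\<Sum>q\<in>I. dev2 l (w q)) + real (card I) * (real l * (E2 + noise_power))"
          unfolding sumI by (simp add: w_def dev2_def sum_subtractf sum.distrib algebra_simps)
        also have "\<dots> \<le> real (card I) * (real l * \<theta> * E2) + real (card I) * (real l * (E2 + noise_power))"
          using dev2_le by simp
        also have "\<dots> = real (card I) * real l * ((1 + \<theta>) * E2 + noise_power)" by (simp add: algebra_simps)
        also have "\<dots> \<le> real (card I) * real l * (real \<eta> * P2)"
          using power2 by (intro mult_left_mono) (auto simp: E2_def noise_power_def)
        also have "\<dots> = (real l * real \<eta>) * (real (card I) * P2)" by (simp add: mult_ac)
        also have "\<dots> \<le> real n * (real (card I) * P2)" using P2 by (intro mult_right_mono ln) auto
        finally show "(\<Sum>m1<M1. \<Sum>m2<M2. (\<Sum>k<l. quad (c1 m1 k) (c2 m2 k)) + real l * noise_power)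
            \<le> real n * real M1 * real M2 * P2" by (simp add: cardI mult_ac)
      qed
      finally show ?thesis .
    qed
    have word: "(c1 m1, c2 m2) \<in> space (word_space l \<Otimes>\<^sub>M word_space l)" if "m1 < M1" "m2 < M2" for m1 m2
      using c1 c2 that by (simp add: space_pair_measure)
    have pairm: "(\<lambda>\<omega>. ((c1 m1, c2 m2), \<omega>)) \<in> ?W \<rightarrow>\<^sub>M joint_space N s2 l n" if "m1 < M1" "m2 < M2" for m1 m2
      unfolding joint_space_def by (rule measurable_Pair1'[OF word[OF that]])
    have decm: "decoded c n m1 m2 \<in> ?W \<rightarrow>\<^sub>M count_space UNIV" if "m1 < M1" "m2 < M2" for m1 m2
      unfolding dec
      by (rule measurable_compose[OF measurable_compose[OF pairm[OF that] received_measurable[OF n, folded out_space_def]]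
            decoder_measurable[OF n c1 c2]]) auto
    have x2m: "(\<lambda>\<omega>. x2 c m1 m2 (fst \<omega>) (snd \<omega>) t) \<in> borel_measurable ?W" if "m1 < M1" "m2 < M2" for m1 m2 t
      using measurable_compose[OF pairm[OF that] sent2_measurable[OF n, of t]] by (simp add: c_def x2_fb_code)
    have "valid_code P1 P2 N s2 n c"
      unfolding valid_code_def using M pw1 pw2 decm x2m by (simp add: c_def)
    moreover have "err_prob N s2 n c \<le> d"
    proof -
      have "measure ?W {\<omega> \<in> space ?W. decoded c n m1 m2 \<omega> \<noteq> (m1, m2)} \<le> measure ?W (failure M1 M2 c1 c2 m1 m2)"
        if m: "m1 < M1" "m2 < M2" for m1 m2
      proof (rule W.finite_measure_mono)
        \<comment> \<open>If the true pair is accepted and no other is, the search returns it; every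
          decoding error is therefore a failure.\<close>
        show "{\<omega> \<in> space ?W. decoded c n m1 m2 \<omega> \<noteq> (m1, m2)} \<subseteq> failure M1 M2 c1 c2 m1 m2"
        proof
          fix \<omega> assume w: "\<omega> \<in> {\<omega> \<in> space ?W. decoded c n m1 m2 \<omega> \<noteq> (m1, m2)}"
          then show "\<omega> \<in> failure M1 M2 c1 c2 m1 m2"
            using decoder_correct[OF m, of c1 c2 "received l n ((c1 m1, c2 m2), \<omega>)" l n]
            unfolding failure_def dec by auto
        qed
        have [measurable]: "c1 k \<in> space (word_space l)" if "k < M1" for k using c1 that by simp
        have [measurable]: "c2 k \<in> space (word_space l)" if "k < M2" for k using c2 that by simp
        show "failure M1 M2 c1 c2 m1 m2 \<in> sets ?W"
          unfolding failure_def using m by measurable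
      qed
      then have "(\<Sum>m1<M1. \<Sum>m2<M2. measure ?W {\<omega> \<in> space ?W. decoded c n m1 m2 \<omega> \<noteq> (m1, m2)})
          \<le> (\<Sum>m1<M1. \<Sum>m2<M2. measure ?W (failure M1 M2 c1 c2 m1 m2))"
        by (intro sum_mono) auto
      also note errI
      finally show ?thesis
        using M unfolding err_prob_def by (simp add: c_def divide_le_eq mult_ac)
    qed
    ultimately show "\<exists>c. msz1 c = M1 \<and> msz2 c = M2 \<and> valid_code P1 P2 N s2 n c \<and> err_prob N s2 n c \<le> d"
      by (intro exI[of _ c]) (simp add: c_def)
  qed
qed

end

section \<open>Achievability of the region\<close>

lemma exp_rate_tendsto_0:
  fixes r K :: real
  assumes eta: "0 < \<eta>" and lt: "real \<eta> * r < K"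
  shows "(\<lambda>n. exp (real n * r - real (n div \<eta>) * K)) \<longlonglongrightarrow> 0"
proof -
  \<comment> \<open>Rounding n / \<eta> down loses at most one block and costs a constant factor exp
    |K|; \<open>a\<close> is the exponent that remains per channel use.\<close>
  define a where "a = K / real \<eta> - r"
  have a: "0 < a" using eta lt by (simp add: a_def field_simps)
  have le: "exp (real n * r - real (n div \<eta>) * K) \<le> exp \<bar>K\<bar> * exp (- a) ^ n" for n
  proof -
    have upper: "real (n div \<eta>) \<le> real n / real \<eta>" by (rule of_nat_div_le_of_nat)
    have "real n = real \<eta> * real (n div \<eta>) + real (n mod \<eta>)"
      by (metis mult_div_mod_eq of_nat_add of_nat_mult)
    moreover have "real (n mod \<eta>) \<le> real \<eta>" using eta by (simp add: less_imp_le)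
    ultimately have "real n \<le> real \<eta> * (real (n div \<eta>) + 1)" by (simp add: distrib_left)
    then have low: "real n / real \<eta> - 1 \<le> real (n div \<eta>)" using eta by (simp add: field_simps)
    have "real n / real \<eta> * K - real (n div \<eta>) * K \<le> \<bar>K\<bar>"
    proof -
      have "real n / real \<eta> * K - real (n div \<eta>) * K = (real n / real \<eta> - real (n div \<eta>)) * K"
        by (simp add: left_diff_distrib)
      also have "\<dots> \<le> (real n / real \<eta> - real (n div \<eta>)) * \<bar>K\<bar>"
        using upper by (intro mult_left_mono) auto
      also have "\<dots> \<le> 1 * \<bar>K\<bar>" using low by (intro mult_right_mono) auto
      finally show ?thesis by simp
    qed
    then have "real n * r - real (n div \<eta>) * K \<le> \<bar>K\<bar> + real n * (- a)"
      by (simp add: a_def algebra_simps)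
    then have "exp (real n * r - real (n div \<eta>) * K) \<le> exp (\<bar>K\<bar> + real n * (- a))" by simp
    then show ?thesis by (simp only: exp_add exp_of_nat_mult)
  qed
  have "(\<lambda>n. exp \<bar>K\<bar> * exp (- a) ^ n) \<longlonglongrightarrow> exp \<bar>K\<bar> * 0"
    using a by (intro tendsto_mult tendsto_const LIMSEQ_power_zero) auto
  then have lim: "(\<lambda>n. exp \<bar>K\<bar> * exp (- a) ^ n) \<longlonglongrightarrow> 0" by simp
  show ?thesis
  proof (rule tendsto_sandwich[OF _ _ tendsto_const lim])
    show "\<forall>\<^sub>F n in sequentially. exp (real n * r - real (n div \<eta>) * K) \<le> exp \<bar>K\<bar> * exp (- a) ^ n"
      using le by (rule always_eventually[OF allI])
  qed simp
qed

text \<open>Because of the added 1 the number of wrong words, one less than the size, is at most exp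
  (n r), while the size itself is at least exp (n r). It also keeps the codebook nonempty when
  \<open>r\<close> is negative.\<close>

definition codebook_size :: "nat \<Rightarrow> real \<Rightarrow> nat" where
  "codebook_size n r = nat \<lfloor>exp (real n * r)\<rfloor> + 1"

lemma codebook_size:
  shows "1 \<le> codebook_size n r" "real (codebook_size n r - 1) \<le> exp (real n * r)"
    and "real n * r \<le> ln (real (codebook_size n r))"
proof -
  show "1 \<le> codebook_size n r" "real (codebook_size n r - 1) \<le> exp (real n * r)"
    by (simp_all add: codebook_size_def)
  have "exp (real n * r) \<le> real (codebook_size n r)"
    unfolding codebook_size_def by (simp, linarith)
  then show "real n * r \<le> ln (real (codebook_size n r))"
    using \<open>1 \<le> codebook_size n r\<close> by (subst ln_ge_iff) simp_all
qed

lemma (in fb_coding) reliable_codes: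
  assumes r1: "real \<eta> * r1 < I1 - \<epsilon>" and r2: "real \<eta> * r2 < I2 - \<epsilon>" and r12: "real \<eta> * (r1 + r2) < I1 + I3 - \<epsilon>"
  obtains cs where "\<forall>\<^sub>F n in sequentially. valid_code P1 P2 N s2 n (cs n) \<and>
      r1 \<le> ln (real (msz1 (cs n))) / real n \<and> r2 \<le> ln (real (msz2 (cs n))) / real n"
    "(\<lambda>n. err_prob N s2 n (cs n)) \<longlonglongrightarrow> 0"
proof -
  obtain V where V: "0 \<le> V" "\<And>l n M1 M2 d. 0 < l \<Longrightarrow> l * \<eta> \<le> n \<Longrightarrow> 1 \<le> M1 \<Longrightarrow> 1 \<le> M2 \<Longrightarrow>
    V / real l + real (M1 - 1) * exp (- (real l * (I1 - \<epsilon>))) + real (M2 - 1) * exp (- (real l * (I2 - \<epsilon>)))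
      + real (M1 - 1) * real (M2 - 1) * exp (- (real l * (I1 + I3 - \<epsilon>))) < d \<Longrightarrow> d < 1 \<Longrightarrow>
    \<exists>c. msz1 c = M1 \<and> msz2 c = M2 \<and> valid_code P1 P2 N s2 n c \<and> err_prob N s2 n c \<le> d"
    using code_exists by blast
  \<comment> \<open>The last summand makes the bound strict, as the existence of codes requires, and
    tends to 0.\<close>
  define d where "d n = V / real (n div \<eta>) + exp (real n * r1 - real (n div \<eta>) * (I1 - \<epsilon>))
      + exp (real n * r2 - real (n div \<eta>) * (I2 - \<epsilon>)) + exp (real n * (r1 + r2) - real (n div \<eta>) * (I1 + I3 - \<epsilon>))
      + inverse (real (Suc n))" for n
  have "filterlim (\<lambda>n. real (n div \<eta>)) at_top sequentially"
    using eta by (intro filterlim_compose[OF filterlim_real_sequentially] filterlim_at_top_div_const_nat)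
  then have "(\<lambda>n. V / real (n div \<eta>)) \<longlonglongrightarrow> 0"
    by (intro tendsto_divide_0[OF tendsto_const] filterlim_at_top_imp_at_infinity)
  then have "d \<longlonglongrightarrow> 0 + 0 + 0 + 0 + 0"
    unfolding d_def using eta r1 r2 r12
    by (intro tendsto_add exp_rate_tendsto_0 LIMSEQ_inverse_real_of_nat)
  then have d0: "d \<longlonglongrightarrow> 0" by simp
  define good where "good n c \<longleftrightarrow> msz1 c = codebook_size n r1 \<and> msz2 c = codebook_size n r2 \<and>
    valid_code P1 P2 N s2 n c \<and> err_prob N s2 n c \<le> d n" for n c
  \<comment> \<open>Where no good code exists the choice is arbitrary; this happens for finitely
    many \<open>n\<close> only.\<close>
  define cs where "cs n = (SOME c. good n c)" for n
  have ev: "\<forall>\<^sub>F n in sequentially. good n (cs n) \<and> 0 < n"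
    using order_tendstoD(2)[OF d0, of 1, simplified] eventually_ge_at_top[of \<eta>]
  proof eventually_elim
    fix n assume d1: "d n < 1" and n: "\<eta> \<le> n"
    let ?l = "n div \<eta>" and ?M1 = "codebook_size n r1" and ?M2 = "codebook_size n r2"
    have l: "0 < ?l" using n eta by (simp add: div_greater_zero_iff)
    have e: "real (codebook_size n r - 1) * exp (- (real ?l * K)) \<le> exp (real n * r - real ?l * K)" for r K
      using mult_right_mono[OF codebook_size(2), of "exp (- (real ?l * K))" n r] by (simp add: exp_add[symmetric])
    have e12: "real (?M1 - 1) * real (?M2 - 1) * exp (- (real ?l * K)) \<le> exp (real n * (r1 + r2) - real ?l * K)" for K
    proof -
      have "real (?M1 - 1) * real (?M2 - 1) * exp (- (real ?l * K)) \<le> exp (real n * r1) * exp (real n * r2) * exp (- (real ?l * K))"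
        by (intro mult_right_mono mult_mono codebook_size(2)) auto
      then show ?thesis by (simp add: exp_add[symmetric] distrib_left)
    qed
    have "V / real ?l + real (?M1 - 1) * exp (- (real ?l * (I1 - \<epsilon>))) + real (?M2 - 1) * exp (- (real ?l * (I2 - \<epsilon>)))
      + real (?M1 - 1) * real (?M2 - 1) * exp (- (real ?l * (I1 + I3 - \<epsilon>))) < d n"
      using e[of r1 "I1 - \<epsilon>"] e[of r2 "I2 - \<epsilon>"] e12[of "I1 + I3 - \<epsilon>"] unfolding d_def
      by (smt (verit) inverse_positive_iff_positive of_nat_0_less_iff zero_less_Suc)
    then have "\<exists>c. good n c"
      unfolding good_def using l d1 codebook_size(1) by (intro V(2)[of ?l]) (auto simp: div_times_less_eq_dividend)
    then have "good n (cs n)" unfolding cs_def by (rule someI_ex)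
    then show "good n (cs n) \<and> 0 < n" using n eta by simp
  qed
  show ?thesis
  proof (rule that[of cs])
    show "\<forall>\<^sub>F n in sequentially. valid_code P1 P2 N s2 n (cs n) \<and>
      r1 \<le> ln (real (msz1 (cs n))) / real n \<and> r2 \<le> ln (real (msz2 (cs n))) / real n"
      using ev
    proof eventually_elim
      fix n assume g: "good n (cs n) \<and> 0 < n"
      then show "valid_code P1 P2 N s2 n (cs n) \<and>
        r1 \<le> ln (real (msz1 (cs n))) / real n \<and> r2 \<le> ln (real (msz2 (cs n))) / real n"
        using codebook_size(3)[of n r1] codebook_size(3)[of n r2]
        by (auto simp: good_def le_divide_eq mult.commute)
    qed
    show "(\<lambda>n. err_prob N s2 n (cs n)) \<longlonglongrightarrow> 0"
    proof (rule tendsto_sandwich[OF _ _ tendsto_const d0])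
      show "\<forall>\<^sub>F n in sequentially. 0 \<le> err_prob N s2 n (cs n)"
        by (intro always_eventually allI) (auto simp: err_prob_def intro!: divide_nonneg_nonneg sum_nonneg)
      show "\<forall>\<^sub>F n in sequentially. err_prob N s2 n (cs n) \<le> d n"
        using ev by eventually_elim (simp add: good_def)
    qed
  qed
qed

text \<open>After conjugation each summand is a multiple of a Gram matrix, so the trace is a
  weighted sum of squared entries of G a2, G B a1 and G B. These are the transfer coefficients of
  the scheme, and the trace is its energy per block.\<close>

lemma trace_feedback_power:
  assumes G: "G \<in> carrier_mat \<eta> \<eta>" and B: "B \<in> carrier_mat \<eta> \<eta>"
    and a1: "a1 \<in> carrier_vec \<eta>" and a2: "a2 \<in> carrier_vec \<eta>"
  shows "trace_mat (G * (outer_mat a2 + B * outer_mat a1 * transpose_mat B + c \<cdot>\<^sub>m (B * transpose_mat B)) * transpose_mat G)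
    = (\<Sum>i<\<eta>. (\<Sum>j<\<eta>. G $$ (i, j) * a2 $ j)\<^sup>2) + (\<Sum>i<\<eta>. (\<Sum>j<\<eta>. G $$ (i, j) * (\<Sum>l<\<eta>. B $$ (j, l) * a1 $ l))\<^sup>2)
      + c * (\<Sum>i<\<eta>. \<Sum>l<\<eta>. (\<Sum>j<\<eta>. G $$ (i, j) * B $$ (j, l))\<^sup>2)"
proof -
  have oc: "outer_mat v \<in> carrier_mat \<eta> \<eta>" if "v \<in> carrier_vec \<eta>" for v
    using that by (simp add: outer_mat_def)
  have v1: "B *\<^sub>v a1 \<in> carrier_vec \<eta>" using B a1 by simp
  have BB: "B * transpose_mat B \<in> carrier_mat \<eta> \<eta>" and GB: "G * B \<in> carrier_mat \<eta> \<eta>" using B G by auto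
  have Gt: "transpose_mat G \<in> carrier_mat \<eta> \<eta>" and Bt: "transpose_mat B \<in> carrier_mat \<eta> \<eta>"
    using G B by simp_all
  let ?O2 = "outer_mat a2" and ?O1 = "outer_mat (B *\<^sub>v a1)" and ?C = "c \<cdot>\<^sub>m (B * transpose_mat B)"
  have C: "?C \<in> carrier_mat \<eta> \<eta>" using BB by simp
  note O2 = oc[OF a2] and O1 = oc[OF v1]
  have O12: "?O2 + ?O1 \<in> carrier_mat \<eta> \<eta>" using O1 by simp
  note GO1 = mult_carrier_mat[OF G O1] and GO2 = mult_carrier_mat[OF G O2] and GC = mult_carrier_mat[OF G C]
  have "G * (?O2 + ?O1 + ?C) = G * ?O2 + G * ?O1 + G * ?C"
    by (simp only: mult_add_distrib_mat[OF G O12 C] mult_add_distrib_mat[OF G O2 O1])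
  moreover have "(G * ?O2 + G * ?O1 + G * ?C) * transpose_mat G
      = G * ?O2 * transpose_mat G + G * ?O1 * transpose_mat G + G * ?C * transpose_mat G"
    by (simp only: add_mult_distrib_mat[OF add_carrier_mat[OF GO1] GC Gt] add_mult_distrib_mat[OF GO2 GO1 Gt])
  moreover have "G * ?C * transpose_mat G = c \<cdot>\<^sub>m (G * B * transpose_mat (G * B))"
  proof -
    have "G * ?C = c \<cdot>\<^sub>m (G * (B * transpose_mat B))" by (rule mult_smult_distrib[OF G BB])
    also have "\<dots> * transpose_mat G = c \<cdot>\<^sub>m (G * (B * transpose_mat B) * transpose_mat G)"
      using G BB by (intro mult_smult_assoc_mat[of _ \<eta> \<eta> _ \<eta>]) auto
    also have "G * (B * transpose_mat B) * transpose_mat G = G * B * transpose_mat (G * B)"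
      unfolding transpose_mult[OF G B]
      by (simp only: assoc_mult_mat[OF G BB Gt] assoc_mult_mat[OF B Bt Gt]
          assoc_mult_mat[OF G B mult_carrier_mat[OF Bt Gt]])
    finally show ?thesis .
  qed
  ultimately have eq: "G * (?O2 + B * outer_mat a1 * transpose_mat B + ?C) * transpose_mat G
      = outer_mat (G *\<^sub>v a2) + outer_mat (G *\<^sub>v (B *\<^sub>v a1)) + c \<cdot>\<^sub>m (G * B * transpose_mat (G * B))"
    unfolding conjugate_outer_mat[OF B a1] by (simp only: conjugate_outer_mat[OF G a2] conjugate_outer_mat[OF G v1])
  have ent: "(outer_mat (G *\<^sub>v a2) + outer_mat (G *\<^sub>v (B *\<^sub>v a1)) + c \<cdot>\<^sub>m (G * B * transpose_mat (G * B))) $$ (i, i)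
      = ((G *\<^sub>v a2) $ i)\<^sup>2 + ((G *\<^sub>v (B *\<^sub>v a1)) $ i)\<^sup>2 + c * (\<Sum>l<\<eta>. ((G * B) $$ (i, l))\<^sup>2)" if i: "i < \<eta>" for i
  proof -
    have o: "outer_mat v $$ (i, i) = (v $ i)\<^sup>2" "outer_mat v \<in> carrier_mat \<eta> \<eta>" if "v \<in> carrier_vec \<eta>" for v
      using that i by (simp_all add: outer_mat_def power2_eq_square)
    have h: "(H * transpose_mat H) $$ (i, i) = (\<Sum>l<\<eta>. (H $$ (i, l))\<^sup>2)" "H * transpose_mat H \<in> carrier_mat \<eta> \<eta>"
      if "H \<in> carrier_mat \<eta> \<eta>" for H :: "real mat"
      using that i by (simp_all add: scalar_prod_def atLeast0LessThan power2_eq_square)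
    have v: "G *\<^sub>v a2 \<in> carrier_vec \<eta>" "G *\<^sub>v (B *\<^sub>v a1) \<in> carrier_vec \<eta>" using G B a1 a2 by auto
    have "(X + Y + c \<cdot>\<^sub>m Z) $$ (i, i) = X $$ (i, i) + Y $$ (i, i) + c * Z $$ (i, i)"
      if "X \<in> carrier_mat \<eta> \<eta>" "Y \<in> carrier_mat \<eta> \<eta>" "Z \<in> carrier_mat \<eta> \<eta>" for X Y Z :: "real mat"
      using that i by simp
    from this[OF o(2)[OF v(1)] o(2)[OF v(2)] h(2)[OF GB]] show ?thesis
      by (simp only: o(1)[OF v(1)] o(1)[OF v(2)] h(1)[OF GB])
  qed
  have "trace_mat (G * (?O2 + B * outer_mat a1 * transpose_mat B + ?C) * transpose_mat G)
      = (\<Sum>i<\<eta>. ((G *\<^sub>v a2) $ i)\<^sup>2 + ((G *\<^sub>v (B *\<^sub>v a1)) $ i)\<^sup>2 + c * (\<Sum>l<\<eta>. ((G * B) $$ (i, l))\<^sup>2))"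
    unfolding eq trace_mat_def using G by (intro sum.cong ent) (auto simp: outer_mat_def)
  also have "\<dots> = (\<Sum>i<\<eta>. ((G *\<^sub>v a2) $ i)\<^sup>2) + (\<Sum>i<\<eta>. ((G *\<^sub>v (B *\<^sub>v a1)) $ i)\<^sup>2) + c * (\<Sum>i<\<eta>. \<Sum>l<\<eta>. ((G * B) $$ (i, l))\<^sup>2)"
    by (simp add: sum.distrib sum_distrib_left)
  finally show ?thesis
    using G B a1 a2 by (simp add: scalar_prod_def atLeast0LessThan)
qed

lemma scalar_prod_sum: "v \<in> carrier_vec \<eta> \<Longrightarrow> w \<in> carrier_vec \<eta> \<Longrightarrow> v \<bullet> w = (\<Sum>i<\<eta>. v $ i * (w $ i :: real))"
  by (simp add: scalar_prod_def atLeast0LessThan)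

text \<open>Scaling the signal powers by \<tau> < 1 creates the power margin and lowers the rates.
  The three logarithms are continuous at \<tau> = 1, so the loss stays within the tolerance
  \<open>\<delta>\<close>.\<close>

lemma pent_achievable:
  assumes P1: "P1 > 0" and P2: "P2 > 0" and N: "N > 0" and s2: "s2 \<ge> 0" and eta: "0 < \<eta>"
    and a1: "a1 \<in> carrier_vec \<eta>" and a2: "a2 \<in> carrier_vec \<eta>" and low: "strictly_lower \<eta> B"
    and pw: "power_ok P1 P2 N s2 \<eta> a1 a2 B"
    and D: "D \<in> carrier_mat k \<eta>" "k = 1 \<or> k = 2" "det (D * transpose_mat D) \<noteq> 0"
    and R: "R \<in> pent N s2 \<eta> a1 a2 B D"
  shows "achievable P1 P2 N s2 R"
  unfolding achievable_def
proof (intro allI impI)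
  fix \<delta> :: real assume \<delta>: "0 < \<delta>"
  have B: "B \<in> carrier_mat \<eta> \<eta>" using low by (simp add: strictly_lower_def)
  define G where "G = inv_mat (1\<^sub>m \<eta> - B)"
  have G: "G \<in> carrier_mat \<eta> \<eta>" unfolding G_def by (rule strictly_lower_inverse(1)[OF low])
  obtain v1 v2 :: "real vec" and c11 c12 c22 :: real where v: "v1 \<in> carrier_vec \<eta>" "v2 \<in> carrier_vec \<eta>"
    and ga: "v1 \<bullet> a1 = c11" "v1 \<bullet> a2 = c12" "v2 \<bullet> a1 = c12" "v2 \<bullet> a2 = c22"
    and cv: "v1 \<bullet> (QP N s2 \<eta> B *\<^sub>v v1) = c11" "v1 \<bullet> (QP N s2 \<eta> B *\<^sub>v v2) = c12" "v2 \<bullet> (QP N s2 \<eta> B *\<^sub>v v2) = c22"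
    and rb: "rate_bound \<eta> D (outer_mat a1) (QP N s2 \<eta> B) = ln (1 + c11) / (2 * real \<eta>)"
    "rate_bound \<eta> D (outer_mat a2) (QP N s2 \<eta> B) = ln (1 + c22) / (2 * real \<eta>)"
    "rate_bound \<eta> D (outer_mat a1 + outer_mat a2) (QP N s2 \<eta> B) = ln ((1 + c11) * (1 + c22) - c12\<^sup>2) / (2 * real \<eta>)"
    by (rule matched_filters[OF B D(1,2) N s2 D(3) a1 a2])
  define fB where "fB i j = B $$ (i, j)" for i j
  define fG where "fG i j = G $$ (i, j)" for i j
  have QPsum: "x \<bullet> (QP N s2 \<eta> B *\<^sub>v y) = N * (\<Sum>j<\<eta>. x $ j * y $ j)
      + s2 * (\<Sum>i<\<eta>. (\<Sum>j<\<eta>. x $ j * fB j i) * (\<Sum>j<\<eta>. y $ j * fB j i))"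
    if x: "x \<in> carrier_vec \<eta>" and y: "y \<in> carrier_vec \<eta>" for x y
  proof -
    have Bx: "(transpose_mat B *\<^sub>v x) $ i = (\<Sum>j<\<eta>. x $ j * fB j i)" if "x \<in> carrier_vec \<eta>" "i < \<eta>" for x i
      using B that by (simp add: scalar_prod_def atLeast0LessThan fB_def mult.commute)
    have c: "transpose_mat B *\<^sub>v x \<in> carrier_vec \<eta>" if "x \<in> carrier_vec \<eta>" for x using B that by simp
    show ?thesis
      unfolding scalar_prod_QP[OF B x y] scalar_prod_sum[OF x y] scalar_prod_sum[OF c[OF x] c[OF y]]
      by (simp add: Bx[OF x] Bx[OF y])
  qed
  define cY :: "real vec \<Rightarrow> coeffs" where "cY x = (0, 0, \<lambda>j. x $ j, \<lambda>i. \<Sum>j<\<eta>. x $ j * fB j i)" for x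
  have covY: "lform_cov N s2 \<eta> (cY v1) (cY v1) = c11" "lform_cov N s2 \<eta> (cY v1) (cY v2) = c12" "lform_cov N s2 \<eta> (cY v2) (cY v2) = c22"
    using cv v by (simp_all add: cY_def QPsum)
  have c_nn: "0 \<le> c11" "0 \<le> c22"
    using lform_cov_nonneg[of N s2 \<eta> "cY v1"] lform_cov_nonneg[of N s2 \<eta> "cY v2"] N s2 covY by auto
  \<comment> \<open>Continuity of the sum rate logarithm needs a positive argument. It follows from
    the nonnegative variance of Y2 - t Y1, where Y1 and Y2 are the filtered noises and t = c12 / (1
    + c11).\<close>
  have disc: "0 < (1 + c11) * (1 + c22) - c12\<^sup>2"
  proof -
    define t where "t = c12 / (1 + c11)"
    have t: "t * (1 + c11) = c12" using c_nn by (simp add: t_def)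
    have "0 \<le> lform_cov N s2 \<eta> (lcomb (- t) (cY v1) 1 (cY v2)) (lcomb (- t) (cY v1) 1 (cY v2))"
      using N s2 by (intro lform_cov_nonneg) auto
    also have "\<dots> = t * (t * c11) - 2 * t * c12 + c22"
      using covY lform_cov_commute[of N s2 \<eta> "cY v2" "cY v1"]
      by (simp add: lform_cov_lcomb lform_cov_commute[of _ _ _ "lcomb _ _ _ _"] algebra_simps)
    also have "t * (t * c11) = t * (c12 - t)" proof -
      have "t * c11 = c12 - t" using t by (simp add: algebra_simps)
      then show ?thesis by simp
    qed
    finally have "0 \<le> c22 - t * c12 - t * t" by (simp add: algebra_simps)
    then have "0 < 1 + c22 - t * c12" using zero_le_square[of t] by linarith
    then have "0 < (1 + c11) * (1 + c22 - t * c12)" using c_nn by simp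
    also have "\<dots> = (1 + c11) * (1 + c22) - (t * (1 + c11)) * c12" by (simp add: algebra_simps)
    finally show ?thesis unfolding t by (simp add: power2_eq_square)
  qed
  \<comment> \<open>Lowering a rate by \<delta> / 2 frees \<eta> \<delta> / 2 = 4 \<gamma> per
    block; the scaling and the decoding margin use less than \<gamma> and exactly \<gamma>.\<close>
  define \<gamma> where "\<gamma> = real \<eta> * \<delta> / 8"
  have \<gamma>: "0 < \<gamma>" using eta \<delta> by (simp add: \<gamma>_def)
  have "((\<lambda>\<tau>. ln (1 + \<tau> * c11) / 2) \<longlongrightarrow> ln (1 + 1 * c11) / 2) (at_left 1)"
    using c_nn by (intro tendsto_intros) auto
  then have ev1: "\<forall>\<^sub>F \<tau> in at_left 1. ln (1 + c11) / 2 - \<gamma> < ln (1 + \<tau> * c11) / 2"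
    using \<gamma> by (intro order_tendstoD(1)) auto
  have "((\<lambda>\<tau>. ln (1 + \<tau> * c22) / 2) \<longlongrightarrow> ln (1 + 1 * c22) / 2) (at_left 1)"
    using c_nn by (intro tendsto_intros) auto
  then have ev2: "\<forall>\<^sub>F \<tau> in at_left 1. ln (1 + c22) / 2 - \<gamma> < ln (1 + \<tau> * c22) / 2"
    using \<gamma> by (intro order_tendstoD(1)) auto
  have "((\<lambda>\<tau>. ln ((1 + \<tau> * c11) * (1 + \<tau> * c22) - (\<tau> * c12)\<^sup>2) / 2)
      \<longlongrightarrow> ln ((1 + 1 * c11) * (1 + 1 * c22) - (1 * c12)\<^sup>2) / 2) (at_left 1)"
    using disc by (intro tendsto_intros) auto
  then have ev3: "\<forall>\<^sub>F \<tau> in at_left 1. ln ((1 + c11) * (1 + c22) - c12\<^sup>2) / 2 - \<gamma>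
      < ln ((1 + \<tau> * c11) * (1 + \<tau> * c22) - (\<tau> * c12)\<^sup>2) / 2"
    using \<gamma> by (intro order_tendstoD(1)) auto
  have "\<forall>\<^sub>F \<tau>::real in at_left 1. \<tau> \<in> {0<..<1}"
    by (rule eventually_at_leftI[of 0]) auto
  with ev1 ev2 ev3 have "\<forall>\<^sub>F \<tau> in at_left 1. \<tau> \<in> {0<..<1} \<and> ln (1 + c11) / 2 - \<gamma> < ln (1 + \<tau> * c11) / 2
      \<and> ln (1 + c22) / 2 - \<gamma> < ln (1 + \<tau> * c22) / 2
      \<and> ln ((1 + c11) * (1 + c22) - c12\<^sup>2) / 2 - \<gamma> < ln ((1 + \<tau> * c11) * (1 + \<tau> * c22) - (\<tau> * c12)\<^sup>2) / 2"
    by eventually_elim auto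
  then obtain \<tau> where \<tau>: "0 < \<tau>" "\<tau> < 1" and t1: "ln (1 + c11) / 2 - \<gamma> < ln (1 + \<tau> * c11) / 2"
    and t2: "ln (1 + c22) / 2 - \<gamma> < ln (1 + \<tau> * c22) / 2"
    and t3: "ln ((1 + c11) * (1 + c22) - c12\<^sup>2) / 2 - \<gamma> < ln ((1 + \<tau> * c11) * (1 + \<tau> * c22) - (\<tau> * c12)\<^sup>2) / 2"
    using eventually_happens' [of "at_left (1::real)"] by force
  define s where "s = sqrt \<tau>"
  have s: "s * s = \<tau>" using \<tau> by (simp add: s_def)
  \<comment> \<open>The filters are scaled along with the signals, so gains and noise covariances
    are both multiplied by \<tau> and remain equal.\<close>
  define f1 f2 g1 g2 where "f1 = (\<lambda>i. s * a1 $ i)" and "f2 = (\<lambda>i. s * a2 $ i)"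
    and "g1 = (\<lambda>i. s * v1 $ i)" and "g2 = (\<lambda>i. s * v2 $ i)"
  interpret S: fb_scheme N s2 \<eta> f1 f2 fB fG
  proof
    show "0 < \<eta>" "0 \<le> N" "0 \<le> s2" using eta N s2 by auto
    show "fB i j = 0" if "i \<le> j" "j < \<eta>" for i j using low that by (simp add: fB_def strictly_lower_def)
    show "x i = (\<Sum>j<\<eta>. fG i j * r j)" if "\<And>i. i < \<eta> \<Longrightarrow> x i = r i + (\<Sum>j<\<eta>. fB i j * x j)" "i < \<eta>" for x r i
      using strictly_lower_solve[OF low, of x r i] that by (simp add: fB_def fG_def G_def)
  qed
  have scale: "(\<Sum>j<\<eta>. s * p j * (s * q j)) = \<tau> * (\<Sum>j<\<eta>. p j * q j)" for p q :: "nat \<Rightarrow> real"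
    by (simp add: sum_distrib_left s[symmetric] mult_ac)
  have scale1: "(\<Sum>j<\<eta>. s * p j * q j) = s * (\<Sum>j<\<eta>. p j * q j)" for p q :: "nat \<Rightarrow> real"
    by (simp add: sum_distrib_left mult_ac)
  have tr: "a1 \<bullet> a1 \<le> real \<eta> * P1"
    "(\<Sum>i<\<eta>. (\<Sum>j<\<eta>. G $$ (i, j) * a2 $ j)\<^sup>2) + (\<Sum>i<\<eta>. (\<Sum>j<\<eta>. G $$ (i, j) * (\<Sum>l<\<eta>. B $$ (j, l) * a1 $ l))\<^sup>2)
      + (N + s2) * (\<Sum>i<\<eta>. \<Sum>l<\<eta>. (\<Sum>j<\<eta>. G $$ (i, j) * B $$ (j, l))\<^sup>2) \<le> real \<eta> * P2"
    using pw unfolding power_ok_def Let_def G_def[symmetric] trace_feedback_power[OF G B a1 a2] by auto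
  have gsq: "(S.gain2 i)\<^sup>2 = \<tau> * (\<Sum>j<\<eta>. G $$ (i, j) * a2 $ j)\<^sup>2"
    "(S.gain1 i)\<^sup>2 = \<tau> * (\<Sum>j<\<eta>. G $$ (i, j) * (\<Sum>l<\<eta>. B $$ (j, l) * a1 $ l))\<^sup>2" for i
  proof -
    have "S.gain2 i = s * (\<Sum>j<\<eta>. G $$ (i, j) * a2 $ j)"
      unfolding S.gain2_def unfolding f2_def fG_def by (simp add: sum_distrib_left mult_ac)
    then show "(S.gain2 i)\<^sup>2 = \<tau> * (\<Sum>j<\<eta>. G $$ (i, j) * a2 $ j)\<^sup>2"
      using s by (simp add: power_mult_distrib power2_eq_square[of s])
    have "S.gain1 i = s * (\<Sum>j<\<eta>. G $$ (i, j) * (\<Sum>l<\<eta>. B $$ (j, l) * a1 $ l))"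
      unfolding S.gain1_def unfolding f1_def fG_def fB_def by (simp add: sum_distrib_left mult_ac)
    then show "(S.gain1 i)\<^sup>2 = \<tau> * (\<Sum>j<\<eta>. G $$ (i, j) * (\<Sum>l<\<eta>. B $$ (j, l) * a1 $ l))\<^sup>2"
      using s by (simp add: power_mult_distrib power2_eq_square[of s])
  qed
  \<comment> \<open>The margin \<theta> = 1 / \<tau> - 1 satisfies (1 + \<theta>) \<tau> = 1, which
    leads back to the original power constraints.\<close>
  interpret C: fb_coding N s2 \<eta> f1 f2 fB fG g1 g2 "\<tau> * c11" "\<tau> * c12" "\<tau> * c22" \<gamma> "1 / \<tau> - 1" P1 P2
  proof
    show "(\<Sum>j<\<eta>. g1 j * f1 j) = \<tau> * c11" "(\<Sum>j<\<eta>. g1 j * f2 j) = \<tau> * c12"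
      "(\<Sum>j<\<eta>. g2 j * f1 j) = \<tau> * c12" "(\<Sum>j<\<eta>. g2 j * f2 j) = \<tau> * c22"
      using ga v a1 a2 by (simp_all add: g1_def g2_def f1_def f2_def scale scalar_prod_sum[of _ \<eta>])
    have q: "N * (\<Sum>j<\<eta>. s * x $ j * (s * y $ j)) + s2 * (\<Sum>i<\<eta>. (\<Sum>j<\<eta>. s * x $ j * fB j i) * (\<Sum>j<\<eta>. s * y $ j * fB j i))
        = \<tau> * (x \<bullet> (QP N s2 \<eta> B *\<^sub>v y))" if "x \<in> carrier_vec \<eta>" "y \<in> carrier_vec \<eta>" for x y
      unfolding QPsum[OF that] scale scale1 by (simp add: scale distrib_left mult_ac)
    show "N * (\<Sum>j<\<eta>. g1 j * g1 j) + s2 * (\<Sum>i<\<eta>. (\<Sum>j<\<eta>. g1 j * fB j i) * (\<Sum>j<\<eta>. g1 j * fB j i)) = \<tau> * c11"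
      "N * (\<Sum>j<\<eta>. g1 j * g2 j) + s2 * (\<Sum>i<\<eta>. (\<Sum>j<\<eta>. g1 j * fB j i) * (\<Sum>j<\<eta>. g2 j * fB j i)) = \<tau> * c12"
      "N * (\<Sum>j<\<eta>. g2 j * g2 j) + s2 * (\<Sum>i<\<eta>. (\<Sum>j<\<eta>. g2 j * fB j i) * (\<Sum>j<\<eta>. g2 j * fB j i)) = \<tau> * c22"
      unfolding g1_def g2_def using q v cv by simp_all
    show "0 < \<gamma>" by (rule \<gamma>)
    show "0 < 1 / \<tau> - 1" using \<tau> by simp
    have "(\<Sum>i<\<eta>. (f1 i)\<^sup>2) = \<tau> * (a1 \<bullet> a1)"
      unfolding scalar_prod_sum[OF a1 a1] f1_def power2_eq_square by (rule scale)
    then show "(1 + (1 / \<tau> - 1)) * (\<Sum>i<\<eta>. (f1 i)\<^sup>2) \<le> real \<eta> * P1" using tr(1) \<tau> by simp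
    show "(1 + (1 / \<tau> - 1)) * ((\<Sum>i<\<eta>. (S.gain2 i)\<^sup>2) + (\<Sum>i<\<eta>. (S.gain1 i)\<^sup>2))
      + (N + s2) * (\<Sum>i<\<eta>. \<Sum>j<\<eta>. (S.gainz i j)\<^sup>2) \<le> real \<eta> * P2"
      using tr(2) \<tau> by (simp add: gsq sum_distrib_left[symmetric] distrib_left[symmetric] S.gainz_def fG_def fB_def)
    show "0 \<le> P1" "0 \<le> P2" using P1 P2 by auto
  qed
  obtain R1 R2 where Req: "R = (R1, R2)" by (cases R)
  have Rb: "R1 \<le> ln (1 + c11) / (2 * real \<eta>)" "R2 \<le> ln (1 + c22) / (2 * real \<eta>)"
    "R1 + R2 \<le> ln ((1 + c11) * (1 + c22) - c12\<^sup>2) / (2 * real \<eta>)"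
    using R unfolding Req pent_def Let_def rb by auto
  have \<gamma>8: "real \<eta> * \<delta> = 8 * \<gamma>" by (simp add: \<gamma>_def)
  have q1: "real \<eta> * (R1 - \<delta> / 2) < C.I1 - \<gamma>"
  proof -
    have "real \<eta> * R1 \<le> ln (1 + c11) / 2" using Rb(1) eta by (simp add: field_simps)
    then show ?thesis using t1 \<gamma> \<gamma>8 by (simp add: C.I1_def right_diff_distrib)
  qed
  have q2: "real \<eta> * (R2 - \<delta> / 2) < C.I2 - \<gamma>"
  proof -
    have "real \<eta> * R2 \<le> ln (1 + c22) / 2" using Rb(2) eta by (simp add: field_simps)
    then show ?thesis using t2 \<gamma> \<gamma>8 by (simp add: C.I2_def right_diff_distrib)
  qed
  have I13: "C.I1 + C.I3 = ln ((1 + \<tau> * c11) * (1 + \<tau> * c22) - (\<tau> * c12)\<^sup>2) / 2"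
  proof -
    have "(1 + \<tau> * c11) * (1 + C.c22') = (1 + \<tau> * c11) * (1 + \<tau> * c22) - (C.\<kappa> * (1 + \<tau> * c11)) * (\<tau> * c12)"
      unfolding C.c22'_def by (simp add: algebra_simps)
    also have "\<dots> = (1 + \<tau> * c11) * (1 + \<tau> * c22) - (\<tau> * c12)\<^sup>2"
      unfolding C.kappa_mult by (simp add: power2_eq_square)
    finally have eq: "(1 + \<tau> * c11) * (1 + C.c22') = (1 + \<tau> * c11) * (1 + \<tau> * c22) - (\<tau> * c12)\<^sup>2" .
    show ?thesis
      unfolding eq[symmetric] C.I1_def C.I3_def using C.c_nonneg(1) C.c22'_nonneg
      by (simp add: ln_mult add_divide_distrib)
  qed
  have q12: "real \<eta> * ((R1 - \<delta> / 2) + (R2 - \<delta> / 2)) < C.I1 + C.I3 - \<gamma>"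
  proof -
    have "real \<eta> * (R1 + R2) \<le> ln ((1 + c11) * (1 + c22) - c12\<^sup>2) / 2"
      using mult_left_mono[OF Rb(3), of "real \<eta>"] eta by simp
    then show ?thesis unfolding I13 using t3 \<gamma> \<gamma>8 by (simp add: algebra_simps)
  qed
  obtain cs where cs: "\<forall>\<^sub>F n in sequentially. valid_code P1 P2 N s2 n (cs n) \<and>
      R1 - \<delta> / 2 \<le> ln (real (msz1 (cs n))) / real n \<and> R2 - \<delta> / 2 \<le> ln (real (msz2 (cs n))) / real n"
    and err: "(\<lambda>n. err_prob N s2 n (cs n)) \<longlonglongrightarrow> 0"
    by (rule C.reliable_codes[OF q1 q2 q12])
  have "\<forall>\<^sub>F n in sequentially. valid_code P1 P2 N s2 n (cs n) \<and>
      fst R - \<delta> < ln (real (msz1 (cs n))) / real n \<and> snd R - \<delta> < ln (real (msz2 (cs n))) / real n"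
    using cs by eventually_elim (use \<delta> in \<open>auto simp: Req\<close>)
  with err show "\<exists>cs. (\<forall>\<^sub>F n in sequentially. valid_code P1 P2 N s2 n (cs n) \<and>
            ln (real (msz1 (cs n))) / real n > fst R - \<delta> \<and>
            ln (real (msz2 (cs n))) / real n > snd R - \<delta>) \<and>
        (\<lambda>n. err_prob N s2 n (cs n)) \<longlonglongrightarrow> 0" by blast
qed

section \<open>The origin and limits of achievable pairs\<close>

lemma achievable_zero:
  assumes "0 \<le> P1" "0 \<le> P2" "0 \<le> N" "0 \<le> s2"
  shows "achievable P1 P2 N s2 (0, 0)"
  unfolding achievable_def
proof (intro allI impI)
  fix \<delta> :: real assume \<delta>: "0 < \<delta>"
  define c where "c = \<lparr>msz1 = 1, msz2 = 1, enc1 = (\<lambda>_ _. 0), enc2 = (\<lambda>_ _ _. 0), dec = (\<lambda>_. (0, 0))\<rparr>"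
  have "valid_code P1 P2 N s2 n c" for n
    using assms by (simp add: valid_code_def c_def x2_def decoded_def[abs_def])
  moreover have "err_prob N s2 n c = 0" for n
    by (simp add: err_prob_def c_def decoded_def)
  ultimately show "\<exists>cs. (\<forall>\<^sub>F n in sequentially. valid_code P1 P2 N s2 n (cs n) \<and>
            ln (real (msz1 (cs n))) / real n > fst (0, 0) - \<delta> \<and>
            ln (real (msz2 (cs n))) / real n > snd (0, 0) - \<delta>) \<and>
        (\<lambda>n. err_prob N s2 n (cs n)) \<longlonglongrightarrow> 0"
    using \<delta> by (intro exI[of _ "\<lambda>_. c"]) (simp add: c_def)
qed

text \<open>One half of \<open>\<delta>\<close> pays for the distance to an achievable pair, the
  other half for the rate slack of that pair. Closedness reduces the theorem, whose region is a
  closure, to single choices of the parameters.\<close>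

lemma closed_achievable: "closed {R. achievable P1 P2 N s2 R}"
proof -
  have "achievable P1 P2 N s2 R" if R: "R \<in> closure {R. achievable P1 P2 N s2 R}" for R
    unfolding achievable_def
  proof (intro allI impI)
    fix \<delta> :: real assume \<delta>: "0 < \<delta>"
    then obtain R' where R': "achievable P1 P2 N s2 R'" "dist R' R < \<delta> / 2"
      using R unfolding closure_approachable by (metis half_gt_zero mem_Collect_eq)
    have d: "fst R - fst R' < \<delta> / 2" "snd R - snd R' < \<delta> / 2"
      using dist_fst_le[of R' R] dist_snd_le[of R' R] R'(2) by (auto simp: dist_real_def)
    obtain cs where cs: "\<forall>\<^sub>F n in sequentially. valid_code P1 P2 N s2 n (cs n) \<and>
            ln (real (msz1 (cs n))) / real n > fst R' - \<delta> / 2 \<and>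
            ln (real (msz2 (cs n))) / real n > snd R' - \<delta> / 2"
      and err: "(\<lambda>n. err_prob N s2 n (cs n)) \<longlonglongrightarrow> 0"
      using R'(1) \<delta> unfolding achievable_def by (meson half_gt_zero)
    have "\<forall>\<^sub>F n in sequentially. valid_code P1 P2 N s2 n (cs n) \<and>
            ln (real (msz1 (cs n))) / real n > fst R - \<delta> \<and> ln (real (msz2 (cs n))) / real n > snd R - \<delta>"
      using cs by eventually_elim (use d in auto)
    with err show "\<exists>cs. (\<forall>\<^sub>F n in sequentially. valid_code P1 P2 N s2 n (cs n) \<and>
            ln (real (msz1 (cs n))) / real n > fst R - \<delta> \<and>
            ln (real (msz2 (cs n))) / real n > snd R - \<delta>) \<and>
        (\<lambda>n. err_prob N s2 n (cs n)) \<longlonglongrightarrow> 0" by blast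
  qed
  then show ?thesis by (metis closure_subset closure_eq mem_Collect_eq subsetI subset_antisym)
qed

theorem mainTheorem7:
  fixes P1 P2 N s2 :: real
  assumes "P1 > 0" and "P2 > 0" and "N > 0" and "s2 \<ge> 0"
  shows "region_P P1 P2 N s2 \<subseteq> capacity_NoisyPartialFB P1 P2 N s2"
proof -
  have "achievable P1 P2 N s2 R"
    if R: "R \<in> region_P_eta N s2 \<eta> a1 a2 B2 C" and eta: "0 < \<eta>" and a: "a1 \<in> carrier_vec \<eta>" "a2 \<in> carrier_vec \<eta>"
      and B2: "strictly_lower \<eta> B2" and C: "C \<in> carrier_mat 2 \<eta>" and pw: "power_ok P1 P2 N s2 \<eta> a1 a2 B2"
    for R \<eta> a1 a2 B2 C
  proof -
    note pa = pent_achievable[OF assms eta a B2 pw]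
    consider "det (C * transpose_mat C) \<noteq> 0" "R \<in> pent N s2 \<eta> a1 a2 B2 C"
      | i where "i < 2" "row C i \<noteq> 0\<^sub>v \<eta>" "R \<in> pent N s2 \<eta> a1 a2 B2 (mat_of_rows \<eta> [row C i])"
      | "R = (0, 0)"
      using R unfolding region_P_eta_def by (auto split: if_splits)
    then show ?thesis
    proof cases
      case 1
      then show ?thesis using pa[OF C] by auto
    next
      case 2
      define D where "D = mat_of_rows \<eta> [row C i]"
      have r: "row C i \<in> carrier_vec \<eta>" using C 2(1) by simp
      have D: "D \<in> carrier_mat 1 \<eta>" using mat_of_rows_carrier(1)[of \<eta> "[row C i]"] by (simp add: D_def)
      \<comment> \<open>A nonzero row gives a 1 x 1 matrix with nonzero entry, so the singular case
        becomes the nonsingular one with a single row.\<close>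
      have "det (D * transpose_mat D) = row C i \<bullet> row C i"
        using D r by (subst det_single) (auto simp: D_def mat_of_rows_row)
      moreover have "row C i \<bullet> row C i \<noteq> 0"
        using conjugate_square_eq_0_vec[OF r] 2(2) by simp
      ultimately show ?thesis using pa[OF D] 2(3) by (simp add: D_def)
    next
      case 3
      then show ?thesis using achievable_zero[of P1 P2 N s2] assms by simp
    qed
  qed
  then show ?thesis
    unfolding region_P_def capacity_NoisyPartialFB_def
    by (intro closure_minimal closed_achievable) auto
qed

end
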